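(* Let $c>30$, and let $n>0$ and $0\le m\le n-1$ be integers with $n>\frac{2c}{\pi}+5$. Let $t_1<\dots<t_n$ be the roots of $\psi_n$ in $(-1,1)$ and $W_j=\frac{1}{\psi_n'(t_j)}\int_{-1}^1\frac{\psi_n(s)\,ds}{s-t_j}$. Then $$\Big|\int_{-1}^1\psi_m(s)\,ds-\sum_{j=1}^n\psi_m(t_j)W_j\Big|\le|\lambda_n|\Big(24\log\frac{1}{|\lambda_n|}+6\chi_n\Big).$$
   Context: For a real number $c>0$, let $F_c[\varphi](x)=\int_{-1}^1\varphi(t)e^{icxt}\,dt$ on $L^2[-1,1]$, with eigenvalues $\lambda_0,\lambda_1,\dots$ ordered so that $|\lambda_n|\ge|\lambda_{n+1}|$ (nonzero, simple, $\lambda_n=i^n|\lambda_n|$) and corresponding real eigenfunctions $\psi_0,\psi_1,\dots$ (prolate spheroidal wave functions of band limit $c$) with $\|\psi_n\|_{L^2[-1,1]}=1$; $\psi_n$ has the parity of $n$ and exactly $n$ simple roots in $(-1,1)$. There is a strictly increasing sequence of positive numbers $\chi_0<\chi_1<\dots$ such that $\psi_n$ satisfies $(1-x^2)\psi''(x)-2x\psi'(x)+(\chi_n-c^2x^2)\psi(x)=0$, and $\chi_n$ is the unique value for which this ODE has a solution continuous on $[-1,1]$ whose multiples are exactly those of $\psi_n$. *)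

theory Defs
  imports "HOL-Analysis.Analysis"
begin

definition finite_fourier :: "real \<Rightarrow> (real \<Rightarrow> real) \<Rightarrow> real \<Rightarrow> complex" where
  "finite_fourier c \<phi> x =
     integral {-1..1} (\<lambda>t. complex_of_real (\<phi> t) * exp (\<i> * complex_of_real (c * x * t)))"

definition roots_in :: "(real \<Rightarrow> real) \<Rightarrow> real set" where
  "roots_in f = {t. -1 < t \<and> t < 1 \<and> f t = 0}"

text \<open>psi, lam, chi are the prolate spheroidal wave functions of band limit c,
  the eigenvalues of F_c and the Sturm-Liouville eigenvalues chi_n.
  psi n is a real, L2-normalised eigenfunction of F_c with eigenvalue lam n
  having exactly n simple roots in (-1,1) (this fixes psi n up to sign),
  and it solves the prolate ODE with parameter chi n.\<close>
definition pswf_system ::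
  "real \<Rightarrow> (nat \<Rightarrow> real \<Rightarrow> real) \<Rightarrow> (nat \<Rightarrow> complex) \<Rightarrow> (nat \<Rightarrow> real) \<Rightarrow> bool" where
  "pswf_system c psi lam chi \<longleftrightarrow>
     (\<forall>n. continuous_on {-1..1} (psi n)
        \<and> integral {-1..1} (\<lambda>t. (psi n t)\<^sup>2) = 1
        \<and> lam n \<noteq> 0
        \<and> cmod (lam n) \<ge> cmod (lam (Suc n))
        \<and> lam n = \<i> ^ n * complex_of_real (cmod (lam n))
        \<and> (\<forall>x\<in>{-1..1}. finite_fourier c (psi n) x = lam n * complex_of_real (psi n x))
        \<and> finite (roots_in (psi n)) \<and> card (roots_in (psi n)) = n
        \<and> (\<forall>t\<in>roots_in (psi n). deriv (psi n) t \<noteq> 0)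
        \<and> 0 < chi n \<and> chi n < chi (Suc n)
        \<and> (\<forall>x\<in>{-1<..<1}.
             (psi n has_real_derivative deriv (psi n) x) (at x)
           \<and> (deriv (psi n) has_real_derivative deriv (deriv (psi n)) x) (at x)
           \<and> (1 - x\<^sup>2) * deriv (deriv (psi n)) x - 2 * x * deriv (psi n) x
               + (chi n - c\<^sup>2 * x\<^sup>2) * psi n x = 0))"

end

theory Submission
  imports Defs "HOL-Complex_Analysis.Complex_Analysis" "HOL-Real_Asymp.Real_Asymp"
begin

text \<open>Each \<^term>\<open>psi n\<close> extends to an entire function, and the quadrature error is the contribution
to the partial fraction expansion of psi m / psi n of the zeros of psi n outside [-1,1]: a residue
computation on growing squares writes psi m on [-1,1] as psi n times the sum over all zeros x of
psi m x / (psi n' x * (s - x)), up to an additive multiple of psi n controlled by the asymptotics at infinity.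
Counting the roots by a Riccati equation shows that chi n > c^2; then all zeros are real, by monotonicity
of a flux along rays. At an outer zero x, psi m x is bounded by the total variation of psi m,
the slope psi n' x is bounded below by a Lyapunov function of the equation whose limit at infinity is known,
and the integral of psi n s / (x - s) is bounded by means of the Laplace transform of psi n. Comparison with the
Riccati equation separates consecutive outer zeros by at least pi / (sqrt 2 * c), so the contributions can be
summed; for even n and m the far zeros need a better bound on psi m, taken from the Wronskian of psi m and psi n.
The total is about |lam n| * (chi n)^(7/8), which leaves enough room to absorb the logarithm,
since |lam n| is at most 2.13. For odd m the error vanishes by symmetry.\<close>

section \<open>The entire extension\<close>

text \<open>Each outer term carries three powers of the eigenvalues: 1/|lam m| from the decay of psi
  m, |lam n| from the reciprocal slope of psi n, and |lam n| again from the transform of psi n,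
  because its Laplace transform starts from lam n times values of psi n at 0. As |lam n| \<le> |lam
  m|, one factor |lam n| survives. The obstacle is the summation. In the variable s = c x - sqrt
  (chi n) the terms decay like s^(-3/2) for odd n, but only like 1/s for even n, and then the bounds
  have no finite sum; the Wronskian improves them to 1/s^2 at the price of a factor of order chi n
  times the variation of psi n, so it is applied only beyond s = (chi n)^2, which costs a logarithm.
  Since chi m may lie below c^2, the variation of psi m is estimated from integral identities
  instead of the monotone energy available for psi n. The exponent 7/8 is 1/2 + 1/8 from the
  variation, where the root of a logarithm is counted as 1/8, plus 1/4 from the sum. The lower bound
  on n enters through the root count, and c > 30 through chi n > 900.\<close>

lemma entire_eqI:
  assumes "f holomorphic_on UNIV" "g holomorphic_on UNIV"
    and "\<And>x::real. -1 < x \<Longrightarrow> x < 1 \<Longrightarrow> f (of_real x) = g (of_real x)"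
  shows "f z = g z"
proof -
  have lim: "(0::complex) islimpt (of_real ` {-1<..<1})"
    unfolding islimpt_approachable
  proof (intro allI impI)
    fix e :: real assume e: "e > 0"
    let ?x = "min (e/2) (1/2)"
    have "?x \<in> {-1<..<1}" using e by (auto simp: min_def)
    hence "of_real ?x \<in> complex_of_real ` {-1<..<1}" by (rule imageI)
    moreover have "complex_of_real ?x \<noteq> 0" "dist (complex_of_real ?x) 0 < e" using e
      by (auto simp: min_def)
    ultimately show "\<exists>x'\<in>complex_of_real ` {-1<..<1}. x' \<noteq> 0 \<and> dist x' 0 < e" by blast
  qed
  have "f z - g z = 0"
    by (rule analytic_continuation[of "\<lambda>z. f z - g z" UNIV "of_real ` {-1<..<1}" 0])
       (use assms lim in \<open>auto intro!: holomorphic_intros\<close>)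
  thus ?thesis by simp
qed

lemma entire_real_on_reals:
  assumes H: "H holomorphic_on UNIV" and r: "\<And>x::real. H (of_real x) \<in> \<real>"
  shows "((\<lambda>x. Re (H (of_real x))) has_real_derivative Re (deriv H (of_real x))) (at x)"
    and "deriv H (of_real x) \<in> \<real>"
proof -
  have d: "(H has_field_derivative deriv H (of_real x)) (at (of_real x))"
    using H by (simp add: holomorphic_derivI)
  have v: "((\<lambda>x. H (of_real x)) has_vector_derivative deriv H (of_real x)) (at x)"
    using has_vector_derivative_real_field[OF d] by simp
  show "((\<lambda>x. Re (H (of_real x))) has_real_derivative Re (deriv H (of_real x))) (at x)"
    using bounded_linear.has_vector_derivative[OF bounded_linear_Re v]
    by (simp add: has_real_derivative_iff_has_vector_derivative)
  have i: "((\<lambda>x. Im (H (of_real x))) has_real_derivative Im (deriv H (of_real x))) (at x)"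
    using bounded_linear.has_vector_derivative[OF bounded_linear_Im v]
    by (simp add: has_real_derivative_iff_has_vector_derivative)
  have "(\<lambda>x::real. Im (H (of_real x))) = (\<lambda>x. 0)" using r by (auto simp: complex_is_Real_iff)
  hence "Im (deriv H (of_real x)) = 0" using i by (metis DERIV_const DERIV_unique)
  thus "deriv H (of_real x) \<in> \<real>" by (simp add: complex_is_Real_iff)
qed

text \<open>One eigenfunction with its two eigenvalues, \<open>\<mu>\<close> for the Fourier
  operator and \<open>ch\<close> for the ODE. The index \<open>k\<close> acts through the phase of
  \<open>\<mu>\<close>, from which the parity of the eigenfunction is derived.\<close>

locale prolate =
  fixes c ch :: real and \<mu> :: complex and f :: "real \<Rightarrow> real" and k :: nat
  assumes c_pos: "c > 0"
    and f_cont: "continuous_on {-1..1} f"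
    and f_norm: "integral {-1..1} (\<lambda>t. (f t)\<^sup>2) = 1"
    and mu_nz: "\<mu> \<noteq> 0"
    and mu_phase: "\<mu> = \<i> ^ k * complex_of_real (cmod \<mu>)"
    and f_eig: "\<And>x. x \<in> {-1..1} \<Longrightarrow> finite_fourier c f x = \<mu> * complex_of_real (f x)"
    and f_deriv: "\<And>x. x \<in> {-1<..<1} \<Longrightarrow> (f has_real_derivative deriv f x) (at x)"
    and f_deriv2: "\<And>x. x \<in> {-1<..<1} \<Longrightarrow> (deriv f has_real_derivative deriv (deriv f) x) (at x)"
    and f_ode: "\<And>x. x \<in> {-1<..<1} \<Longrightarrow>
      (1 - x\<^sup>2) * deriv (deriv f) x - 2 * x * deriv f x + (ch - c\<^sup>2 * x\<^sup>2) * f x = 0"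
begin

text \<open>The eigenvalue equation solved for the eigenfunction; the integral runs over a compact
  interval, so it makes sense at every complex argument.\<close>

definition F :: "complex \<Rightarrow> complex" where
  "F z = integral {-1..1} (\<lambda>t. complex_of_real (f t) * exp (\<i> * of_real c * z * of_real t)) / \<mu>"

text \<open>The hypotheses constrain \<^term>\<open>f\<close> on [-1,1] only; beyond this interval its analytic continuation \<open>g\<close> takes over.\<close>
definition g :: "real \<Rightarrow> real" where "g x = Re (F (of_real x))"
definition g1 :: "real \<Rightarrow> real" where "g1 x = Re (deriv F (of_real x))"
definition g2 :: "real \<Rightarrow> real" where "g2 x = Re (deriv (deriv F) (of_real x))"

lemma F_holo: "F holomorphic_on A"
proof -
  have c1: "continuous_on {-1..1} (\<lambda>t. complex_of_real (f t))"
    using f_cont by (intro continuous_intros)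
  have c2: "continuous_on (UNIV \<times> {-1..1}) (\<lambda>p. complex_of_real (f (snd p)))"
    by (rule continuous_on_compose2[OF c1]) (auto intro!: continuous_intros)
  have "(\<lambda>z. integral (cbox (-1) (1::real)) (\<lambda>t. complex_of_real (f t) * exp (\<i> * of_real c * z * of_real t))) holomorphic_on UNIV"
  proof (rule leibniz_rule_holomorphic[where fx = "\<lambda>z t. complex_of_real (f t) * (exp (\<i> * of_real c * z * of_real t) * (\<i> * of_real c * of_real t))"])
    show "((\<lambda>x. complex_of_real (f t) * exp (\<i> * complex_of_real c * x * complex_of_real t)) has_field_derivative
            complex_of_real (f t) * (exp (\<i> * complex_of_real c * x * complex_of_real t) * (\<i> * complex_of_real c * complex_of_real t)))
            (at x within UNIV)" for x t
      by (auto intro!: derivative_eq_intros)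
    show "(\<lambda>t. complex_of_real (f t) * exp (\<i> * complex_of_real c * x * complex_of_real t)) integrable_on cbox (- 1) 1" for x
      using c1 by (intro integrable_continuous) (auto intro!: continuous_intros)
    show "continuous_on (UNIV \<times> cbox (- 1) 1)
     (\<lambda>(x, t). complex_of_real (f t) *
        (exp (\<i> * complex_of_real c * x * complex_of_real t) * (\<i> * complex_of_real c * complex_of_real t)))"
      using c2 by (auto simp: case_prod_unfold intro!: continuous_intros)
  qed auto
  hence "F holomorphic_on UNIV"
    unfolding F_def[abs_def] using mu_nz by (auto intro!: holomorphic_intros)
  thus ?thesis using holomorphic_on_subset by blast
qed

lemma F_fourier: "\<mu> * F z = integral {-1..1} (\<lambda>t. complex_of_real (f t) * exp (\<i> * of_real c * z * of_real t))"
  using mu_nz by (simp add: F_def)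

lemma F_eq: assumes "x \<in> {-1..1}" shows "F (of_real x) = of_real (f x)"
proof -
  have "\<mu> * F (of_real x) = finite_fourier c f x"
    unfolding F_fourier finite_fourier_def by (simp add: mult.assoc)
  thus ?thesis using f_eig[OF assms] mu_nz by simp
qed

lemma F_cnj: "F (cnj z) = cnj (F z)"
proof -
  have h: "(\<lambda>z. cnj (F (cnj z))) holomorphic_on UNIV"
    using holomorphic_on_compose_cnj_cnj[of F UNIV] F_holo by (simp add: o_def)
  have "cnj (F (cnj (cnj z))) = F (cnj z)"
    by (rule entire_eqI[OF h F_holo]) (simp add: F_eq)
  thus ?thesis by simp
qed

lemma F_real: "F (of_real x) \<in> \<real>"
  using F_cnj[of "of_real x"] by (simp add: Reals_cnj_iff)

lemma F_of_real: "F (of_real x) = of_real (g x)"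
  using F_real[of x] by (simp add: g_def complex_is_Real_iff complex_eq_iff)

lemma dF_holo: "deriv F holomorphic_on A"
  using holomorphic_deriv[OF F_holo[of UNIV]] holomorphic_on_subset by blast
lemma ddF_holo: "deriv (deriv F) holomorphic_on A"
  using holomorphic_deriv[OF dF_holo[of UNIV]] holomorphic_on_subset by blast

lemma dF: "(F has_field_derivative deriv F z) (at z within A)"
  using F_holo[of UNIV] by (meson UNIV_I has_field_derivative_at_within holomorphic_derivI open_UNIV)
lemma ddF: "(deriv F has_field_derivative deriv (deriv F) z) (at z within A)"
  using dF_holo[of UNIV] by (meson UNIV_I has_field_derivative_at_within holomorphic_derivI open_UNIV)

lemma dF_of_real: "deriv F (of_real x) = of_real (g1 x)"
  using entire_real_on_reals(2)[OF F_holo F_real, of x] by (simp add: g1_def complex_is_Real_iff complex_eq_iff)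
lemma ddF_of_real: "deriv (deriv F) (of_real x) = of_real (g2 x)"
proof -
  have "deriv F (complex_of_real x) \<in> \<real>" for x by (simp add: dF_of_real)
  from entire_real_on_reals(2)[OF dF_holo this, of x] show ?thesis
    by (simp add: g2_def complex_is_Real_iff complex_eq_iff)
qed
lemma g_deriv: "(g has_real_derivative g1 x) (at x within A)"
  using entire_real_on_reals(1)[OF F_holo F_real, of x] unfolding g_def[abs_def] g1_def
  using has_field_derivative_at_within by blast
lemma g1_deriv: "(g1 has_real_derivative g2 x) (at x within A)"
proof -
  have "deriv F (complex_of_real x) \<in> \<real>" for x by (simp add: dF_of_real)
  from entire_real_on_reals(1)[OF dF_holo this, of x] show ?thesis
    unfolding g1_def[abs_def] g2_def using has_field_derivative_at_within by blast
qed

lemma g_eq: "x \<in> {-1..1} \<Longrightarrow> g x = f x" by (simp add: g_def F_eq)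

lemma g1_eq: assumes "x \<in> {-1<..<1}" shows "deriv f x = g1 x"
proof -
  have "(g has_real_derivative deriv f x) (at x)"
    by (rule has_field_derivative_transform_within_open[OF f_deriv[OF assms], of "{-1<..<1}"])
       (use assms g_eq in auto)
  thus ?thesis using g_deriv[of x UNIV] DERIV_unique by blast
qed

lemma g2_eq: assumes "x \<in> {-1<..<1}" shows "deriv (deriv f) x = g2 x"
proof -
  have "(g1 has_real_derivative deriv (deriv f) x) (at x)"
    by (rule has_field_derivative_transform_within_open[OF f_deriv2[OF assms], of "{-1<..<1}"])
       (use assms g1_eq in auto)
  thus ?thesis using g1_deriv[of x UNIV] DERIV_unique by blast
qed

lemma F_ode: "(1 - z\<^sup>2) * deriv (deriv F) z - 2 * z * deriv F z + (of_real ch - of_real (c\<^sup>2) * z\<^sup>2) * F z = 0"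
proof (rule entire_eqI[where f = "\<lambda>z. (1 - z\<^sup>2) * deriv (deriv F) z - 2 * z * deriv F z +
          (complex_of_real ch - complex_of_real (c\<^sup>2) * z\<^sup>2) * F z" and g = "\<lambda>z. 0" and z = z])
  show "(\<lambda>z. (1 - z\<^sup>2) * deriv (deriv F) z - 2 * z * deriv F z +
          (complex_of_real ch - complex_of_real (c\<^sup>2) * z\<^sup>2) * F z) holomorphic_on UNIV"
    by (intro holomorphic_intros F_holo dF_holo ddF_holo)
  fix x :: real assume x: "-1 < x" "x < 1"
  have "(1 - x\<^sup>2) * g2 x - 2 * x * g1 x + (ch - c\<^sup>2 * x\<^sup>2) * g x = 0"
    using f_ode[of x] x g1_eq[of x] g2_eq[of x] g_eq[of x] by auto
  hence "complex_of_real ((1 - x\<^sup>2) * g2 x - 2 * x * g1 x + (ch - c\<^sup>2 * x\<^sup>2) * g x) = 0" by simp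
  thus "(1 - (complex_of_real x)\<^sup>2) * deriv (deriv F) (complex_of_real x) -
         2 * complex_of_real x * deriv F (complex_of_real x) +
         (complex_of_real ch - complex_of_real (c\<^sup>2) * (complex_of_real x)\<^sup>2) * F (complex_of_real x) = 0"
    by (simp add: F_of_real dF_of_real ddF_of_real)
qed auto

lemma g_ode: "(1 - x\<^sup>2) * g2 x - 2 * x * g1 x + (ch - c\<^sup>2 * x\<^sup>2) * g x = 0"
proof -
  have "complex_of_real ((1 - x\<^sup>2) * g2 x - 2 * x * g1 x + (ch - c\<^sup>2 * x\<^sup>2) * g x) = 0"
    using F_ode[of "of_real x"] by (simp add: F_of_real dF_of_real ddF_of_real)
  thus ?thesis by (simp only: of_real_eq_0_iff)
qed

text \<open>The ODE in divergence form. The flux on the left vanishes at 1 and -1, so energy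
  arguments starting or ending there produce no boundary term.\<close>

lemma F_flux: "((\<lambda>z. (z\<^sup>2 - 1) * deriv F z) has_field_derivative (of_real ch - of_real (c\<^sup>2) * z\<^sup>2) * F z) (at z within A)"
proof -
  have "((\<lambda>z. (z\<^sup>2 - 1) * deriv F z) has_field_derivative 2 * z * deriv F z + deriv (deriv F) z * (z\<^sup>2 - 1)) (at z within A)"
    by (auto intro!: derivative_eq_intros ddF)
  moreover have "2 * z * deriv F z + deriv (deriv F) z * (z\<^sup>2 - 1) = (of_real ch - of_real (c\<^sup>2) * z\<^sup>2) * F z"
    using F_ode[of z] by (simp add: algebra_simps)
  ultimately show ?thesis by metis
qed

lemma g_flux: "((\<lambda>x. (x\<^sup>2 - 1) * g1 x) has_real_derivative (ch - c\<^sup>2 * x\<^sup>2) * g x) (at x within A)"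
proof -
  have "((\<lambda>x. (x\<^sup>2 - 1) * g1 x) has_real_derivative 2 * x * g1 x + g2 x * (x\<^sup>2 - 1)) (at x within A)"
    by (auto intro!: derivative_eq_intros g1_deriv)
  moreover have "2 * x * g1 x + g2 x * (x\<^sup>2 - 1) = (ch - c\<^sup>2 * x\<^sup>2) * g x"
    using g_ode[of x] by (simp add: algebra_simps)
  ultimately show ?thesis by metis
qed

text \<open>Since \<open>f\<close> is real, reversing a real argument conjugates the Fourier
  integral, while \<mu> in \<i>^k times the positive reals satisfies cnj \<mu> = (-1)^k
  \<mu>.\<close>

lemma F_parity: "F (-z) = (-1) ^ k * F z"
proof -
  have h: "(\<lambda>z. F (-z)) holomorphic_on UNIV"
    using holomorphic_on_compose[of uminus UNIV F, OF _ F_holo] by (simp add: o_def holomorphic_on_minus)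
  have i: "cnj \<mu> = (-1)^k * \<mu>"
    by (subst mu_phase, subst (2) mu_phase) (simp add: power_mult_distrib flip: power_mult_distrib)
  show ?thesis
  proof (rule entire_eqI[OF h])
    show "(\<lambda>z. (-1) ^ k * F z) holomorphic_on UNIV" by (intro holomorphic_intros F_holo)
    fix x :: real assume x: "-1 < x" "x < 1"
    have "\<mu> * F (- of_real x) = cnj (\<mu> * F (of_real x))"
      unfolding F_fourier integral_cnj by (simp add: exp_cnj)
    also have "\<dots> = (-1)^k * \<mu> * F (of_real x)" by (simp add: F_of_real i)
    finally show "F (- complex_of_real x) = (-1) ^ k * F (complex_of_real x)" using mu_nz by simp
  qed
qed

lemma g_parity: "g (-x) = (-1) ^ k * g x"
proof -
  have "complex_of_real (g (-x)) = of_real ((-1) ^ k * g x)"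
    using F_parity[of "of_real x"] by (simp flip: F_of_real)
  thus ?thesis by (simp only: of_real_eq_iff)
qed

lemma g1_parity: "g1 (-x) = - ((-1) ^ k * g1 x)"
proof -
  have a: "((\<lambda>x. g (-x)) has_real_derivative - g1 (-x)) (at x)"
    using DERIV_chain2[where f = g and g = "\<lambda>x. - x" and x = x and Db = "-1" and s = UNIV, OF g_deriv]
    by (simp add: DERIV_minus)
  have b: "((\<lambda>x. g (-x)) has_real_derivative (-1)^k * g1 x) (at x)"
    unfolding g_parity by (auto intro!: derivative_eq_intros g_deriv)
  from DERIV_unique[OF a b] show ?thesis by simp
qed

lemma cont_g: "continuous_on A g"
  by (meson DERIV_continuous continuous_on_eq_continuous_within g_deriv)
lemma cont_g1: "continuous_on A g1"
  by (meson DERIV_continuous continuous_on_eq_continuous_within g1_deriv)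

lemma g_norm: "integral {-1..1} (\<lambda>t. (g t)\<^sup>2) = 1"
  using f_norm by (subst integral_cong[of _ _ "\<lambda>t. (f t)\<^sup>2"]) (auto simp: g_eq)

lemma F_fourier_g: "\<mu> * F z = integral {-1..1} (\<lambda>t. complex_of_real (g t) * exp (\<i> * of_real c * z * of_real t))"
  unfolding F_fourier by (rule integral_cong) (simp add: g_eq)

end

section \<open>Energy estimates and reality of the zeros\<close>

text \<open>Under this assumption the turning point sqrt ch / c, where the coefficient ch - c^2 x^2
  changes sign, lies to the right of 1.\<close>

locale prolate_high = prolate +
  assumes ch_gt: "ch > c\<^sup>2"
begin

lemma ch_pos: "ch > 0" using ch_gt by (meson le_less_trans zero_le_power2)

lemma q_pos: assumes "\<bar>x\<bar> \<le> 1" shows "ch - c\<^sup>2 * x\<^sup>2 > 0"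
proof -
  have "x\<^sup>2 \<le> 1" using assms by (simp add: abs_square_le_1)
  hence "c\<^sup>2 * x\<^sup>2 \<le> c\<^sup>2" by (simp add: mult_left_le)
  thus ?thesis using ch_gt by simp
qed

text \<open>The ODE cancels the product of \<open>g\<close> and \<open>g1\<close> in the derivative.
  The two remaining terms, collected in \<open>?D\<close>, are nonnegative: one is what the damping
  term leaves after the decrease of 1 - x^2, the other comes from the decrease of ch - c^2 x^2. At 1
  the energy is just g(1)^2.\<close>

lemma energy_mono:
  assumes "0 \<le> x" "x \<le> y" "y \<le> 1"
  shows "(g x)\<^sup>2 + (1 - x\<^sup>2) * (g1 x)\<^sup>2 / (ch - c\<^sup>2 * x\<^sup>2) \<le> (g y)\<^sup>2 + (1 - y\<^sup>2) * (g1 y)\<^sup>2 / (ch - c\<^sup>2 * y\<^sup>2)"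
proof (rule DERIV_nonneg_imp_nondecreasing[OF assms(2)])
  fix t assume t: "x \<le> t" "t \<le> y"
  define q where "q = ch - c\<^sup>2 * t\<^sup>2"
  have q: "q > 0" unfolding q_def using q_pos[of t] t assms by auto
  let ?D = "2 * t * (g1 t)\<^sup>2 / q + 2 * c\<^sup>2 * t * (1 - t\<^sup>2) * (g1 t)\<^sup>2 / q\<^sup>2"
  have ode: "(1 - t\<^sup>2) * g2 t = 2 * t * g1 t - q * g t" using g_ode[of t] by (simp add: q_def)
  have "((\<lambda>x. (g x)\<^sup>2 + (1 - x\<^sup>2) * (g1 x)\<^sup>2 / (ch - c\<^sup>2 * x\<^sup>2)) has_real_derivative
     (2 * g t * g1 t + ((- 2 * t * (g1 t)\<^sup>2 + (1 - t\<^sup>2) * (2 * g1 t * g2 t)) * q - (1 - t\<^sup>2) * (g1 t)\<^sup>2 * (- c\<^sup>2 * (2 * t))) / (q * q))) (at t)"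
    unfolding q_def
    by (rule derivative_eq_intros g_deriv g1_deriv refl | use q in \<open>simp add: q_def\<close>)+
  also have "(2 * g t * g1 t + ((- 2 * t * (g1 t)\<^sup>2 + (1 - t\<^sup>2) * (2 * g1 t * g2 t)) * q - (1 - t\<^sup>2) * (g1 t)\<^sup>2 * (- c\<^sup>2 * (2 * t))) / (q * q))
     = 2 * g t * g1 t + ((- 2 * t * (g1 t)\<^sup>2 + 2 * g1 t * ((1 - t\<^sup>2) * g2 t)) * q - (1 - t\<^sup>2) * (g1 t)\<^sup>2 * (- c\<^sup>2 * (2 * t))) / (q * q)"
    by (simp add: algebra_simps)
  also have "\<dots> = ?D" unfolding ode using q by (simp add: field_simps power2_eq_square)
  finally have "((\<lambda>x. (g x)\<^sup>2 + (1 - x\<^sup>2) * (g1 x)\<^sup>2 / (ch - c\<^sup>2 * x\<^sup>2)) has_real_derivative ?D) (at t)" .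
  moreover have "?D \<ge> 0"
  proof -
    have "1 - t\<^sup>2 \<ge> 0" using t assms by (simp add: abs_square_le_1)
    thus ?thesis using q t assms by (intro add_nonneg_nonneg divide_nonneg_nonneg mult_nonneg_nonneg) auto
  qed
  ultimately show "\<exists>D. ((\<lambda>x. (g x)\<^sup>2 + (1 - x\<^sup>2) * (g1 x)\<^sup>2 / (ch - c\<^sup>2 * x\<^sup>2)) has_real_derivative D) (at t) \<and> 0 \<le> D" by blast
qed

lemma g_sq_even: "(g (-x))\<^sup>2 = (g x)\<^sup>2"
  by (simp add: g_parity power_mult_distrib flip: power_mult)

lemma g_le_g_one: assumes "\<bar>x\<bar> \<le> 1" shows "(g x)\<^sup>2 \<le> (g 1)\<^sup>2"
proof -
  have *: "(g x)\<^sup>2 \<le> (g 1)\<^sup>2" if "0 \<le> x" "x \<le> 1" for x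
  proof -
    have "(1 - x\<^sup>2) * (g1 x)\<^sup>2 / (ch - c\<^sup>2 * x\<^sup>2) \<ge> 0"
      using q_pos[of x] that by (intro divide_nonneg_nonneg mult_nonneg_nonneg) (auto simp: abs_square_le_1)
    thus ?thesis using energy_mono[of x 1] that by simp
  qed
  show ?thesis using *[of x] *[of "-x"] assms by (cases "x \<ge> 0") (auto simp: g_sq_even)
qed

text \<open>The maximum of g^2 on [-1,1] sits at the ends, and its mean over this interval of length
  2 is 1/2.\<close>

lemma g_one_sq_ge: "(g 1)\<^sup>2 \<ge> 1 / 2"
proof -
  have "integral {-1..1} (\<lambda>t. (g t)\<^sup>2) \<le> integral {-1..1::real} (\<lambda>t. (g 1)\<^sup>2)"
    by (intro integral_le integrable_continuous_real continuous_intros cont_g g_le_g_one) auto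
  thus ?thesis using g_norm by simp
qed

lemma g_one_nz: "g 1 \<noteq> 0" using g_one_sq_ge by auto

lemma g0_bounds: "\<bar>g 0\<bar> \<le> \<bar>g 1\<bar>" "(g1 0)\<^sup>2 \<le> ch * (g 1)\<^sup>2"
proof -
  have "(g 0)\<^sup>2 + (g1 0)\<^sup>2 / ch \<le> (g 1)\<^sup>2" using energy_mono[of 0 1] by simp
  moreover have "(g1 0)\<^sup>2 / ch \<ge> 0" using ch_pos by simp
  ultimately have a: "(g 0)\<^sup>2 \<le> (g 1)\<^sup>2" "(g1 0)\<^sup>2 / ch \<le> (g 1)\<^sup>2"
    using zero_le_power2[of "g 0"] by linarith+
  show "\<bar>g 0\<bar> \<le> \<bar>g 1\<bar>" using a(1) by (simp add: abs_le_square_iff)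
  show "(g1 0)\<^sup>2 \<le> ch * (g 1)\<^sup>2" using a(2) ch_pos by (simp add: field_simps)
qed

section \<open>Exclusion of nonreal zeros\<close>

lemma F_not_zero_on_segment:
  assumes "\<kappa> \<noteq> 0" "\<And>r::real. 0 < r \<Longrightarrow> r < 1 \<Longrightarrow> F (p + of_real r * \<kappa>) = 0"
  shows False
proof -
  have lim: "p islimpt ((\<lambda>r::real. p + of_real r * \<kappa>) ` {0<..<1})"
    unfolding islimpt_approachable
  proof (intro allI impI)
    fix e :: real assume e: "e > 0"
    define r where "r = min (1/2) (e / (2 * cmod \<kappa>))"
    have r: "0 < r" "r < 1" "r * cmod \<kappa> < e" using e assms(1)
      by (auto simp: r_def min_def field_simps)
    show "\<exists>x'\<in>(\<lambda>r::real. p + of_real r * \<kappa>) ` {0<..<1}. x' \<noteq> p \<and> dist x' p < e"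
      using r assms(1) by (intro bexI[of _ "p + of_real r * \<kappa>"]) (auto simp: dist_norm norm_mult)
  qed
  have "F 1 = 0"
    by (rule analytic_continuation[of F UNIV "(\<lambda>r::real. p + of_real r * \<kappa>) ` {0<..<1}" p])
       (use F_holo lim assms(2) in auto)
  thus False using F_of_real[of 1] g_one_nz by simp
qed

text \<open>A nondecreasing \<open>M\<close> with equal end values is constant, so its derivative
  vanishes and the lower bound forces \<open>F\<close> to be zero along the whole segment. The
  weight \<open>A\<close> has to be positive only in the interior, because on a ray from 1 it
  vanishes at the starting point.\<close>

lemma no_zero_by_monotonicity:
  assumes "\<kappa> \<noteq> 0" and M: "\<And>r. 0 \<le> r \<Longrightarrow> r \<le> 1 \<Longrightarrow> (M has_real_derivative M' r) (at r)"
    and "M 0 = 0" "M 1 = 0"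
    and ge: "\<And>r. 0 \<le> r \<Longrightarrow> r \<le> 1 \<Longrightarrow> M' r \<ge> A r * (cmod (F (p + of_real r * \<kappa>)))\<^sup>2"
    and A: "\<And>r. 0 \<le> r \<Longrightarrow> r \<le> 1 \<Longrightarrow> A r \<ge> 0" "\<And>r. 0 < r \<Longrightarrow> r < 1 \<Longrightarrow> A r > 0"
  shows False
proof (rule F_not_zero_on_segment[OF assms(1)])
  have nn: "M' r \<ge> 0" if "0 \<le> r" "r \<le> 1" for r
    using ge[OF that] A(1)[OF that] by (smt (verit) mult_nonneg_nonneg zero_le_power2)
  have mono: "M x \<le> M y" if "0 \<le> x" "x \<le> y" "y \<le> 1" for x y
    using that M nn by (intro DERIV_nonneg_imp_nondecreasing[OF that(2)]) (meson order_trans)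
  fix r :: real assume r: "0 < r" "r < 1"
  have "M x = 0" if "x \<in> {0<..<1}" for x
    using mono[of 0 x] mono[of x 1] that assms by auto
  hence "(M has_real_derivative 0) (at r)"
    using has_field_derivative_transform_within_open[of "\<lambda>_. 0" 0 r "{0<..<1}" M] r by auto
  hence "M' r = 0" using M[of r] r DERIV_unique by force
  hence "A r * (cmod (F (p + of_real r * \<kappa>)))\<^sup>2 \<le> 0" using ge[of r] r by simp
  hence "(cmod (F (p + of_real r * \<kappa>)))\<^sup>2 \<le> 0" using A(2)[OF r] by (simp add: mult_le_0_iff)
  thus "F (p + of_real r * \<kappa>) = 0" by simp
qed

text \<open>Green's identity along a segment: the flux is multiplied by the conjugate of
  \<open>F\<close>. The derivative is a combination of |F|^2 and |F'|^2 with explicit coefficients,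
  so a suitable direction \<open>\<kappa>\<close> and a real or imaginary part make both
  coefficients one-signed.\<close>

lemma flux_pairing:
  fixes p \<kappa> :: complex
  assumes "\<kappa> \<noteq> 0"
  defines "Z \<equiv> \<lambda>r::real. p + of_real r * \<kappa>"
  shows "((\<lambda>r. ((Z r)\<^sup>2 - 1) / \<kappa> * deriv F (Z r) * cnj (F (Z r))) has_vector_derivative
     (of_real ch - of_real (c\<^sup>2) * (Z r)\<^sup>2) * of_real ((cmod (F (Z r)))\<^sup>2) +
     ((Z r)\<^sup>2 - 1) / \<kappa> * cnj \<kappa> * of_real ((cmod (deriv F (Z r)))\<^sup>2)) (at r)"
proof -
  have Z: "(Z has_vector_derivative \<kappa>) (at r)" unfolding Z_def
    by (auto intro!: derivative_eq_intros simp: scaleR_conv_of_real)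
  have "((\<lambda>r. (\<lambda>z. (z\<^sup>2 - 1) * deriv F z) (Z r)) has_vector_derivative \<kappa> * ((of_real ch - of_real (c\<^sup>2) * (Z r)\<^sup>2) * F (Z r))) (at r)"
    using field_vector_diff_chain_at[OF Z F_flux] by (simp add: o_def)
  from has_vector_derivative_mult_right[OF this, of "1/\<kappa>"]
  have a: "((\<lambda>r. ((Z r)\<^sup>2 - 1) / \<kappa> * deriv F (Z r)) has_vector_derivative ((of_real ch - of_real (c\<^sup>2) * (Z r)\<^sup>2) * F (Z r))) (at r)"
    using assms(1) by (simp only: times_divide_eq_left mult_1_left nonzero_mult_div_cancel_left not_False_eq_True)
  have "((\<lambda>r. F (Z r)) has_vector_derivative \<kappa> * deriv F (Z r)) (at r)"
    using field_vector_diff_chain_at[OF Z dF] by (simp add: o_def)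
  hence b: "((\<lambda>r. cnj (F (Z r))) has_vector_derivative cnj (\<kappa> * deriv F (Z r))) (at r)"
    by (rule has_vector_derivative_cnj)
  show ?thesis
    using has_vector_derivative_mult[OF a b]
    by (rule back_subst[where P = "\<lambda>d. (_ has_vector_derivative d) (at r)"])
       (simp add: complex_norm_square algebra_simps flip: of_real_power)
qed

text \<open>The pairing vanishes at 1 because of the factor z^2 - 1 and at \<open>z\<close> because
  \<open>F\<close> does. Along the ray between them its imaginary part is monotone, since Im (Z^2) >
  0 after the start.\<close>

lemma no_zero_right:
  assumes "F z = 0" "Re z \<ge> 1" "Im z > 0" shows False
proof -
  define \<kappa> where "\<kappa> = z - 1"
  have k: "Re \<kappa> \<ge> 0" "Im \<kappa> > 0" using assms by (auto simp: \<kappa>_def)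
  hence knz: "\<kappa> \<noteq> 0" by auto
  define Z where "Z = (\<lambda>r::real. 1 + of_real r * \<kappa>)"
  have Zq: "((Z r)\<^sup>2 - 1) / \<kappa> = of_real r * (2 + of_real r * \<kappa>)" for r
    using knz by (simp add: Z_def power2_eq_square field_simps)
  define M' where "M' = (\<lambda>r. - Im ((of_real ch - of_real (c\<^sup>2) * (Z r)\<^sup>2) * of_real ((cmod (F (Z r)))\<^sup>2) +
     ((Z r)\<^sup>2 - 1) / \<kappa> * cnj \<kappa> * of_real ((cmod (deriv F (Z r)))\<^sup>2)))"
  define M where "M = (\<lambda>r. - Im (((Z r)\<^sup>2 - 1) / \<kappa> * deriv F (Z r) * cnj (F (Z r))))"
  show False
  proof (rule no_zero_by_monotonicity[where M = M and M' = M' and \<kappa> = \<kappa> and p = 1 and A = "\<lambda>r. 2 * c\<^sup>2 * r * Im \<kappa> * (1 + r * Re \<kappa>)"])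
    show "\<kappa> \<noteq> 0" by fact
    show "(M has_real_derivative M' r) (at r)" for r
      unfolding M_def M'_def Z_def has_real_derivative_iff_has_vector_derivative
      by (intro has_vector_derivative_minus bounded_linear.has_vector_derivative[OF bounded_linear_Im] flux_pairing knz)
    show "M 0 = 0" unfolding M_def Zq by simp
    show "M 1 = 0" unfolding M_def Z_def using assms by (simp add: \<kappa>_def)
    fix r :: real assume r: "0 \<le> r" "r \<le> 1"
    show "2 * c\<^sup>2 * r * Im \<kappa> * (1 + r * Re \<kappa>) \<ge> 0" using r k by simp
    have "M' r = 2 * c\<^sup>2 * r * Im \<kappa> * (1 + r * Re \<kappa>) * (cmod (F (Z r)))\<^sup>2 + 2 * r * Im \<kappa> * (cmod (deriv F (Z r)))\<^sup>2"
      unfolding M'_def Zq by (simp add: Z_def power2_eq_square algebra_simps)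
    moreover have "2 * r * Im \<kappa> * (cmod (deriv F (Z r)))\<^sup>2 \<ge> 0" using r k by simp
    ultimately show "M' r \<ge> 2 * c\<^sup>2 * r * Im \<kappa> * (1 + r * Re \<kappa>) * (cmod (F (1 + of_real r * \<kappa>)))\<^sup>2"
      unfolding Z_def by linarith
  next
    fix r :: real assume r: "0 < r" "r < 1"
    have "1 + r * Re \<kappa> > 0" using r k by (simp add: add_pos_nonneg)
    thus "2 * c\<^sup>2 * r * Im \<kappa> * (1 + r * Re \<kappa>) > 0" using r k c_pos by simp
  qed
qed

text \<open>Here the segment is vertical and starts at the real point Re z. There \<open>F\<close>
  and its derivative are real while \<open>\<kappa>\<close> is imaginary, so the real part of the
  pairing vanishes; \<open>q_pos\<close> then makes this real part strictly increasing unless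
  \<open>F\<close> is zero.\<close>

lemma no_zero_middle:
  assumes "F z = 0" "0 \<le> Re z" "Re z \<le> 1" "Im z > 0" shows False
proof -
  define a b where "a = Re z" and "b = Im z"
  define \<kappa> where "\<kappa> = \<i> * of_real b"
  have b: "b > 0" and a: "0 \<le> a" "a \<le> 1" using assms by (auto simp: a_def b_def)
  hence knz: "\<kappa> \<noteq> 0" by (auto simp: \<kappa>_def)
  define Z where "Z = (\<lambda>r::real. of_real a + of_real r * \<kappa>)"
  have Z1: "Z 1 = z" by (simp add: Z_def a_def b_def \<kappa>_def complex_eq_iff)
  define M' where "M' = (\<lambda>r. Re ((of_real ch - of_real (c\<^sup>2) * (Z r)\<^sup>2) * of_real ((cmod (F (Z r)))\<^sup>2) +
     ((Z r)\<^sup>2 - 1) / \<kappa> * cnj \<kappa> * of_real ((cmod (deriv F (Z r)))\<^sup>2)))"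
  define M where "M = (\<lambda>r. Re (((Z r)\<^sup>2 - 1) / \<kappa> * deriv F (Z r) * cnj (F (Z r))))"
  have a2: "a\<^sup>2 \<le> 1" using a by (simp add: abs_square_le_1)
  have pos: "ch - c\<^sup>2 * a\<^sup>2 > 0" using q_pos[of a] a by simp
  show False
  proof (rule no_zero_by_monotonicity[where M = M and M' = M' and \<kappa> = \<kappa> and p = "of_real a" and A = "\<lambda>r. ch - c\<^sup>2 * a\<^sup>2"])
    show "\<kappa> \<noteq> 0" by fact
    show "(M has_real_derivative M' r) (at r)" for r
      unfolding M_def M'_def Z_def has_real_derivative_iff_has_vector_derivative
      by (intro bounded_linear.has_vector_derivative[OF bounded_linear_Re] flux_pairing knz)
    have "((of_real a)\<^sup>2 - 1) / \<kappa> * deriv F (of_real a) * cnj (F (of_real a)) = of_real ((a\<^sup>2 - 1) * g1 a * g a) / \<kappa>"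
      unfolding F_of_real dF_of_real by simp
    moreover have "Re (of_real x / \<kappa>) = 0" for x unfolding \<kappa>_def by (simp add: Re_divide)
    ultimately have "Re (((of_real a)\<^sup>2 - 1) / \<kappa> * deriv F (of_real a) * cnj (F (of_real a))) = 0" by metis
    thus "M 0 = 0" unfolding M_def Z_def by simp
    show "M 1 = 0" unfolding M_def Z1 using assms by simp
    fix r :: real assume r: "0 \<le> r" "r \<le> 1"
    have kk: "((Z r)\<^sup>2 - 1) / \<kappa> * cnj \<kappa> = 1 - (Z r)\<^sup>2" using b by (simp add: \<kappa>_def)
    have "M' r = (ch - c\<^sup>2 * a\<^sup>2 + c\<^sup>2 * (r * b)\<^sup>2) * (cmod (F (Z r)))\<^sup>2 + (1 - a\<^sup>2 + (r * b)\<^sup>2) * (cmod (deriv F (Z r)))\<^sup>2"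
      unfolding M'_def kk by (simp add: Z_def \<kappa>_def power2_eq_square algebra_simps)
    moreover have "(1 - a\<^sup>2 + (r * b)\<^sup>2) * (cmod (deriv F (Z r)))\<^sup>2 \<ge> 0" using a2 by simp
    moreover have "c\<^sup>2 * (r * b)\<^sup>2 * (cmod (F (Z r)))\<^sup>2 \<ge> 0" by simp
    ultimately show "M' r \<ge> (ch - c\<^sup>2 * a\<^sup>2) * (cmod (F (of_real a + of_real r * \<kappa>)))\<^sup>2"
      unfolding Z_def by (simp add: distrib_right)
  qed (use pos in auto)
qed

text \<open>Conjugation and parity permute the zeros, so it suffices to exclude zeros with Re z
  \<ge> 0 and Im z > 0.\<close>

lemma zeros_real: assumes "F z = 0" shows "z \<in> \<real>"
proof -
  have quad: "Im z \<le> 0" if "F z = 0" "Re z \<ge> 0" for z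
    using no_zero_right[OF that(1)] no_zero_middle[OF that] that by (cases "Re z \<le> 1") force+
  have upper: "Im z = 0" if "F z = 0" "Re z \<ge> 0" for z
    using quad[OF that] quad[of "cnj z"] that by (simp add: F_cnj)
  have "Im z = 0"
    using upper[of z] upper[of "-z"] assms by (cases "Re z \<ge> 0") (auto simp: F_parity)
  thus ?thesis by (simp add: complex_is_Real_iff)
qed

end

section \<open>The Stieltjes transform\<close>

lemma zero_le_mult_one_plus_square: "0 \<le> (1 + y\<^sup>2) * a \<Longrightarrow> 0 \<le> (a::real)"
proof -
  assume "0 \<le> (1 + y\<^sup>2) * a"
  moreover have "0 < 1 + y\<^sup>2" by (simp add: add_pos_nonneg)
  ultimately show "0 \<le> a" by (simp only: zero_le_mult_iff) linarith
qed

context prolate_high begin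

text \<open>In the auxiliary function \<open>h\<close> all terms with \<open>g1\<close> cancel upon
  differentiation, and the remaining multiple of g^2 is nonpositive on [0,1]. Vanishing data at 0
  give h = 0 at 0, and h = 0 at 1 always, so h and with it \<open>g\<close> would vanish in
  between.\<close>

lemma uniqueness_zero: "g 0 \<noteq> 0 \<or> g1 0 \<noteq> 0"
proof (rule ccontr)
  assume z: "\<not> (g 0 \<noteq> 0 \<or> g1 0 \<noteq> 0)"
  define h where "h = (\<lambda>x. (1 - x\<^sup>2) * (ch - c\<^sup>2 * x\<^sup>2) * (g x)\<^sup>2 + ((x\<^sup>2 - 1) * g1 x)\<^sup>2)"
  have d: "(h has_real_derivative (- 2 * x * (ch - c\<^sup>2 * x\<^sup>2) + (1 - x\<^sup>2) * (- c\<^sup>2 * (2 * x))) * (g x)\<^sup>2) (at x)" for x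
  proof -
    have "(h has_real_derivative (- 2 * x * (ch - c\<^sup>2 * x\<^sup>2) + (1 - x\<^sup>2) * (- c\<^sup>2 * (2 * x))) * (g x)\<^sup>2 +
       (1 - x\<^sup>2) * (ch - c\<^sup>2 * x\<^sup>2) * (2 * g x * g1 x) + 2 * ((x\<^sup>2 - 1) * g1 x) * ((ch - c\<^sup>2 * x\<^sup>2) * g x)) (at x)"
      unfolding h_def by (rule derivative_eq_intros g_deriv g_flux refl | simp)+
    moreover have "(- 2 * x * (ch - c\<^sup>2 * x\<^sup>2) + (1 - x\<^sup>2) * (- c\<^sup>2 * (2 * x))) * (g x)\<^sup>2 +
       (1 - x\<^sup>2) * (ch - c\<^sup>2 * x\<^sup>2) * (2 * g x * g1 x) + 2 * ((x\<^sup>2 - 1) * g1 x) * ((ch - c\<^sup>2 * x\<^sup>2) * g x)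
       = (- 2 * x * (ch - c\<^sup>2 * x\<^sup>2) + (1 - x\<^sup>2) * (- c\<^sup>2 * (2 * x))) * (g x)\<^sup>2"
      by algebra
    ultimately show ?thesis by metis
  qed
  have mono: "h 1 \<le> h x \<and> h x \<le> h 0" if x: "0 \<le> x" "x \<le> 1" for x
  proof -
    have neg: "(- 2 * x * (ch - c\<^sup>2 * x\<^sup>2) + (1 - x\<^sup>2) * (- c\<^sup>2 * (2 * x))) * (g x)\<^sup>2 \<le> 0" if "0 \<le> x" "x \<le> 1" for x
    proof -
      have "0 \<le> x * (ch - c\<^sup>2 * x\<^sup>2)" "0 \<le> (1 - x\<^sup>2) * (c\<^sup>2 * (2 * x))"
        using that q_pos[of x] by (auto simp: abs_square_le_1)
      moreover have "- 2 * x * (ch - c\<^sup>2 * x\<^sup>2) + (1 - x\<^sup>2) * (- c\<^sup>2 * (2 * x)) =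
          - 2 * (x * (ch - c\<^sup>2 * x\<^sup>2)) - (1 - x\<^sup>2) * (c\<^sup>2 * (2 * x))" by algebra
      ultimately have "- 2 * x * (ch - c\<^sup>2 * x\<^sup>2) + (1 - x\<^sup>2) * (- c\<^sup>2 * (2 * x)) \<le> 0" by linarith
      thus ?thesis by (rule mult_nonpos_nonneg) (rule zero_le_power2)
    qed
    have "h v \<le> h u" if "0 \<le> u" "u \<le> v" "v \<le> 1" for u v
    proof (rule DERIV_nonpos_imp_nonincreasing[OF that(2)])
      fix t assume "u \<le> t" "t \<le> v"
      thus "\<exists>D. (h has_real_derivative D) (at t) \<and> D \<le> 0" using d[of t] neg[of t] that by (intro exI conjI) auto
    qed
    thus ?thesis using x by simp
  qed
  have h01: "h 1 = 0" "h 0 = 0" using z by (auto simp: h_def)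
  have "g x = 0" if x: "0 < x" "x < 1" for x
  proof -
    have "h x = 0" using mono[of x] x h01 by auto
    moreover have a: "0 < (1 - x\<^sup>2) * (ch - c\<^sup>2 * x\<^sup>2)" using x q_pos[of x] by (auto simp: abs_square_less_1)
    moreover have "0 \<le> ((x\<^sup>2 - 1) * g1 x)\<^sup>2" by simp
    ultimately have "(1 - x\<^sup>2) * (ch - c\<^sup>2 * x\<^sup>2) * (g x)\<^sup>2 \<le> 0" unfolding h_def by linarith
    thus ?thesis using mult_pos_pos[OF a, of "(g x)\<^sup>2"] by (cases "g x = 0") auto
  qed
  hence "F (0 + of_real x * 1) = 0" if "0 < x" "x < 1" for x using that by (simp add: F_of_real)
  thus False using F_not_zero_on_segment[of 1 0] by simp
qed

text \<open>On the imaginary axis the Fourier transform becomes a Laplace transform, whose Laplace transform is in turn the Stieltjes transform of \<^term>\<open>g\<close>.\<close>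
definition J :: "real \<Rightarrow> real" where "J y = integral {-1..1} (\<lambda>t. g t * exp (c * y * t))"

definition J1 :: "real \<Rightarrow> real" where "J1 y = Re (- \<i> * \<mu> * deriv F (- \<i> * of_real y))"

lemma J_eq: "of_real (J y) = \<mu> * F (- \<i> * of_real y)"
proof -
  have "(\<lambda>t. g t * exp (c * y * t)) integrable_on {-1..1}"
    by (intro integrable_continuous_real continuous_intros cont_g)
  from integral_linear[OF this bounded_linear_of_real[where 'a = complex]]
  have "of_real (J y) = integral {-1..1} (\<lambda>t. complex_of_real (g t * exp (c * y * t)))"
    by (simp add: J_def o_def)
  also have "\<dots> = \<mu> * F (- \<i> * of_real y)"
    unfolding F_fourier_g by (rule integral_cong) (simp add: exp_of_real mult_ac flip: exp_of_real)
  finally show ?thesis .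
qed

lemma J_deriv: "(J has_real_derivative J1 y) (at y within A)"
proof -
  have Z: "((\<lambda>y. - \<i> * of_real y) has_vector_derivative - \<i>) (at y)"
    by (auto intro!: derivative_eq_intros simp: scaleR_conv_of_real)
  have "((\<lambda>y. \<mu> * F (- \<i> * of_real y)) has_vector_derivative \<mu> * (- \<i> * deriv F (- \<i> * of_real y))) (at y)"
    by (intro has_vector_derivative_mult_right field_vector_diff_chain_at[OF Z dF, unfolded o_def])
  hence "((\<lambda>y. of_real (J y)) has_vector_derivative \<mu> * (- \<i> * deriv F (- \<i> * of_real y))) (at y)"
    by (simp only: J_eq)
  from bounded_linear.has_vector_derivative[OF bounded_linear_Re this]
  have "(J has_real_derivative J1 y) (at y)"
    by (simp add: J1_def has_real_derivative_iff_has_vector_derivative mult_ac)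
  thus ?thesis by (rule has_field_derivative_at_within)
qed

text \<open>On the imaginary axis z^2 becomes -y^2, which makes both coefficients of the ODE
  positive: \<open>J\<close> does not oscillate. All sign information about \<open>J\<close> rests
  on this.\<close>

lemma J_flux: "((\<lambda>y. (1 + y\<^sup>2) * J1 y) has_real_derivative (ch + c\<^sup>2 * y\<^sup>2) * J y) (at y within A)"
proof -
  have Z: "((\<lambda>y. - \<i> * of_real y) has_vector_derivative - \<i>) (at y)"
    by (auto intro!: derivative_eq_intros simp: scaleR_conv_of_real)
  have "((\<lambda>y. (\<i> * \<mu>) * (\<lambda>z. (z\<^sup>2 - 1) * deriv F z) (- \<i> * of_real y)) has_vector_derivative
          (\<i> * \<mu>) * (- \<i> * ((of_real ch - of_real (c\<^sup>2) * (- \<i> * of_real y)\<^sup>2) * F (- \<i> * of_real y)))) (at y)"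
    by (intro has_vector_derivative_mult_right field_vector_diff_chain_at[OF Z F_flux, unfolded o_def])
  also have "(\<lambda>y. (\<i> * \<mu>) * (\<lambda>z. (z\<^sup>2 - 1) * deriv F z) (- \<i> * of_real y)) =
     (\<lambda>y. of_real (1 + y\<^sup>2) * (- \<i> * \<mu> * deriv F (- \<i> * of_real y)))"
    by (simp add: fun_eq_iff power_mult_distrib algebra_simps)
  also have "(\<i> * \<mu>) * (- \<i> * ((of_real ch - of_real (c\<^sup>2) * (- \<i> * of_real y)\<^sup>2) * F (- \<i> * of_real y))) =
     of_real ((ch + c\<^sup>2 * y\<^sup>2) * J y)"
    unfolding of_real_mult J_eq by (simp add: power_mult_distrib algebra_simps)
  finally have v: "((\<lambda>y. of_real (1 + y\<^sup>2) * (- \<i> * \<mu> * deriv F (- \<i> * of_real y))) has_vector_derivative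
     of_real ((ch + c\<^sup>2 * y\<^sup>2) * J y)) (at y)" .
  have re: "Re (of_real a * z) = a * Re z" for a z by simp
  from bounded_linear.has_vector_derivative[OF bounded_linear_Re v]
  have "((\<lambda>y. (1 + y\<^sup>2) * J1 y) has_real_derivative (ch + c\<^sup>2 * y\<^sup>2) * J y) (at y)"
    unfolding has_real_derivative_iff_has_vector_derivative J1_def re Re_complex_of_real .
  thus ?thesis by (rule has_field_derivative_at_within)
qed

definition J2 :: "real \<Rightarrow> real" where "J2 y = ((ch + c\<^sup>2 * y\<^sup>2) * J y - 2 * y * J1 y) / (1 + y\<^sup>2)"

lemma J1_deriv: "(J1 has_real_derivative J2 y) (at y)"
proof -
  have nz: "1 + y\<^sup>2 \<noteq> 0" for y :: real by (smt (verit) zero_le_power2)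
  have "((\<lambda>y. ((1 + y\<^sup>2) * J1 y) / (1 + y\<^sup>2)) has_real_derivative
      (((ch + c\<^sup>2 * y\<^sup>2) * J y) * (1 + y\<^sup>2) - ((1 + y\<^sup>2) * J1 y) * (2 * y)) / ((1 + y\<^sup>2) * (1 + y\<^sup>2))) (at y)"
    by (rule derivative_eq_intros J_flux refl | use nz in simp)+
  also have "(\<lambda>y. ((1 + y\<^sup>2) * J1 y) / (1 + y\<^sup>2)) = J1" using nz by (simp add: fun_eq_iff)
  also have "(((ch + c\<^sup>2 * y\<^sup>2) * J y) * (1 + y\<^sup>2) - ((1 + y\<^sup>2) * J1 y) * (2 * y)) / ((1 + y\<^sup>2) * (1 + y\<^sup>2)) = J2 y"
  proof -
    have "((ch + c\<^sup>2 * y\<^sup>2) * J y) * (1 + y\<^sup>2) - ((1 + y\<^sup>2) * J1 y) * (2 * y) = (1 + y\<^sup>2) * ((ch + c\<^sup>2 * y\<^sup>2) * J y - 2 * y * J1 y)"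
      by (simp only: right_diff_distrib mult_ac)
    thus ?thesis unfolding J2_def using nz[of y] by simp
  qed
  finally show ?thesis .
qed

text \<open>The initial data of \<open>J\<close> are those of \<open>F\<close> multiplied by \<mu>;
  this is how the small factor |\<mu>| enters the bound on the Stieltjes transform.\<close>

lemma J_zero: "\<bar>J 0\<bar> = cmod \<mu> * \<bar>g 0\<bar>" "\<bar>J1 0\<bar> \<le> cmod \<mu> * \<bar>g1 0\<bar>"
proof -
  have "\<bar>J 0\<bar> = cmod (complex_of_real (J 0))" by simp
  also have "\<dots> = cmod \<mu> * \<bar>g 0\<bar>" unfolding J_eq using F_of_real[of 0] by (simp add: norm_mult)
  finally show "\<bar>J 0\<bar> = cmod \<mu> * \<bar>g 0\<bar>" .
  have "\<bar>J1 0\<bar> \<le> cmod (- \<i> * \<mu> * deriv F 0)" unfolding J1_def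
    using abs_Re_le_cmod[of "- \<i> * \<mu> * deriv F 0"] by simp
  also have "\<dots> = cmod \<mu> * \<bar>g1 0\<bar>" using dF_of_real[of 0] by (simp add: norm_mult)
  finally show "\<bar>J1 0\<bar> \<le> cmod \<mu> * \<bar>g1 0\<bar>" .
qed

text \<open>The product of \<open>J\<close> with its flux has a derivative that is a sum of squares
  with positive weights.\<close>

lemma JJ1_nonneg: assumes "y \<ge> 0" "J 0 * J1 0 \<ge> 0" shows "J y * J1 y \<ge> 0"
proof -
  have "J 0 * ((1 + 0\<^sup>2) * J1 0) \<le> J y * ((1 + y\<^sup>2) * J1 y)"
  proof (rule DERIV_nonneg_imp_nondecreasing[OF assms(1)])
    fix x :: real
    have "((\<lambda>y. J y * ((1 + y\<^sup>2) * J1 y)) has_real_derivative J1 x * ((1 + x\<^sup>2) * J1 x) + ((ch + c\<^sup>2 * x\<^sup>2) * J x) * J x) (at x)"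
      by (intro DERIV_mult J_deriv J_flux)
    moreover have eq: "J1 x * ((1 + x\<^sup>2) * J1 x) + ((ch + c\<^sup>2 * x\<^sup>2) * J x) * J x = (1 + x\<^sup>2) * (J1 x)\<^sup>2 + (ch + c\<^sup>2 * x\<^sup>2) * (J x)\<^sup>2"
      by (simp add: power2_eq_square algebra_simps)
    moreover have "(1 + x\<^sup>2) * (J1 x)\<^sup>2 + (ch + c\<^sup>2 * x\<^sup>2) * (J x)\<^sup>2 \<ge> 0" using ch_pos by simp
    ultimately show "\<exists>D. ((\<lambda>y. J y * ((1 + y\<^sup>2) * J1 y)) has_real_derivative D) (at x) \<and> 0 \<le> D" by (intro exI conjI) (assumption, simp only: eq)
  qed
  hence "0 \<le> (1 + y\<^sup>2) * (J y * J1 y)" using assms(2) by (simp add: algebra_simps)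
  thus ?thesis by (rule zero_le_mult_one_plus_square)
qed

lemma J_parity_zero: "J 0 * J1 0 = 0"
proof (cases "even k")
  case True
  hence "g1 0 = 0" using g1_parity[of 0] by simp
  thus ?thesis using J_zero(2) by simp
next
  case False
  hence "g 0 = 0" using g_parity[of 0] by simp
  thus ?thesis using J_zero(1) by simp
qed

lemma J_nonzero_init: "J 0 \<noteq> 0 \<or> J1 0 \<noteq> 0"
proof -
  have "J 0 = 0 \<longleftrightarrow> g 0 = 0" using J_zero(1) mu_nz by auto
  moreover have "g1 0 = 0" if "J1 0 = 0" "g 0 = 0"
  proof -
    have "odd k"
    proof
      assume "even k"
      hence "g1 0 = 0" using g1_parity[of 0] by simp
      thus False using that uniqueness_zero by simp
    qed
    \<comment> \<open>For odd \<open>k\<close> the eigenvalue is \<i> times a real number, so the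
      real part in the definition of \<open>J1\<close> loses nothing at 0.\<close>
    then obtain j where j: "k = 2 * j + 1" by (auto elim: oddE)
    have mu: "\<mu> = \<i> * of_real ((-1)^j * cmod \<mu>)" by (subst mu_phase) (simp add: j power_mult)
    have "- \<i> * \<mu> * deriv F (- \<i> * of_real 0) = - \<i> * (\<i> * of_real ((-1)^j * cmod \<mu>)) * of_real (g1 0)"
      using dF_of_real[of 0] mu by (metis mult_zero_right of_real_0)
    also have "\<dots> = of_real ((-1)^j * cmod \<mu> * g1 0)" by simp
    finally have "- \<i> * \<mu> * deriv F (- \<i> * of_real 0) = of_real ((-1)^j * cmod \<mu> * g1 0)" .
    hence "J1 0 = (-1)^j * cmod \<mu> * g1 0" unfolding J1_def by (simp only: Re_complex_of_real)
    thus ?thesis using that mu_nz by simp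
  qed
  ultimately show ?thesis using uniqueness_zero by blast
qed

text \<open>By parity exactly one of the initial data \<open>J 0\<close> and \<open>J1 0\<close> is
  nonzero, and its sign is \<open>\<sigma>\<close>. That sign persists because J^2 is nondecreasing,
  and it passes to \<open>J1\<close> through the flux.\<close>

lemma J_sign:
  obtains \<sigma> :: real where "\<sigma> = 1 \<or> \<sigma> = -1" "\<And>y. y \<ge> 0 \<Longrightarrow> \<sigma> * J y \<ge> 0" "\<And>y. y \<ge> 0 \<Longrightarrow> \<sigma> * J1 y \<ge> 0"
proof -
  define \<sigma> :: real where "\<sigma> = (if J 0 > 0 \<or> J1 0 > 0 then 1 else -1)"
  have s: "\<sigma> = 1 \<or> \<sigma> = -1" by (simp add: \<sigma>_def)
  have init: "\<sigma> * J 0 \<ge> 0" "\<sigma> * J1 0 \<ge> 0" "\<sigma> * J 0 > 0 \<or> \<sigma> * J1 0 > 0"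
    using J_parity_zero J_nonzero_init by (auto simp: \<sigma>_def)
  have mono2: "(J x)\<^sup>2 \<le> (J y)\<^sup>2" if "0 \<le> x" "x \<le> y" for x y
  proof (rule DERIV_nonneg_imp_nondecreasing[OF that(2)])
    fix t assume "x \<le> t"
    have "((\<lambda>y. (J y)\<^sup>2) has_real_derivative 2 * (J t * J1 t)) (at t)"
      by (rule derivative_eq_intros J_deriv refl | simp)+
    thus "\<exists>D. ((\<lambda>y. (J y)\<^sup>2) has_real_derivative D) (at t) \<and> 0 \<le> D"
      using JJ1_nonneg[of t] J_parity_zero \<open>x \<le> t\<close> that by auto
  qed
  have contJ: "continuous_on A J" for A
    by (meson DERIV_continuous J_deriv continuous_on_eq_continuous_within)
  \<comment> \<open>A zero at z > 0 makes \<open>J\<close> vanish on all of [0,z] by monotonicity of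
    J^2, hence \<open>F\<close> on a segment of the imaginary axis.\<close>
  have nozero: False if z: "z > 0" "J z = 0" for z
  proof -
    have "J y = 0" if "0 \<le> y" "y \<le> z" for y using mono2[OF that] z by simp
    hence "F (0 + of_real r * (- \<i> * of_real z)) = 0" if "0 < r" "r < 1" for r
      using J_eq[of "r * z"] mu_nz that z by (simp add: mult_ac mult_left_le_one_le)
    thus False using F_not_zero_on_segment[of "- \<i> * of_real z" 0] z by simp
  qed
  have pos: "\<sigma> * J y \<ge> 0" if "y \<ge> 0" for y
  proof (rule ccontr)
    assume n: "\<not> \<sigma> * J y \<ge> 0"
    obtain x where x: "0 \<le> x" "x < y" "\<sigma> * J x > 0"
    proof (cases "\<sigma> * J 0 > 0")
      case True thus ?thesis using n that[of 0] \<open>y \<ge> 0\<close> by (cases "y = 0") auto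
    next
      case False
      hence "\<sigma> * J 0 = 0" "\<sigma> * J1 0 > 0" using init by auto
      moreover have "((\<lambda>y. \<sigma> * J y) has_real_derivative \<sigma> * J1 0) (at 0)" by (intro DERIV_cmult J_deriv)
      ultimately obtain d where d: "d > 0" "\<And>h. 0 < h \<Longrightarrow> h < d \<Longrightarrow> \<sigma> * J 0 < \<sigma> * J (0 + h)"
        using DERIV_pos_inc_right by blast
      have "y > 0" using n init(1) \<open>y \<ge> 0\<close> by (cases "y = 0") auto
      thus ?thesis using that[of "min (d/2) (y/2)"] d(2)[of "min (d/2) (y/2)"] d(1) \<open>\<sigma> * J 0 = 0\<close> by auto
    qed
    have "\<exists>z\<ge>x. z \<le> y \<and> \<sigma> * J z = 0"
      using n x by (intro IVT2') (auto intro!: continuous_intros contJ)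
    then obtain z where z: "x \<le> z" "z \<le> y" "\<sigma> * J z = 0" by blast
    have "z > 0" using x z by (cases "z = x") auto
    thus False using nozero[of z] z s by auto
  qed
  have pos1: "\<sigma> * J1 y \<ge> 0" if "y \<ge> 0" for y
  proof -
    have "\<sigma> * ((1 + 0\<^sup>2) * J1 0) \<le> \<sigma> * ((1 + y\<^sup>2) * J1 y)"
    proof (rule DERIV_nonneg_imp_nondecreasing[OF that])
      fix x :: real assume x: "0 \<le> x"
      have "((\<lambda>y. \<sigma> * ((1 + y\<^sup>2) * J1 y)) has_real_derivative \<sigma> * ((ch + c\<^sup>2 * x\<^sup>2) * J x)) (at x)"
        by (intro DERIV_cmult J_flux)
      moreover have "0 \<le> ch + c\<^sup>2 * x\<^sup>2" using ch_pos by simp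
      hence "0 \<le> (ch + c\<^sup>2 * x\<^sup>2) * (\<sigma> * J x)" using pos[OF x] by (rule mult_nonneg_nonneg)
      hence "0 \<le> \<sigma> * ((ch + c\<^sup>2 * x\<^sup>2) * J x)" by (simp only: mult.left_commute)
      ultimately show "\<exists>D. ((\<lambda>y. \<sigma> * ((1 + y\<^sup>2) * J1 y)) has_real_derivative D) (at x) \<and> 0 \<le> D" by blast
    qed
    hence "0 \<le> (1 + y\<^sup>2) * (\<sigma> * J1 y)" using init by (simp add: algebra_simps)
    thus ?thesis by (rule zero_le_mult_one_plus_square)
  qed
  show ?thesis using that s pos pos1 by blast
qed

text \<open>The truncated Laplace integral of \<open>J\<close> is the function
  \<open>\<Gamma>\<close>, which tends to the Stieltjes transform. Integrating by parts twice
  replaces \<open>J\<close> by \<open>J2\<close>, and the inequality J2 \<le> ch J (up to the sign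
  \<open>\<sigma>\<close>) turns the result into a bound by the initial data, with denominator s^2 -
  ch for s = c x.\<close>

lemma stieltjes_bound:
  assumes x: "x > 1" "c\<^sup>2 * x\<^sup>2 > ch"
  shows "\<bar>integral {-1..1} (\<lambda>t. g t / (x - t))\<bar> \<le> cmod \<mu> * c * (c * x * \<bar>g 0\<bar> + \<bar>g1 0\<bar>) / (c\<^sup>2 * x\<^sup>2 - ch)"
proof -
  obtain \<sigma> :: real where s: "\<sigma> = 1 \<or> \<sigma> = -1" and pos: "\<And>y. y \<ge> 0 \<Longrightarrow> \<sigma> * J y \<ge> 0" "\<And>y. y \<ge> 0 \<Longrightarrow> \<sigma> * J1 y \<ge> 0"
    using J_sign by blast
  define s where "s = c * x"
  have s0: "s > 0" using c_pos x by (simp add: s_def)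
  have sq: "s\<^sup>2 - ch > 0" using x by (simp add: s_def power_mult_distrib)
  define \<Gamma> where "\<Gamma> = (\<lambda>Y. integral {-1..1} (\<lambda>t. g t * (1 - exp (- c * (x - t) * Y)) / (x - t)))"
  have G: "(\<Gamma> has_real_derivative c * exp (- s * Y) * J Y) (at Y)" for Y
  proof -
    have "((\<lambda>Y. integral (cbox (-1) 1) (\<lambda>t. g t * (1 - exp (- c * (x - t) * Y)) / (x - t))) has_field_derivative
        integral (cbox (-1) 1) (\<lambda>t. g t * (c * exp (- c * (x - t) * Y)))) (at Y within UNIV)"
    proof (rule leibniz_rule_field_derivative)
      fix y t :: real assume t: "t \<in> cbox (-1) 1"
      show "((\<lambda>Y. g t * (1 - exp (- c * (x - t) * Y)) / (x - t)) has_field_derivative g t * (c * exp (- c * (x - t) * y))) (at y within UNIV)"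
      proof -
        have "x - t \<noteq> 0" using t x by auto
        hence "g t * (c * exp (- c * (x - t) * y)) = (g t * (0 - exp (- c * (x - t) * y) * (- c * (x - t)))) / (x - t)"
          by simp
        moreover have "((\<lambda>Y. g t * (1 - exp (- c * (x - t) * Y)) / (x - t)) has_field_derivative (g t * (0 - exp (- c * (x - t) * y) * (- c * (x - t)))) / (x - t)) (at y)"
          by (intro DERIV_cdivide DERIV_cmult derivative_intros) (auto intro!: derivative_eq_intros)
        ultimately show ?thesis by simp
      qed
    next
      fix Y :: real
      show "(\<lambda>t. g t * (1 - exp (- c * (x - t) * Y)) / (x - t)) integrable_on cbox (-1) 1"
        using x by (intro integrable_continuous continuous_intros cont_g) auto
      show "continuous_on (UNIV \<times> cbox (-1) 1) (\<lambda>(Y, t). g t * (c * exp (- c * (x - t) * Y)))"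
        unfolding case_prod_unfold
        by (intro continuous_intros continuous_on_compose2[OF cont_g[of UNIV]]) auto
    qed auto
    also have "integral (cbox (-1) 1) (\<lambda>t. g t * (c * exp (- c * (x - t) * Y))) =
        integral {-1..1} (\<lambda>t. c * exp (- s * Y) * (g t * exp (c * Y * t)))"
      unfolding cbox_interval by (rule integral_cong) (simp add: s_def mult_ac flip: exp_add, simp add: algebra_simps flip: exp_add)
    also have "\<dots> = c * exp (- s * Y) * J Y" by (simp add: J_def)
    finally show ?thesis by (simp add: \<Gamma>_def)
  qed
  have up: "\<sigma> * \<Gamma> Y \<le> c * (s * (\<sigma> * J 0) + \<sigma> * J1 0) / (s\<^sup>2 - ch)" if Y: "Y \<ge> 0" for Y
  proof -
    \<comment> \<open>The two integrations by parts in differential form: the derivative of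
      \<open>\<Omega>\<close> is the exponential times \<sigma> (J2 - ch J).\<close>
    define \<Omega> where "\<Omega> = (\<lambda>y. (s\<^sup>2 - ch) / c * (\<sigma> * \<Gamma> y) + exp (- s * y) * (s * (\<sigma> * J y) + \<sigma> * J1 y))"
    have "\<Omega> Y \<le> \<Omega> 0"
    proof (rule DERIV_nonpos_imp_nonincreasing[OF Y])
      fix y :: real assume y: "0 \<le> y"
      have "(\<Omega> has_real_derivative (s\<^sup>2 - ch) / c * (\<sigma> * (c * exp (- s * y) * J y)) +
           (exp (- s * y) * (s * (\<sigma> * J1 y) + \<sigma> * J2 y) + (- s * exp (- s * y)) * (s * (\<sigma> * J y) + \<sigma> * J1 y))) (at y)"
        unfolding \<Omega>_def
        by (intro DERIV_add DERIV_cmult G DERIV_mult' J_deriv J1_deriv) (auto intro!: derivative_eq_intros)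
      also have "(s\<^sup>2 - ch) / c * (\<sigma> * (c * exp (- s * y) * J y)) +
           (exp (- s * y) * (s * (\<sigma> * J1 y) + \<sigma> * J2 y) + (- s * exp (- s * y)) * (s * (\<sigma> * J y) + \<sigma> * J1 y)) =
           exp (- s * y) * (\<sigma> * J2 y - ch * (\<sigma> * J y))"
        using c_pos by (simp add: field_simps power2_eq_square)
      finally have "(\<Omega> has_real_derivative exp (- s * y) * (\<sigma> * J2 y - ch * (\<sigma> * J y))) (at y)" .
      \<comment> \<open>The term with \<open>J1\<close> has a favourable sign, and (ch + c^2 y^2) /
        (1 + y^2) \<le> ch because c^2 < ch.\<close>
      moreover have "\<sigma> * J2 y - ch * (\<sigma> * J y) \<le> 0"
      proof -
        have "\<sigma> * J2 y = ((ch + c\<^sup>2 * y\<^sup>2) * (\<sigma> * J y) - 2 * y * (\<sigma> * J1 y)) / (1 + y\<^sup>2)"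
          by (simp add: J2_def algebra_simps)
        also have "\<dots> \<le> ((ch + ch * y\<^sup>2) * (\<sigma> * J y)) / (1 + y\<^sup>2)"
        proof (rule divide_right_mono)
          have "(ch + c\<^sup>2 * y\<^sup>2) * (\<sigma> * J y) \<le> (ch + ch * y\<^sup>2) * (\<sigma> * J y)"
            using pos(1)[OF y] ch_gt by (intro mult_right_mono add_left_mono) auto
          moreover have "2 * y * (\<sigma> * J1 y) \<ge> 0" by (rule mult_nonneg_nonneg) (use y pos(2)[OF y] in simp_all)
          ultimately show "(ch + c\<^sup>2 * y\<^sup>2) * (\<sigma> * J y) - 2 * y * (\<sigma> * J1 y) \<le> (ch + ch * y\<^sup>2) * (\<sigma> * J y)" by linarith
        qed auto
        also have "\<dots> = ch * (\<sigma> * J y)"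
        proof -
          have "1 + y\<^sup>2 \<noteq> 0" by (smt (verit) zero_le_power2)
          moreover have "(ch + ch * y\<^sup>2) * (\<sigma> * J y) = (1 + y\<^sup>2) * (ch * (\<sigma> * J y))" by algebra
          ultimately show ?thesis by (simp only: nonzero_mult_div_cancel_left not_False_eq_True)
        qed
        finally show ?thesis by simp
      qed
      ultimately show "\<exists>D. (\<Omega> has_real_derivative D) (at y) \<and> D \<le> 0"
        by (meson exp_ge_zero mult_nonneg_nonpos)
    qed
    moreover have "\<Gamma> 0 = 0" by (simp add: \<Gamma>_def)
    moreover have "0 \<le> s * (\<sigma> * J Y)" by (rule mult_nonneg_nonneg[OF less_imp_le[OF s0] pos(1)[OF Y]])
    hence "0 \<le> exp (- s * Y) * (s * (\<sigma> * J Y) + \<sigma> * J1 Y)"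
      using pos(2)[OF Y] by (intro mult_nonneg_nonneg[OF exp_ge_zero] add_nonneg_nonneg)
    ultimately have "(s\<^sup>2 - ch) / c * (\<sigma> * \<Gamma> Y) \<le> s * (\<sigma> * J 0) + \<sigma> * J1 0" by (simp add: \<Omega>_def)
    thus ?thesis using sq c_pos by (simp add: field_simps)
  qed
  have lo: "\<sigma> * \<Gamma> Y \<ge> 0" if Y: "Y \<ge> 0" for Y
  proof -
    have "\<sigma> * \<Gamma> 0 \<le> \<sigma> * \<Gamma> Y"
    proof (rule DERIV_nonneg_imp_nondecreasing[OF Y])
      fix y :: real assume y: "0 \<le> y"
      have "((\<lambda>y. \<sigma> * \<Gamma> y) has_real_derivative \<sigma> * (c * exp (- s * y) * J y)) (at y)" by (intro DERIV_cmult G)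
      moreover have "0 \<le> c * exp (- s * y) * (\<sigma> * J y)" using pos(1)[OF y] c_pos by simp
      hence "0 \<le> \<sigma> * (c * exp (- s * y) * J y)" by (simp only: mult.left_commute)
      ultimately show "\<exists>D. ((\<lambda>y. \<sigma> * \<Gamma> y) has_real_derivative D) (at y) \<and> 0 \<le> D" by blast
    qed
    thus ?thesis by (simp add: \<Gamma>_def)
  qed
  have bd: "\<bar>\<Gamma> Y\<bar> \<le> cmod \<mu> * c * (c * x * \<bar>g 0\<bar> + \<bar>g1 0\<bar>) / (c\<^sup>2 * x\<^sup>2 - ch)" if Y: "Y \<ge> 0" for Y
  proof -
    have "\<bar>\<Gamma> Y\<bar> = \<sigma> * \<Gamma> Y" using s lo[OF Y] by auto
    also have "\<dots> \<le> c * (s * (\<sigma> * J 0) + \<sigma> * J1 0) / (s\<^sup>2 - ch)" by (rule up[OF Y])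
    also have "\<dots> \<le> c * (s * (cmod \<mu> * \<bar>g 0\<bar>) + cmod \<mu> * \<bar>g1 0\<bar>) / (s\<^sup>2 - ch)"
    proof (intro divide_right_mono mult_left_mono add_mono)
      show "\<sigma> * J 0 \<le> cmod \<mu> * \<bar>g 0\<bar>" using s J_zero(1) by auto
      show "\<sigma> * J1 0 \<le> cmod \<mu> * \<bar>g1 0\<bar>" using s J_zero(2) by auto
    qed (use sq c_pos s0 in auto)
    also have "\<dots> = cmod \<mu> * c * (c * x * \<bar>g 0\<bar> + \<bar>g1 0\<bar>) / (c\<^sup>2 * x\<^sup>2 - ch)"
      by (simp add: s_def power_mult_distrib algebra_simps)
    finally show ?thesis .
  qed
  have lim: "(\<Gamma> \<longlongrightarrow> integral {-1..1} (\<lambda>t. g t / (x - t))) at_top"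
  proof -
    define I where "I = integral {-1..1} (\<lambda>t. g t / (x - t))"
    define K where "K = integral {-1..1} (\<lambda>t. \<bar>g t\<bar> / (x - t))"
    have le: "\<bar>\<Gamma> Y - I\<bar> \<le> exp (- (c * (x - 1)) * Y) * K" if Y: "Y \<ge> 0" for Y
    proof -
      have eq: "\<Gamma> Y - I = integral {-1..1} (\<lambda>t. g t * (1 - exp (- c * (x - t) * Y)) / (x - t) - g t / (x - t))"
        unfolding \<Gamma>_def I_def using x
        by (intro integral_diff[symmetric] integrable_continuous_real continuous_intros cont_g) auto
      have "norm (\<Gamma> Y - I) \<le> integral {-1..1} (\<lambda>t. exp (- (c * (x - 1)) * Y) * (\<bar>g t\<bar> / (x - t)))"
        unfolding eq
      proof (rule integral_norm_bound_integral)
        show "(\<lambda>t. g t * (1 - exp (- c * (x - t) * Y)) / (x - t) - g t / (x - t)) integrable_on {-1..1}"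
          using x by (intro integrable_continuous_real continuous_intros cont_g) auto
        show "(\<lambda>t. exp (- (c * (x - 1)) * Y) * (\<bar>g t\<bar> / (x - t))) integrable_on {-1..1}"
          using x by (intro integrable_continuous_real continuous_intros cont_g) auto
        fix t :: real assume t: "t \<in> {-1..1}"
        have "g t * (1 - exp (- c * (x - t) * Y)) / (x - t) - g t / (x - t) = - (exp (- c * (x - t) * Y) * (g t / (x - t)))"
          by (simp only: right_diff_distrib diff_divide_distrib mult_1_right times_divide_eq_right mult.commute diff_diff_eq2) simp
        hence "norm (g t * (1 - exp (- c * (x - t) * Y)) / (x - t) - g t / (x - t)) = exp (- c * (x - t) * Y) * (\<bar>g t\<bar> / (x - t))"
          using t x by (simp add: abs_mult)
        also have "\<dots> \<le> exp (- (c * (x - 1)) * Y) * (\<bar>g t\<bar> / (x - t))"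
        proof (rule mult_right_mono)
          have "c * (x - 1) * Y \<le> c * (x - t) * Y" using t Y c_pos by (intro mult_right_mono mult_left_mono) auto
          thus "exp (- c * (x - t) * Y) \<le> exp (- (c * (x - 1)) * Y)" by simp
        qed (use t x in auto)
        finally show "norm (g t * (1 - exp (- c * (x - t) * Y)) / (x - t) - g t / (x - t)) \<le> exp (- (c * (x - 1)) * Y) * (\<bar>g t\<bar> / (x - t))" .
      qed
      thus ?thesis unfolding K_def real_norm_def Henstock_Kurzweil_Integration.integral_mult_right .
    qed
    have "((\<lambda>Y. exp (- (c * (x - 1)) * Y) * K) \<longlongrightarrow> 0 * K) at_top"
    proof (intro tendsto_mult tendsto_const)
      have "filterlim (\<lambda>Y. (- (c * (x - 1))) * Y) at_bot at_top"
        using x c_pos by (intro filterlim_tendsto_neg_mult_at_bot[OF tendsto_const]) (auto simp: filterlim_ident)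
      thus "((\<lambda>Y. exp (- (c * (x - 1)) * Y)) \<longlongrightarrow> 0) at_top" by (rule filterlim_compose[OF exp_at_bot])
    qed
    hence "((\<lambda>Y. exp (- (c * (x - 1)) * Y) * K) \<longlongrightarrow> 0) at_top" by (simp only: mult_zero_left)
    moreover have "\<forall>\<^sub>F Y in at_top. norm (\<Gamma> Y - I) \<le> exp (- (c * (x - 1)) * Y) * K"
      using eventually_ge_at_top[of 0] by eventually_elim (unfold real_norm_def, rule le)
    ultimately have "((\<lambda>Y. \<Gamma> Y - I) \<longlongrightarrow> 0) at_top" by (rule Lim_null_comparison[rotated])
    hence "(\<Gamma> \<longlongrightarrow> I) at_top" by (rule Lim_null[THEN iffD2])
    thus ?thesis unfolding I_def .
  qed
  show ?thesis
  proof (rule tendsto_upperbound[OF tendsto_rabs[OF lim]])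
    show "\<forall>\<^sub>F Y in at_top. \<bar>\<Gamma> Y\<bar> \<le> cmod \<mu> * c * (c * x * \<bar>g 0\<bar> + \<bar>g1 0\<bar>) / (c\<^sup>2 * x\<^sup>2 - ch)"
      using eventually_ge_at_top[of 0] by eventually_elim (rule bd)
  qed simp
qed

end

section \<open>Asymptotics at infinity\<close>

lemma mult_add_eq_imp_eq_divide: "w \<noteq> 0 \<Longrightarrow> w * A + B = C \<Longrightarrow> A = C / w - B / (w :: 'a :: field)"
  by (auto simp: field_simps)

lemma fourier_ibp:
  fixes h h1 :: "real \<Rightarrow> real" and z :: complex
  assumes d: "\<And>x. (h has_real_derivative h1 x) (at x)" and c: "continuous_on UNIV h1" and z: "z \<noteq> 0"
  shows "integral {-1..1} (\<lambda>t. of_real (h t) * exp (\<i> * z * of_real t)) =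
    (of_real (h 1) * exp (\<i> * z) - of_real (h (-1)) * exp (- (\<i> * z))) / (\<i> * z)
     - integral {-1..1} (\<lambda>t. of_real (h1 t) * exp (\<i> * z * of_real t)) / (\<i> * z)"
proof -
  have ch: "continuous_on UNIV h" using d by (meson DERIV_isCont continuous_at_imp_continuous_on)
  have vd: "((\<lambda>t. of_real (h t) * exp (\<i> * z * of_real t)) has_vector_derivative
     (of_real (h t) * (\<i> * z * exp (\<i> * z * of_real t)) + of_real (h1 t) * exp (\<i> * z * of_real t))) (at t within A)" for t A
  proof -
    have "((\<lambda>t. complex_of_real (h t)) has_vector_derivative of_real (h1 t)) (at t)"
      using d by (intro has_vector_derivative_of_real) (simp add: has_real_derivative_iff_has_vector_derivative)
    moreover have "((\<lambda>t::real. exp (\<i> * z * of_real t)) has_vector_derivative (\<i> * z * exp (\<i> * z * of_real t))) (at t)"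
      by (rule has_vector_derivative_real_field) (auto intro!: derivative_eq_intros)
    ultimately have "((\<lambda>t. of_real (h t) * exp (\<i> * z * of_real t)) has_vector_derivative
     (of_real (h t) * (\<i> * z * exp (\<i> * z * of_real t)) + of_real (h1 t) * exp (\<i> * z * of_real t))) (at t)"
      by (rule has_vector_derivative_mult)
    thus ?thesis by (rule has_vector_derivative_at_within)
  qed
  have i0: "(\<lambda>t. of_real (h t) * exp (\<i> * z * of_real t)) integrable_on {-1..1}"
    using ch continuous_on_subset by (intro integrable_continuous_real continuous_intros) blast
  have i1: "(\<lambda>t. of_real (h1 t) * exp (\<i> * z * of_real t)) integrable_on {-1..1}"
    using c continuous_on_subset by (intro integrable_continuous_real continuous_intros) blast
  have "((\<lambda>t. of_real (h t) * (\<i> * z * exp (\<i> * z * of_real t)) + of_real (h1 t) * exp (\<i> * z * of_real t)) has_integral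
     (of_real (h 1) * exp (\<i> * z * of_real 1) - of_real (h (-1)) * exp (\<i> * z * of_real (-1)))) {-1..1}"
    by (rule fundamental_theorem_of_calculus) (auto intro: vd)
  moreover have "((\<lambda>t. (\<i> * z) * (of_real (h t) * exp (\<i> * z * of_real t)) + of_real (h1 t) * exp (\<i> * z * of_real t)) has_integral
     (\<i> * z) * integral {-1..1} (\<lambda>t. of_real (h t) * exp (\<i> * z * of_real t)) +
      integral {-1..1} (\<lambda>t. of_real (h1 t) * exp (\<i> * z * of_real t))) {-1..1}"
    using i0 i1 by (intro has_integral_add has_integral_mult_right) (auto simp: has_integral_integral)
  ultimately have "(\<i> * z) * integral {-1..1} (\<lambda>t. of_real (h t) * exp (\<i> * z * of_real t)) +
      integral {-1..1} (\<lambda>t. of_real (h1 t) * exp (\<i> * z * of_real t)) =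
      of_real (h 1) * exp (\<i> * z) - of_real (h (-1)) * exp (- (\<i> * z))"
    by (intro has_integral_unique) (simp_all add: mult_ac)
  thus ?thesis using z by (intro mult_add_eq_imp_eq_divide) auto
qed

lemma fourier_bound:
  fixes h :: "real \<Rightarrow> real" and z :: complex
  assumes c: "continuous_on UNIV h"
  shows "cmod (integral {-1..1} (\<lambda>t. of_real (h t) * exp (\<i> * z * of_real t))) \<le> exp \<bar>Im z\<bar> * integral {-1..1} (\<lambda>t. \<bar>h t\<bar>)"
proof -
  have c': "continuous_on {-1..1} h" using c continuous_on_subset by blast
  have "cmod (integral {-1..1} (\<lambda>t. of_real (h t) * exp (\<i> * z * of_real t))) \<le> integral {-1..1} (\<lambda>t. exp \<bar>Im z\<bar> * \<bar>h t\<bar>)"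
  proof (rule integral_norm_bound_integral)
    show "(\<lambda>t. of_real (h t) * exp (\<i> * z * of_real t)) integrable_on {-1..1}"
      using c' by (intro integrable_continuous_real continuous_intros)
    show "(\<lambda>t. exp \<bar>Im z\<bar> * \<bar>h t\<bar>) integrable_on {-1..1}"
      using c' by (intro integrable_continuous_real continuous_intros)
    fix t :: real assume t: "t \<in> {-1..1}"
    have "\<bar>Im z * t\<bar> \<le> \<bar>Im z\<bar>" using t mult_left_le[of "\<bar>t\<bar>" "\<bar>Im z\<bar>"] by (simp add: abs_mult abs_le_iff)
    hence "exp (- (Im z * t)) \<le> exp \<bar>Im z\<bar>" by simp
    hence "\<bar>h t\<bar> * exp (- (Im z * t)) \<le> \<bar>h t\<bar> * exp \<bar>Im z\<bar>" by (intro mult_left_mono) auto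
    thus "cmod (of_real (h t) * exp (\<i> * z * of_real t)) \<le> exp \<bar>Im z\<bar> * \<bar>h t\<bar>" by (simp add: norm_mult mult_ac)
  qed
  thus ?thesis by simp
qed

text \<open>One integration by parts yields the main term, a second one shows that what remains is
  smaller by one more power of \<open>z\<close>.\<close>

lemma fourier_asymp:
  fixes h h1 h2 :: "real \<Rightarrow> real" and z :: complex
  assumes d: "\<And>x. (h has_real_derivative h1 x) (at x)" "\<And>x. (h1 has_real_derivative h2 x) (at x)"
    and c: "continuous_on UNIV h2" and z: "z \<noteq> 0"
  shows "cmod (integral {-1..1} (\<lambda>t. of_real (h t) * exp (\<i> * z * of_real t)) -
    (of_real (h 1) * exp (\<i> * z) - of_real (h (-1)) * exp (- (\<i> * z))) / (\<i> * z))
     \<le> (\<bar>h1 1\<bar> + \<bar>h1 (-1)\<bar> + integral {-1..1} (\<lambda>t. \<bar>h2 t\<bar>)) * exp \<bar>Im z\<bar> / (cmod z)\<^sup>2"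
proof -
  have c1: "continuous_on UNIV h1" using d by (meson DERIV_isCont continuous_at_imp_continuous_on)
  let ?I = "\<lambda>h. integral {-1..1} (\<lambda>t. complex_of_real (h t) * exp (\<i> * z * of_real t))"
  have e: "cmod (exp (\<i> * z)) \<le> exp \<bar>Im z\<bar>" "cmod (exp (- (\<i> * z))) \<le> exp \<bar>Im z\<bar>" by auto
  have "cmod (?I h1 * (\<i> * z)) = cmod ((of_real (h1 1) * exp (\<i> * z) - of_real (h1 (-1)) * exp (- (\<i> * z))) - ?I h2)"
  proof -
    have "(P / w - Q / w) * w = P - Q" if "w \<noteq> 0" for P Q w :: complex using that by (simp add: field_simps)
    thus ?thesis unfolding fourier_ibp[OF d(2) c z] using z by simp
  qed
  also have "\<dots> \<le> (cmod (of_real (h1 1) * exp (\<i> * z)) + cmod (of_real (h1 (-1)) * exp (- (\<i> * z)))) + cmod (?I h2)"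
    by (meson add_mono norm_triangle_ineq4 order_refl order_trans)
  also have "\<dots> \<le> (\<bar>h1 1\<bar> * exp \<bar>Im z\<bar> + \<bar>h1 (-1)\<bar> * exp \<bar>Im z\<bar>) + exp \<bar>Im z\<bar> * integral {-1..1} (\<lambda>t. \<bar>h2 t\<bar>)"
    using e by (intro add_mono fourier_bound c) (auto simp: norm_mult intro!: mult_left_mono)
  finally have *: "cmod (?I h1) * cmod z \<le> (\<bar>h1 1\<bar> + \<bar>h1 (-1)\<bar> + integral {-1..1} (\<lambda>t. \<bar>h2 t\<bar>)) * exp \<bar>Im z\<bar>"
    by (simp add: norm_mult algebra_simps)
  have "cmod (?I h - (of_real (h 1) * exp (\<i> * z) - of_real (h (-1)) * exp (- (\<i> * z))) / (\<i> * z)) = cmod (?I h1) / cmod z"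
    unfolding fourier_ibp[OF d(1) c1 z] by (simp add: norm_divide norm_mult)
  also have "\<dots> \<le> (\<bar>h1 1\<bar> + \<bar>h1 (-1)\<bar> + integral {-1..1} (\<lambda>t. \<bar>h2 t\<bar>)) * exp \<bar>Im z\<bar> / (cmod z)\<^sup>2"
    using * z by (simp add: field_simps power2_eq_square)
  finally show ?thesis .
qed

section \<open>Decay and expansion of the entire extension at infinity\<close>

context prolate begin

text \<open>The constant left by a single integration by parts of the Fourier integral at a real
  frequency: both boundary values have modulus |g 1| by parity, and the rest is the total
  variation.\<close>

definition B :: real where "B = 2 * \<bar>g 1\<bar> + integral {-1..1} (\<lambda>t. \<bar>g1 t\<bar>)"

lemma g_minus_one: "g (-1) = (-1)^k * g 1" using g_parity[of 1] by simp

lemma cont_g2: "continuous_on A g2"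
proof -
  have "continuous_on A (\<lambda>x. Re (deriv (deriv F) (of_real x)))"
    by (intro continuous_intros continuous_on_compose2[OF holomorphic_on_imp_continuous_on[OF ddF_holo[of UNIV]]]) auto
  thus ?thesis by (simp add: g2_def[abs_def])
qed

lemma B_nonneg: "B \<ge> 0"
proof -
  have "integral {-1..1} (\<lambda>t. \<bar>g1 t\<bar>) \<ge> 0"
    by (intro integral_nonneg integrable_continuous_real continuous_intros cont_g1) auto
  thus ?thesis by (simp add: B_def)
qed

lemma g_decay: assumes "x > 0" shows "cmod \<mu> * \<bar>g x\<bar> \<le> B / (c * x)"
proof -
  define z where "z = complex_of_real (c * x)"
  have z: "z \<noteq> 0" "Im z = 0" using c_pos assms by (auto simp: z_def)
  have zn: "cmod z = c * x" unfolding z_def norm_of_real using c_pos assms by simp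
  let ?I = "\<lambda>h. integral {-1..1} (\<lambda>t. complex_of_real (h t) * exp (\<i> * z * of_real t))"
  have e: "cmod (exp (\<i> * z)) = 1" "cmod (exp (- (\<i> * z))) = 1" using z by auto
  have "\<mu> * F (of_real x) = ?I g"
    unfolding F_fourier_g by (rule integral_cong) (simp add: z_def mult.assoc)
  hence "cmod \<mu> * \<bar>g x\<bar> = cmod (?I g)" by (metis F_of_real norm_mult norm_of_real)
  also have "?I g = (of_real (g 1) * exp (\<i> * z) - of_real (g (-1)) * exp (- (\<i> * z)) - ?I g1) / (\<i> * z)"
    using fourier_ibp[OF g_deriv cont_g1 z(1)] by (simp add: diff_divide_distrib)
  also have "cmod \<dots> = cmod (of_real (g 1) * exp (\<i> * z) - of_real (g (-1)) * exp (- (\<i> * z)) - ?I g1) / (c * x)"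
    by (simp add: norm_divide norm_mult zn)
  also have "\<dots> \<le> B / (c * x)"
  proof (rule divide_right_mono)
    have "cmod (of_real (g 1) * exp (\<i> * z) - of_real (g (-1)) * exp (- (\<i> * z)) - ?I g1) \<le>
      (cmod (of_real (g 1) * exp (\<i> * z)) + cmod (of_real (g (-1)) * exp (- (\<i> * z)))) + cmod (?I g1)"
      by (meson add_mono norm_triangle_ineq4 order_refl order_trans)
    also have "\<dots> \<le> (\<bar>g 1\<bar> + \<bar>g 1\<bar>) + exp \<bar>Im z\<bar> * integral {-1..1} (\<lambda>t. \<bar>g1 t\<bar>)"
      by (intro add_mono fourier_bound cont_g1) (auto simp: norm_mult e g_minus_one abs_mult norm_power power_abs z)
    also have "\<dots> = B" by (simp add: B_def z)
    finally show "cmod (of_real (g 1) * exp (\<i> * z) - of_real (g (-1)) * exp (- (\<i> * z)) - ?I g1) \<le> B" .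
  qed (use c_pos assms in auto)
  finally show ?thesis .
qed

text \<open>Parity merges the boundary terms at 1 and -1 into a sine (even \<open>k\<close>) or a
  cosine (odd \<open>k\<close>). The constant \<open>K\<close> may stay implicit, since the
  expansion serves only in limits.\<close>

lemma F_asymp:
  obtains K where "K \<ge> 0" "\<And>z. z \<noteq> 0 \<Longrightarrow> cmod (\<mu> * F z - of_real (g 1) * (exp (\<i> * (of_real c * z)) - (-1)^k * exp (- (\<i> * (of_real c * z)))) / (\<i> * (of_real c * z)))
     \<le> K * exp (c * \<bar>Im z\<bar>) / (cmod z)\<^sup>2"
proof
  let ?K = "(\<bar>g1 1\<bar> + \<bar>g1 (-1)\<bar> + integral {-1..1} (\<lambda>t. \<bar>g2 t\<bar>)) / c\<^sup>2"
  show "?K \<ge> 0" by (intro divide_nonneg_nonneg add_nonneg_nonneg integral_nonneg integrable_continuous_real continuous_intros cont_g2) auto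
  fix z :: complex assume z: "z \<noteq> 0"
  define w where "w = of_real c * z"
  have w: "w \<noteq> 0" using z c_pos by (simp add: w_def)
  define Y where "Y = (of_real (g 1) * exp (\<i> * w) - of_real (g (-1)) * exp (- (\<i> * w))) / (\<i> * w)"
  have a: "\<mu> * F z = integral {-1..1} (\<lambda>t. complex_of_real (g t) * exp (\<i> * w * of_real t))"
    unfolding F_fourier_g w_def by (rule integral_cong) (simp add: mult.assoc)
  have b: "of_real (g 1) * (exp (\<i> * w) - (-1)^k * exp (- (\<i> * w))) / (\<i> * w) = Y"
    unfolding Y_def by (simp add: g_minus_one right_diff_distrib)
  have "cmod (\<mu> * F z - Y) \<le> (\<bar>g1 1\<bar> + \<bar>g1 (-1)\<bar> + integral {-1..1} (\<lambda>t. \<bar>g2 t\<bar>)) * exp \<bar>Im w\<bar> / (cmod w)\<^sup>2"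
    unfolding a Y_def by (intro fourier_asymp g_deriv g1_deriv cont_g2 w)
  also have "\<dots> = ?K * exp (c * \<bar>Im z\<bar>) / (cmod z)\<^sup>2"
    using c_pos z by (simp add: w_def norm_mult abs_mult power2_eq_square field_simps)
  finally show "cmod (\<mu> * F z - of_real (g 1) * (exp (\<i> * (of_real c * z)) - (-1)^k * exp (- (\<i> * (of_real c * z)))) / (\<i> * (of_real c * z)))
     \<le> ?K * exp (c * \<bar>Im z\<bar>) / (cmod z)\<^sup>2"
    using b by (simp add: w_def)
qed

lemma dF_fourier: "\<mu> * deriv F z = integral {-1..1} (\<lambda>t. of_real (g t) * (exp (\<i> * of_real c * z * of_real t) * (\<i> * of_real c * of_real t)))"
proof -
  have c2: "continuous_on A (\<lambda>p. complex_of_real (g (snd p)))" for A :: "(complex \<times> real) set"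
    by (intro continuous_intros continuous_on_compose2[OF cont_g[of UNIV]]) auto
  have "((\<lambda>z. integral (cbox (-1) (1::real)) (\<lambda>t. complex_of_real (g t) * exp (\<i> * of_real c * z * of_real t))) has_field_derivative
     integral (cbox (-1) 1) (\<lambda>t. of_real (g t) * (exp (\<i> * of_real c * z * of_real t) * (\<i> * of_real c * of_real t)))) (at z within UNIV)"
  proof (rule leibniz_rule_field_derivative)
    show "((\<lambda>x. complex_of_real (g t) * exp (\<i> * complex_of_real c * x * complex_of_real t)) has_field_derivative
            complex_of_real (g t) * (exp (\<i> * complex_of_real c * x * complex_of_real t) * (\<i> * complex_of_real c * complex_of_real t)))
            (at x within UNIV)" for x t
      by (auto intro!: derivative_eq_intros)
    show "(\<lambda>t. complex_of_real (g t) * exp (\<i> * complex_of_real c * x * complex_of_real t)) integrable_on cbox (- 1) 1" for x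
      by (intro integrable_continuous continuous_intros cont_g)
    show "continuous_on (UNIV \<times> cbox (- 1) 1)
     (\<lambda>(x, t). complex_of_real (g t) *
        (exp (\<i> * complex_of_real c * x * complex_of_real t) * (\<i> * complex_of_real c * complex_of_real t)))"
      using c2 by (auto simp: case_prod_unfold intro!: continuous_intros)
  qed auto
  hence d: "((\<lambda>z. \<mu> * F z) has_field_derivative
     integral {-1..1} (\<lambda>t. of_real (g t) * (exp (\<i> * of_real c * z * of_real t) * (\<i> * of_real c * of_real t)))) (at z)"
    unfolding F_fourier_g by simp
  have "((\<lambda>z. \<mu> * F z) has_field_derivative \<mu> * deriv F z) (at z)" by (intro DERIV_cmult dF)
  from DERIV_unique[OF this d] show ?thesis .
qed

text \<open>Differentiation under the integral replaces g(t) by t g(t). This has the opposite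
  parity, hence the plus sign between the exponentials.\<close>

lemma dF_asymp:
  obtains K where "K \<ge> 0" "\<And>z. z \<noteq> 0 \<Longrightarrow> cmod (\<mu> * deriv F z - of_real (g 1) * (exp (\<i> * (of_real c * z)) + (-1)^k * exp (- (\<i> * (of_real c * z)))) / z)
     \<le> K * exp (c * \<bar>Im z\<bar>) / (cmod z)\<^sup>2"
proof
  define h where "h = (\<lambda>t. t * g t)"
  define h1 where "h1 = (\<lambda>t. g t + t * g1 t)"
  define h2 where "h2 = (\<lambda>t. 2 * g1 t + t * g2 t)"
  have d: "(h has_real_derivative h1 t) (at t)" "(h1 has_real_derivative h2 t) (at t)" for t
    unfolding h_def h1_def h2_def by (auto intro!: derivative_eq_intros g_deriv g1_deriv)
  have ch2: "continuous_on UNIV h2" unfolding h2_def by (intro continuous_intros cont_g1 cont_g2)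
  let ?K = "(\<bar>h1 1\<bar> + \<bar>h1 (-1)\<bar> + integral {-1..1} (\<lambda>t. \<bar>h2 t\<bar>)) / c"
  show "?K \<ge> 0" using c_pos ch2
    by (intro divide_nonneg_nonneg add_nonneg_nonneg integral_nonneg integrable_continuous_real continuous_intros)
       (auto intro: continuous_on_subset)
  fix z :: complex assume z: "z \<noteq> 0"
  define w where "w = of_real c * z"
  have w: "w \<noteq> 0" using z c_pos by (simp add: w_def)
  define X where "X = integral {-1..1} (\<lambda>t. complex_of_real (h t) * exp (\<i> * w * of_real t))"
  define Y where "Y = (of_real (h 1) * exp (\<i> * w) - of_real (h (-1)) * exp (- (\<i> * w))) / (\<i> * w)"
  have "\<mu> * deriv F z = integral {-1..1} (\<lambda>t. \<i> * of_real c * (complex_of_real (h t) * exp (\<i> * w * of_real t)))"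
    unfolding dF_fourier w_def h_def by (rule integral_cong) (simp add: mult_ac)
  hence a: "\<mu> * deriv F z = \<i> * of_real c * X" by (simp add: X_def)
  have b: "of_real (g 1) * (exp (\<i> * w) + (-1)^k * exp (- (\<i> * w))) / z = \<i> * of_real c * Y"
    unfolding Y_def h_def using z c_pos by (simp add: g_minus_one w_def field_simps)
  have "cmod (\<i> * of_real c * X - \<i> * of_real c * Y) = c * cmod (X - Y)"
    using c_pos by (simp add: norm_mult flip: right_diff_distrib)
  also have "\<dots> \<le> c * ((\<bar>h1 1\<bar> + \<bar>h1 (-1)\<bar> + integral {-1..1} (\<lambda>t. \<bar>h2 t\<bar>)) * exp \<bar>Im w\<bar> / (cmod w)\<^sup>2)"
    unfolding X_def Y_def using c_pos by (intro mult_left_mono fourier_asymp d ch2 w) auto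
  also have "\<dots> = ?K * exp (c * \<bar>Im z\<bar>) / (cmod z)\<^sup>2"
    using c_pos z by (simp add: w_def norm_mult abs_mult power2_eq_square field_simps)
  finally show "cmod (\<mu> * deriv F z - of_real (g 1) * (exp (\<i> * (of_real c * z)) + (-1)^k * exp (- (\<i> * (of_real c * z)))) / z)
     \<le> ?K * exp (c * \<bar>Im z\<bar>) / (cmod z)\<^sup>2"
    using a b by (simp add: w_def)
qed

end

section \<open>Total variation\<close>

context prolate begin

lemma g_even_sq_integral: "integral {0..1} (\<lambda>t. (g t)\<^sup>2) = 1 / 2"
proof -
  have i: "(\<lambda>t. (g t)\<^sup>2) integrable_on {a..b}" for a b
    by (intro integrable_continuous_real continuous_intros cont_g)
  have "integral {-1..0} (\<lambda>t. (g t)\<^sup>2) = integral {-0..-(-1)} (\<lambda>t. (g (- t))\<^sup>2)"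
    using Henstock_Kurzweil_Integration.integral_reflect_real[where a = "-1" and b = 0 and f = "\<lambda>t. (g t)\<^sup>2"] by simp
  also have "\<dots> = integral {0..1} (\<lambda>t. (g t)\<^sup>2)"
    by (simp add: g_parity power_mult_distrib flip: power_mult)
  finally show ?thesis
    using Henstock_Kurzweil_Integration.integral_combine[of "-1" 0 1 "\<lambda>t. (g t)\<^sup>2"] i g_norm by simp
qed

lemma g1_abs_integral: "integral {-1..1} (\<lambda>t. \<bar>g1 t\<bar>) = 2 * integral {0..1} (\<lambda>t. \<bar>g1 t\<bar>)"
proof -
  have i: "(\<lambda>t. \<bar>g1 t\<bar>) integrable_on {a..b}" for a b
    by (intro integrable_continuous_real continuous_intros cont_g1)
  have "integral {-1..0} (\<lambda>t. \<bar>g1 t\<bar>) = integral {-0..-(-1)} (\<lambda>t. \<bar>g1 (- t)\<bar>)"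
    using Henstock_Kurzweil_Integration.integral_reflect_real[where a = "-1" and b = 0 and f = "\<lambda>t. \<bar>g1 t\<bar>"] by simp
  also have "\<dots> = integral {0..1} (\<lambda>t. \<bar>g1 t\<bar>)"
    by (simp add: g1_parity abs_mult power_abs)
  finally show ?thesis
    using Henstock_Kurzweil_Integration.integral_combine[of "-1" 0 1 "\<lambda>t. \<bar>g1 t\<bar>"] i by simp
qed

lemma g_g1_zero: "g 0 * g1 0 = 0"
  using g1_parity[of 0] g_parity[of 0] by (cases "even k") auto

text \<open>The divergence form multiplied by \<open>g\<close> and integrated over [0,1]: the
  boundary term at 1 vanishes with x^2 - 1, the one at 0 because an even or odd function has g(0)
  g1(0) = 0. A free bound \<open>Q\<close> replaces \<open>ch\<close> so that both functions of a
  pair can be measured by the larger parameter.\<close>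

lemma dirichlet_integral:
  assumes Q: "ch \<le> Q"
  shows "integral {0..1} (\<lambda>x. (1 - x\<^sup>2) * (g1 x)\<^sup>2) \<le> Q / 2"
proof -
  have d: "((\<lambda>x. (x\<^sup>2 - 1) * g1 x * g x) has_real_derivative (ch - c\<^sup>2 * x\<^sup>2) * (g x)\<^sup>2 - (1 - x\<^sup>2) * (g1 x)\<^sup>2) (at x within A)" for x A
  proof -
    have "((\<lambda>x. (x\<^sup>2 - 1) * g1 x * g x) has_real_derivative (ch - c\<^sup>2 * x\<^sup>2) * g x * g x + g1 x * ((x\<^sup>2 - 1) * g1 x)) (at x within A)"
      by (intro DERIV_mult g_flux g_deriv)
    moreover have "(ch - c\<^sup>2 * x\<^sup>2) * g x * g x + g1 x * ((x\<^sup>2 - 1) * g1 x) = (ch - c\<^sup>2 * x\<^sup>2) * (g x)\<^sup>2 - (1 - x\<^sup>2) * (g1 x)\<^sup>2"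
      by algebra
    ultimately show ?thesis by (simp only:)
  qed
  have "((\<lambda>x. (ch - c\<^sup>2 * x\<^sup>2) * (g x)\<^sup>2 - (1 - x\<^sup>2) * (g1 x)\<^sup>2) has_integral
     (1\<^sup>2 - 1) * g1 1 * g 1 - (0\<^sup>2 - 1) * g1 0 * g 0) {0..1}"
    using d by (intro fundamental_theorem_of_calculus) (auto simp: has_real_derivative_iff_has_vector_derivative)
  also have "(1\<^sup>2 - 1) * g1 1 * g 1 - (0\<^sup>2 - 1) * g1 0 * g 0 = 0" using g_g1_zero by (simp add: mult.commute)
  finally have "integral {0..1} (\<lambda>x. (ch - c\<^sup>2 * x\<^sup>2) * (g x)\<^sup>2 - (1 - x\<^sup>2) * (g1 x)\<^sup>2) = 0"
    by (rule integral_unique)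
  moreover have "integral {0..1} (\<lambda>x. (ch - c\<^sup>2 * x\<^sup>2) * (g x)\<^sup>2 - (1 - x\<^sup>2) * (g1 x)\<^sup>2) =
     integral {0..1} (\<lambda>x. (ch - c\<^sup>2 * x\<^sup>2) * (g x)\<^sup>2) - integral {0..1} (\<lambda>x. (1 - x\<^sup>2) * (g1 x)\<^sup>2)"
    by (intro integral_diff integrable_continuous_real continuous_intros cont_g cont_g1)
  moreover have "integral {0..1} (\<lambda>x. (ch - c\<^sup>2 * x\<^sup>2) * (g x)\<^sup>2) \<le> integral {0..1} (\<lambda>x. Q * (g x)\<^sup>2)"
  proof (intro integral_le integrable_continuous_real continuous_intros cont_g)
    fix x :: real
    have "0 \<le> c\<^sup>2 * x\<^sup>2" by simp
    hence "ch - c\<^sup>2 * x\<^sup>2 \<le> Q" using Q by linarith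
    thus "(ch - c\<^sup>2 * x\<^sup>2) * (g x)\<^sup>2 \<le> Q * (g x)\<^sup>2" by (rule mult_right_mono) simp
  qed
  ultimately show ?thesis by (simp add: g_even_sq_integral)
qed

text \<open>The flux vanishes at 1, so its value at \<open>x\<close> is an integral of
  \<open>g\<close> over [x,1]. The Cauchy-Schwarz inequality, with g^2 having integral at most 1/2
  there, supplies the square root.\<close>

lemma flux_near_one:
  assumes Q: "0 \<le> ch" "ch \<le> Q" "c\<^sup>2 \<le> Q" and x: "0 \<le> x" "x < 1"
  shows "\<bar>(x\<^sup>2 - 1) * g1 x\<bar> \<le> Q * sqrt ((1 - x) / 2)"
proof -
  define r where "r = sqrt ((1 - x) / 2)"
  have r: "r > 0" "r\<^sup>2 = (1 - x) / 2" using x by (auto simp: r_def)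
  have Q0: "Q \<ge> 0" using Q by linarith
  have "((\<lambda>x. (ch - c\<^sup>2 * x\<^sup>2) * g x) has_integral (1\<^sup>2 - 1) * g1 1 - (x\<^sup>2 - 1) * g1 x) {x..1}"
    using x g_flux by (intro fundamental_theorem_of_calculus) (auto simp: has_real_derivative_iff_has_vector_derivative)
  from integral_unique[OF this]
  have "integral {x..1} (\<lambda>x. (ch - c\<^sup>2 * x\<^sup>2) * g x) = - ((x\<^sup>2 - 1) * g1 x)"
    by (simp only: power_one diff_self mult_zero_left diff_0)
  hence "\<bar>(x\<^sup>2 - 1) * g1 x\<bar> = norm (integral {x..1} (\<lambda>x. (ch - c\<^sup>2 * x\<^sup>2) * g x))" by (simp only: real_norm_def abs_minus_cancel)
  also have "\<dots> \<le> integral {x..1} (\<lambda>t. Q / 2 * (1 / (2 * r)) + Q / 2 * (2 * r) * (g t)\<^sup>2)"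
  proof (rule integral_norm_bound_integral)
    fix t assume t: "t \<in> {x..1}"
    have t2: "0 \<le> t\<^sup>2" "t\<^sup>2 \<le> 1" using t x by (auto simp: abs_square_le_1)
    have "0 \<le> c\<^sup>2 * t\<^sup>2" "c\<^sup>2 * t\<^sup>2 \<le> Q" using t2 Q mult_left_le[of "t\<^sup>2" "c\<^sup>2"] by auto
    hence q: "\<bar>ch - c\<^sup>2 * t\<^sup>2\<bar> \<le> Q" using Q by linarith
    \<comment> \<open>Cauchy-Schwarz in pointwise form; the weight 2 r is the one for which both
      summands contribute equally after integration.\<close>
    have "\<bar>g t\<bar> \<le> 1 / 2 * (1 / (2 * r)) + 1 / 2 * (2 * r) * (g t)\<^sup>2"
    proof -
      have "0 \<le> (1 - 2 * r * \<bar>g t\<bar>)\<^sup>2" by simp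
      moreover have "(1 - 2 * r * \<bar>g t\<bar>)\<^sup>2 = 1 - 4 * r * \<bar>g t\<bar> + 4 * r\<^sup>2 * \<bar>g t\<bar>\<^sup>2" by algebra
      ultimately have "4 * r * \<bar>g t\<bar> \<le> 1 + 4 * r\<^sup>2 * (g t)\<^sup>2" unfolding power2_abs by linarith
      hence "4 * r * \<bar>g t\<bar> / (4 * r) \<le> (1 + 4 * r\<^sup>2 * (g t)\<^sup>2) / (4 * r)" by (rule divide_right_mono) (use r(1) in simp)
      also have "(1 + 4 * r\<^sup>2 * (g t)\<^sup>2) / (4 * r) = 1 / 2 * (1 / (2 * r)) + 1 / 2 * (2 * r) * (g t)\<^sup>2"
        using r by (simp add: field_simps power2_eq_square)
      finally show ?thesis using r by simp
    qed
    hence "\<bar>ch - c\<^sup>2 * t\<^sup>2\<bar> * \<bar>g t\<bar> \<le> Q * (1 / 2 * (1 / (2 * r)) + 1 / 2 * (2 * r) * (g t)\<^sup>2)"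
      using q Q0 by (intro mult_mono) auto
    also have "Q * (1 / 2 * (1 / (2 * r)) + 1 / 2 * (2 * r) * (g t)\<^sup>2) = Q / 2 * (1 / (2 * r)) + Q / 2 * (2 * r) * (g t)\<^sup>2"
      by (simp only: distrib_left mult.assoc times_divide_eq_left times_divide_eq_right mult_1_left)
    finally show "norm ((ch - c\<^sup>2 * t\<^sup>2) * g t) \<le> Q / 2 * (1 / (2 * r)) + Q / 2 * (2 * r) * (g t)\<^sup>2"
      unfolding real_norm_def abs_mult .
  qed (intro integrable_continuous_real continuous_intros cont_g)+
  also have "\<dots> = integral {x..1} (\<lambda>t. Q / 2 * (1 / (2 * r))) + integral {x..1} (\<lambda>t. Q / 2 * (2 * r) * (g t)\<^sup>2)"
    by (intro integral_add integrable_continuous_real continuous_intros cont_g)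
  also have "integral {x..1} (\<lambda>t. Q / 2 * (2 * r) * (g t)\<^sup>2) \<le> Q / 2 * (2 * r) * (1 / 2)"
  proof -
    have "integral {x..1} (\<lambda>t. (g t)\<^sup>2) \<le> integral {0..1} (\<lambda>t. (g t)\<^sup>2)"
      using x by (intro integral_subset_le integrable_continuous_real continuous_intros cont_g) auto
    hence "Q / 2 * (2 * r) * integral {x..1} (\<lambda>t. (g t)\<^sup>2) \<le> Q / 2 * (2 * r) * (1 / 2)"
      unfolding g_even_sq_integral using Q0 r(1) by (intro mult_left_mono mult_nonneg_nonneg) auto
    thus ?thesis by (simp only: Henstock_Kurzweil_Integration.integral_mult_right)
  qed
  also have "integral {x..1} (\<lambda>t. Q / 2 * (1 / (2 * r))) + Q / 2 * (2 * r) * (1 / 2) = Q * r"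
  proof -
    have "integral {x..1} (\<lambda>t. K) = (1 - x) * K" for K :: real using x by simp
    hence "integral {x..1} (\<lambda>t. Q / 2 * (1 / (2 * r))) = (1 - x) * (Q / 2 * (1 / (2 * r)))" .
    also have "1 - x = 2 * r\<^sup>2" unfolding r(2) by simp
    also have "2 * r\<^sup>2 * (Q / 2 * (1 / (2 * r))) = Q * r / 2" using r(1) by (simp add: power2_eq_square)
    finally have "integral {x..1} (\<lambda>t. Q / 2 * (1 / (2 * r))) = Q * r / 2" .
    thus ?thesis by (simp only:)
  qed
  finally show ?thesis by (simp add: r_def)
qed

text \<open>The weight 1 - x^2 of the Dirichlet integral degenerates at 1, so on the last stretch of
  length 1/Q the pointwise bound by the flux is integrated instead. It behaves like 1 / sqrt (1 - x)
  and yields about sqrt (Q / 2).\<close>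

lemma tv_near_one:
  assumes Q: "0 \<le> ch" "ch \<le> Q" "c\<^sup>2 \<le> Q" "Q \<ge> 900"
  shows "integral {1 - 1 / Q..1} (\<lambda>x. \<bar>g1 x\<bar>) \<le> 0.71 * sqrt Q"
proof -
  define h where "h = 1 / Q"
  have h: "0 < h" "h \<le> 1 / 900" using Q by (auto simp: h_def field_simps)
  define K where "K = Q / (sqrt 2 * (2 - h))"
  have K: "K \<ge> 0" using Q h by (simp add: K_def)
  \<comment> \<open>At x = 1 the quotient would be 0 by the convention for division, which is no
    majorant; the value is replaced at this single point.\<close>
  define b where "b = (\<lambda>x::real. if x = 1 then \<bar>g1 1\<bar> else K / sqrt (1 - x))"
  have "((\<lambda>x. K / sqrt (1 - x)) has_integral (- (2 * K) * sqrt (1 - 1)) - (- (2 * K) * sqrt (1 - (1 - h)))) {1 - h..1}"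
  proof (rule fundamental_theorem_of_calculus_interior)
    show "continuous_on {1 - h..1} (\<lambda>x. - (2 * K) * sqrt (1 - x))" by (intro continuous_intros)
    fix x assume x: "x \<in> {1 - h<..<1}"
    have "((\<lambda>x. - (2 * K) * sqrt (1 - x)) has_real_derivative - (2 * K) * (- 1 * (inverse (sqrt (1 - x)) / 2))) (at x)"
    proof -
      have "((\<lambda>x. 1 - x) has_real_derivative - 1) (at x)" by (auto intro!: derivative_eq_intros)
      moreover have "(sqrt has_real_derivative inverse (sqrt (1 - x)) / 2) (at (1 - x))"
        using x by (intro DERIV_real_sqrt) auto
      ultimately have "((\<lambda>x. sqrt (1 - x)) has_real_derivative inverse (sqrt (1 - x)) / 2 * - 1) (at x)"
        by (rule DERIV_chain2[rotated])
      from DERIV_cmult[OF this, of "- (2 * K)"] show ?thesis by (simp only: mult.commute[of _ "- 1"])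
    qed
    also have "- (2 * K) * (- 1 * (inverse (sqrt (1 - x)) / 2)) = K / sqrt (1 - x)" by (simp only: divide_inverse) simp
    finally show "((\<lambda>x. - (2 * K) * sqrt (1 - x)) has_vector_derivative K / sqrt (1 - x)) (at x)"
      by (simp add: has_real_derivative_iff_has_vector_derivative)
  qed (use h in simp)
  hence "((\<lambda>x. K / sqrt (1 - x)) has_integral 2 * K * sqrt h) {1 - h..1}" by simp
  hence bi: "(b has_integral 2 * K * sqrt h) {1 - h..1}"
    by (rule has_integral_spike_finite[of "{1}", rotated 2]) (auto simp: b_def)
  have "integral {1 - h..1} (\<lambda>x. \<bar>g1 x\<bar>) \<le> integral {1 - h..1} b"
  proof (rule integral_le)
    show "(\<lambda>x. \<bar>g1 x\<bar>) integrable_on {1 - h..1}" by (intro integrable_continuous_real continuous_intros cont_g1)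
    show "b integrable_on {1 - h..1}" using bi by blast
    fix x assume x: "x \<in> {1 - h..1}"
    show "\<bar>g1 x\<bar> \<le> b x"
    proof (cases "x = 1")
      case False
      hence x1: "x < 1" "0 \<le> x" "1 - h \<le> x" using x h by auto
      define s where "s = sqrt (1 - x)"
      have s: "s > 0" "s * s = 1 - x" using x1 by (auto simp: s_def)
      have "\<bar>(x\<^sup>2 - 1) * g1 x\<bar> \<le> Q * (s / sqrt 2)"
        using flux_near_one[OF Q(1-3) x1(2,1)] by (simp add: s_def real_sqrt_divide)
      moreover have "\<bar>(x\<^sup>2 - 1) * g1 x\<bar> = s * s * (1 + x) * \<bar>g1 x\<bar>"
      proof -
        have "x\<^sup>2 - 1 = - (s * s * (1 + x))" unfolding s by (simp add: power2_eq_square algebra_simps)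
        thus ?thesis using x1 s by (simp add: abs_mult)
      qed
      ultimately have "s * (s * (1 + x) * \<bar>g1 x\<bar>) \<le> s * (Q / sqrt 2)" by (simp add: mult_ac)
      hence "s * (1 + x) * \<bar>g1 x\<bar> \<le> Q / sqrt 2" using s by (simp only: mult_le_cancel_left_pos)
      moreover have "s * (2 - h) * \<bar>g1 x\<bar> \<le> s * (1 + x) * \<bar>g1 x\<bar>" using s x1 by (intro mult_right_mono mult_left_mono) auto
      ultimately have "s * (2 - h) * \<bar>g1 x\<bar> \<le> Q / sqrt 2" by linarith
      hence "\<bar>g1 x\<bar> \<le> Q / sqrt 2 / (s * (2 - h))" using s h by (simp add: pos_le_divide_eq mult_ac)
      also have "\<dots> = K / s" by (simp add: K_def)
      finally show ?thesis using False by (simp add: b_def s_def)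
    qed (simp add: b_def)
  qed
  also have "\<dots> = 2 * K * sqrt h" using bi by (rule integral_unique)
  also have "\<dots> \<le> 0.71 * sqrt Q"
  proof -
    have sq: "sqrt Q > 0" "sqrt Q * sqrt Q = Q" using Q by auto
    have sh: "sqrt h = 1 / sqrt Q" by (simp add: h_def real_sqrt_divide)
    have s2: "sqrt 2 \<ge> 1.414" by (rule real_le_rsqrt) (simp add: power2_eq_square)
    have "2 * K * sqrt h = 2 / (sqrt 2 * (2 - h)) * (Q / sqrt Q)" by (simp add: K_def sh)
    also have "Q / sqrt Q = sqrt Q" using sq by (simp add: field_simps)
    also have "2 / (sqrt 2 * (2 - h)) \<le> 0.71"
    proof -
      have "1.414 * (2 - 1/900) \<le> sqrt 2 * (2 - h)" using s2 h by (intro mult_mono) auto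
      thus ?thesis using h by (simp add: divide_le_eq)
    qed
    finally show ?thesis using sq by (simp add: mult_right_mono)
  qed
  finally show ?thesis by (simp add: h_def)
qed

text \<open>Cauchy-Schwarz with weight 1 - x^2. Stopping at 1 - 1/Q keeps the integral of 1 / (1 -
  x^2) below ln (2 Q) / 2, and the Dirichlet integral is at most Q / 2.\<close>

lemma tv_inner:
  assumes Q: "0 \<le> ch" "ch \<le> Q" "Q \<ge> 900"
  shows "integral {0..1 - 1 / Q} (\<lambda>x. \<bar>g1 x\<bar>) \<le> sqrt (Q * ln (2 * Q)) / 2"
proof -
  define h where "h = 1 / Q"
  have h: "0 < h" "h \<le> 1 / 900" using Q by (auto simp: h_def field_simps)
  define L where "L = ln (2 * Q)"
  have L: "L > 0" using Q by (simp add: L_def)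
  \<comment> \<open>The parameter that balances the two halves of the arithmetic-geometric
    inequality: \<alpha> Q = L / \<alpha>.\<close>
  define \<alpha> where "\<alpha> = sqrt (L / Q)"
  have a: "\<alpha> > 0" using L Q by (simp add: \<alpha>_def)
  have aQ: "\<alpha> * Q = sqrt (Q * L)" "L / \<alpha> = sqrt (Q * L)"
  proof -
    have "sqrt Q * sqrt Q = Q" "sqrt L * sqrt L = L" "sqrt Q > 0" "sqrt L > 0" using Q L by auto
    thus "\<alpha> * Q = sqrt (Q * L)" "L / \<alpha> = sqrt (Q * L)"
      by (simp_all add: \<alpha>_def real_sqrt_divide real_sqrt_mult field_simps)
  qed
  have ip: "((\<lambda>x. 1 / (1 - x\<^sup>2)) has_integral (ln (1 + (1 - h)) / 2 - ln (1 - (1 - h)) / 2) - (ln (1 + 0) / 2 - ln (1 - 0) / 2)) {0..1 - h}"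
  proof (rule fundamental_theorem_of_calculus)
    fix x assume x: "x \<in> {0..1 - h}"
    hence x1: "1 + x > 0" "1 - x > 0" using h by auto
    have "((\<lambda>x. ln (1 + x) / 2 - ln (1 - x) / 2) has_real_derivative 1 / (1 + x) / 2 - (- 1 / (1 - x)) / 2) (at x within {0..1 - h})"
    proof -
      have "((\<lambda>x. ln (1 + x)) has_real_derivative 1 / (1 + x)) (at x within {0..1 - h})"
        "((\<lambda>x. ln (1 - x)) has_real_derivative - 1 / (1 - x)) (at x within {0..1 - h})"
        using x1 by (auto intro!: derivative_eq_intros)
      thus ?thesis by (intro DERIV_diff DERIV_cdivide)
    qed
    also have "1 / (1 + x) / 2 - (- 1 / (1 - x)) / 2 = 1 / (1 - x\<^sup>2)"
    proof -
      have "1 - x\<^sup>2 = (1 + x) * (1 - x)" by (simp add: power2_eq_square algebra_simps)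
      moreover have "1 / a / 2 - (- 1 / b) / 2 = (a + b) / 2 / (a * b)" if "a > 0" "b > 0" for a b :: real
        using that by (simp add: field_simps)
      from this[OF x1] have "1 / (1 + x) / 2 - (- 1 / (1 - x)) / 2 = ((1 + x) + (1 - x)) / 2 / ((1 + x) * (1 - x))" .
      moreover have "((1 + x) + (1 - x)) / 2 = 1" by simp
      ultimately show ?thesis by (simp only:)
    qed
    finally show "((\<lambda>x. ln (1 + x) / 2 - ln (1 - x) / 2) has_vector_derivative 1 / (1 - x\<^sup>2)) (at x within {0..1 - h})"
      by (simp add: has_real_derivative_iff_has_vector_derivative)
  qed (use h in simp)
  have Lb: "(ln (1 + (1 - h)) / 2 - ln (1 - (1 - h)) / 2) - (ln (1 + 0) / 2 - ln (1 - 0) / 2) \<le> L / 2"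
  proof -
    have "ln (2 - h) \<le> ln 2" using h by simp
    moreover have "ln h = - ln Q" using Q by (simp add: h_def ln_div)
    moreover have "L = ln 2 + ln Q" using Q by (simp add: L_def ln_mult)
    ultimately show ?thesis by simp
  qed
  have pp: "(1 - x\<^sup>2) > 0" if "x \<in> {0..1 - h}" for x using that h by (simp add: abs_square_less_1)
  have cp: "continuous_on {0..1 - h} (\<lambda>x. 1 / (1 - x\<^sup>2))" using pp by (intro continuous_intros) force
  have "integral {0..1 - h} (\<lambda>x. \<bar>g1 x\<bar>) \<le> integral {0..1 - h} (\<lambda>x. \<alpha> / 2 * ((1 - x\<^sup>2) * (g1 x)\<^sup>2) + 1 / (2 * \<alpha>) * (1 / (1 - x\<^sup>2)))"
  proof (rule integral_le)
    fix x assume x: "x \<in> {0..1 - h}"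
    define p where "p = 1 - x\<^sup>2"
    have p: "p > 0" using pp[OF x] by (simp add: p_def)
    have "0 \<le> (\<alpha> * p * \<bar>g1 x\<bar> - 1)\<^sup>2" by simp
    hence "2 * (\<alpha> * p) * \<bar>g1 x\<bar> \<le> (\<alpha> * p)\<^sup>2 * (g1 x)\<^sup>2 + 1" by (simp add: power2_diff power_mult_distrib)
    hence "2 * (\<alpha> * p) * \<bar>g1 x\<bar> / (2 * (\<alpha> * p)) \<le> ((\<alpha> * p)\<^sup>2 * (g1 x)\<^sup>2 + 1) / (2 * (\<alpha> * p))"
      using a p by (intro divide_right_mono) auto
    also have "((\<alpha> * p)\<^sup>2 * (g1 x)\<^sup>2 + 1) / (2 * (\<alpha> * p)) = \<alpha> / 2 * (p * (g1 x)\<^sup>2) + 1 / (2 * \<alpha>) * (1 / p)"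
      using a p by (simp add: field_simps power2_eq_square)
    finally show "\<bar>g1 x\<bar> \<le> \<alpha> / 2 * ((1 - x\<^sup>2) * (g1 x)\<^sup>2) + 1 / (2 * \<alpha>) * (1 / (1 - x\<^sup>2))"
      using a p by (simp add: p_def)
  qed (intro integrable_continuous_real continuous_intros cont_g1 cp)+
  also have "\<dots> = \<alpha> / 2 * integral {0..1 - h} (\<lambda>x. (1 - x\<^sup>2) * (g1 x)\<^sup>2) + 1 / (2 * \<alpha>) * integral {0..1 - h} (\<lambda>x. 1 / (1 - x\<^sup>2))"
    by (subst integral_add) (intro integrable_continuous_real continuous_intros cont_g1 cp refl | simp only: Henstock_Kurzweil_Integration.integral_mult_right)+
  also have "\<dots> \<le> \<alpha> / 2 * (Q / 2) + 1 / (2 * \<alpha>) * (L / 2)"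
  proof (intro add_mono mult_left_mono)
    have "integral {0..1 - h} (\<lambda>x. (1 - x\<^sup>2) * (g1 x)\<^sup>2) \<le> integral {0..1} (\<lambda>x. (1 - x\<^sup>2) * (g1 x)\<^sup>2)"
    proof (rule integral_subset_le)
      show "\<forall>x\<in>{0..1}. 0 \<le> (1 - x\<^sup>2) * (g1 x)\<^sup>2"
        by (intro ballI mult_nonneg_nonneg) (auto simp: abs_square_le_1)
    next
      show "{0..1 - h} \<subseteq> {0..1}" using h by auto
    qed (intro integrable_continuous_real continuous_intros cont_g1)+
    also have "\<dots> \<le> Q / 2" by (rule dirichlet_integral[OF Q(2)])
    finally show "integral {0..1 - h} (\<lambda>x. (1 - x\<^sup>2) * (g1 x)\<^sup>2) \<le> Q / 2" .
    show "integral {0..1 - h} (\<lambda>x. 1 / (1 - x\<^sup>2)) \<le> L / 2" using integral_unique[OF ip] Lb by simp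
  qed (use a in auto)
  also have "\<dots> = (\<alpha> * Q + L / \<alpha>) / 4" by (simp add: field_simps)
  also have "\<dots> = sqrt (Q * L) / 2" unfolding aQ by simp
  finally show ?thesis by (simp add: h_def L_def)
qed

lemma B_bound:
  assumes Q: "0 \<le> ch" "ch \<le> Q" "c\<^sup>2 \<le> Q" "Q \<ge> 900"
  shows "B \<le> sqrt 2 + sqrt Q * (2 * sqrt (ln (2 * Q)) + 2.84)"
proof -
  define V where "V = integral {0..1} (\<lambda>x. \<bar>g1 x\<bar>)"
  have i: "(\<lambda>x. \<bar>g1 x\<bar>) integrable_on {a..b}" for a b
    by (intro integrable_continuous_real continuous_intros cont_g1)
  have "V = integral {0..1 - 1 / Q} (\<lambda>x. \<bar>g1 x\<bar>) + integral {1 - 1 / Q..1} (\<lambda>x. \<bar>g1 x\<bar>)"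
    unfolding V_def using Q i by (intro Henstock_Kurzweil_Integration.integral_combine[symmetric]) (auto simp: field_simps)
  hence V: "V \<le> sqrt (Q * ln (2 * Q)) / 2 + 0.71 * sqrt Q"
    using tv_near_one[OF Q] tv_inner[OF Q(1,2,4)] by linarith
  have "\<exists>x\<in>{0..1}. \<forall>y\<in>{0..1}. \<bar>g x\<bar> \<le> \<bar>g y\<bar>"
    by (rule continuous_attains_inf) (auto intro!: continuous_intros cont_g)
  then obtain x where x: "x \<in> {0..1}" "\<And>y. y \<in> {0..1} \<Longrightarrow> \<bar>g x\<bar> \<le> \<bar>g y\<bar>" by blast
  have "integral {0..1} (\<lambda>t::real. (g x)\<^sup>2) \<le> integral {0..1} (\<lambda>t. (g t)\<^sup>2)"
  proof (rule integral_le)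
    fix y :: real assume "y \<in> {0..1}"
    from x(2)[OF this] show "(g x)\<^sup>2 \<le> (g y)\<^sup>2" by (simp only: abs_le_square_iff)
  qed (intro integrable_continuous_real continuous_intros cont_g)+
  hence "(g x)\<^sup>2 \<le> 1 / 2" using g_even_sq_integral by simp
  hence gx: "\<bar>g x\<bar> \<le> sqrt (1 / 2)" by (simp add: real_le_rsqrt)
  have "(g1 has_integral g 1 - g x) {x..1}"
    using x(1) g_deriv by (intro fundamental_theorem_of_calculus) (auto simp: has_real_derivative_iff_has_vector_derivative)
  hence "\<bar>g 1 - g x\<bar> = norm (integral {x..1} g1)" by (simp add: integral_unique)
  also have "\<dots> \<le> integral {x..1} (\<lambda>t. \<bar>g1 t\<bar>)"
    by (rule integral_norm_bound_integral) (auto intro!: i integrable_continuous_real cont_g1)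
  also have "\<dots> \<le> V" unfolding V_def using x(1) by (intro integral_subset_le i) auto
  finally have "\<bar>g 1\<bar> \<le> sqrt (1 / 2) + V" using gx by linarith
  hence "B \<le> 2 * sqrt (1 / 2) + 4 * V" unfolding B_def g1_abs_integral V_def by linarith
  also have "2 * sqrt (1 / 2) = sqrt 2" by (simp add: real_sqrt_divide field_simps)
  finally show ?thesis using V by (simp add: real_sqrt_mult algebra_simps)
qed

end

section \<open>Counting and separating zeros\<close>

text \<open>Along the Riccati flow arctan (y / \<omega>) decreases at the rate \<omega> + \<omega>
  (T - \<omega>^2) / (\<omega>^2 + y^2). The worst case is y = 0 when T \<ge> \<omega>^2 and |y|
  infinite otherwise, and both are covered by \<Phi>'. Hence arctan (y / \<omega>) + \<Phi> is
  nondecreasing, while the arctangent has to fall from \<open>L\<close> to -pi/2.\<close>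

lemma riccati_phase:
  fixes y T \<Phi> \<Phi>' :: "real \<Rightarrow> real"
  assumes ab: "a < b" and \<omega>: "\<omega> > 0"
    and d: "\<And>x. a < x \<Longrightarrow> x < b \<Longrightarrow> (y has_real_derivative - T x - (y x)\<^sup>2) (at x)"
    and \<Phi>: "\<And>x. a \<le> x \<Longrightarrow> x \<le> b \<Longrightarrow> (\<Phi> has_real_derivative \<Phi>' x) (at x)"
    and bd: "\<And>x. a < x \<Longrightarrow> x < b \<Longrightarrow> \<omega> \<le> \<Phi>' x \<and> \<omega> + (T x - \<omega>\<^sup>2) / \<omega> \<le> \<Phi>' x"
    and lb: "filterlim y at_bot (at_left b)"
    and la: "((\<lambda>x. arctan (y x / \<omega>)) \<longlongrightarrow> L) (at_right a)"
  shows "L + pi / 2 \<le> \<Phi> b - \<Phi> a"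
proof -
  define H where "H = (\<lambda>x. arctan (y x / \<omega>) + \<Phi> x)"
  have mono: "H u \<le> H v" if "a < u" "u \<le> v" "v < b" for u v
  proof (rule DERIV_nonneg_imp_nondecreasing[OF that(2)])
    fix x assume "u \<le> x" "x \<le> v"
    hence x: "a < x" "x < b" using that by auto
    have pos: "\<omega>\<^sup>2 + (y x)\<^sup>2 > 0" using \<omega> by (simp add: add_pos_nonneg)
    have "((\<lambda>x. y x / \<omega>) has_real_derivative (- T x - (y x)\<^sup>2) / \<omega>) (at x)"
      by (intro DERIV_cdivide d x)
    hence "((\<lambda>x. arctan (y x / \<omega>)) has_real_derivative inverse (1 + (y x / \<omega>)\<^sup>2) * ((- T x - (y x)\<^sup>2) / \<omega>)) (at x)"
      by (rule DERIV_chain2[OF DERIV_arctan])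
    hence D: "(H has_real_derivative inverse (1 + (y x / \<omega>)\<^sup>2) * ((- T x - (y x)\<^sup>2) / \<omega>) + \<Phi>' x) (at x)"
      unfolding H_def using x by (intro DERIV_add \<Phi>) auto
    have "inverse (1 + (y x / \<omega>)\<^sup>2) * ((- T x - (y x)\<^sup>2) / \<omega>) = - (\<omega> + \<omega> * (T x - \<omega>\<^sup>2) / (\<omega>\<^sup>2 + (y x)\<^sup>2))"
    proof -
      have "1 + (y x / \<omega>)\<^sup>2 = (\<omega>\<^sup>2 + (y x)\<^sup>2) / \<omega>\<^sup>2" using \<omega> by (simp add: power_divide add_divide_distrib)
      hence "inverse (1 + (y x / \<omega>)\<^sup>2) * ((- T x - (y x)\<^sup>2) / \<omega>) = \<omega> * (- T x - (y x)\<^sup>2) / (\<omega>\<^sup>2 + (y x)\<^sup>2)"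
        using \<omega> by (simp add: power2_eq_square)
      also have "\<omega> * (- T x - (y x)\<^sup>2) = - (\<omega> * (\<omega>\<^sup>2 + (y x)\<^sup>2) + \<omega> * (T x - \<omega>\<^sup>2))" by algebra
      also have "\<dots> / (\<omega>\<^sup>2 + (y x)\<^sup>2) = - (\<omega> + \<omega> * (T x - \<omega>\<^sup>2) / (\<omega>\<^sup>2 + (y x)\<^sup>2))"
        using pos by (simp only: minus_divide_left[symmetric] add_divide_distrib) simp
      finally show ?thesis .
    qed
    moreover have "\<omega> + \<omega> * (T x - \<omega>\<^sup>2) / (\<omega>\<^sup>2 + (y x)\<^sup>2) \<le> \<Phi>' x"
    proof (cases "T x \<ge> \<omega>\<^sup>2")
      case True
      have "\<omega> * (T x - \<omega>\<^sup>2) / (\<omega>\<^sup>2 + (y x)\<^sup>2) \<le> \<omega> * (T x - \<omega>\<^sup>2) / \<omega>\<^sup>2"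
        using True \<omega> pos by (intro divide_left_mono mult_nonneg_nonneg) auto
      also have "\<dots> = (T x - \<omega>\<^sup>2) / \<omega>" using \<omega> by (simp add: power2_eq_square)
      finally show ?thesis using bd[OF x] by linarith
    next
      case False
      hence "\<omega> * (T x - \<omega>\<^sup>2) / (\<omega>\<^sup>2 + (y x)\<^sup>2) \<le> 0" using \<omega> pos by (intro divide_nonpos_pos mult_nonneg_nonpos) auto
      thus ?thesis using bd[OF x] by linarith
    qed
    ultimately show "\<exists>D. (H has_real_derivative D) (at x) \<and> 0 \<le> D" using D by (intro exI conjI) (assumption, linarith)
  qed
  define m where "m = (a + b) / 2"
  have m: "a < m" "m < b" using ab by (auto simp: m_def)
  have ca: "(\<Phi> \<longlongrightarrow> \<Phi> a) (at_right a)" "(\<Phi> \<longlongrightarrow> \<Phi> b) (at_left b)"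
    using \<Phi>[of a] \<Phi>[of b] ab by (auto intro!: tendsto_within_subset[OF DERIV_isCont[unfolded isCont_def]])
  have "((\<lambda>x. H x) \<longlongrightarrow> L + \<Phi> a) (at_right a)" unfolding H_def by (intro tendsto_add la ca)
  moreover have "\<forall>\<^sub>F x in at_right a. H x \<le> H m"
    using eventually_at_right_less[of a] eventually_at_right_real[OF m(1)]
    by eventually_elim (rule mono, use m in auto)
  ultimately have 1: "L + \<Phi> a \<le> H m" by (rule tendsto_upperbound) simp
  have "filterlim (\<lambda>x. inverse \<omega> * y x) at_bot (at_left b)"
    using \<omega> by (intro filterlim_tendsto_pos_mult_at_bot[OF tendsto_const _ lb]) auto
  hence "((\<lambda>x. arctan (inverse \<omega> * y x)) \<longlongrightarrow> - (pi / 2)) (at_left b)"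
    by (rule filterlim_compose[OF tendsto_arctan_at_bot])
  hence "((\<lambda>x. arctan (y x / \<omega>)) \<longlongrightarrow> - (pi / 2)) (at_left b)"
    by (simp only: divide_inverse mult.commute)
  hence "((\<lambda>x. H x) \<longlongrightarrow> - (pi / 2) + \<Phi> b) (at_left b)" unfolding H_def by (intro tendsto_add ca)
  moreover have "\<forall>\<^sub>F x in at_left b. H m \<le> H x"
    using eventually_at_left_real[OF m(2)]
    by eventually_elim (rule mono, use m in auto)
  ultimately have "H m \<le> - (pi / 2) + \<Phi> b" by (rule tendsto_lowerbound) simp
  with 1 show ?thesis by linarith
qed

lemma log_deriv_at_zero:
  fixes g g1 :: "real \<Rightarrow> real"
  assumes d: "\<And>x. (g has_real_derivative g1 x) (at x)" and c: "isCont g1 b" and z: "g b = 0" "g1 b \<noteq> 0"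
  shows "filterlim (\<lambda>x. g1 x / g x) at_bot (at_left b)" "filterlim (\<lambda>x. g1 x / g x) at_top (at_right b)"
proof -
  \<comment> \<open>Multiplication by the slope at \<open>b\<close> makes the derivative positive
    there, so that one argument covers rising and falling zeros.\<close>
  define k where "k = (\<lambda>x. g x * g1 b)"
  have dk: "(k has_real_derivative g1 b * g1 b) (at b)" unfolding k_def by (intro DERIV_cmult_right d)
  have pos: "g1 b * g1 b > 0" using z(2) by (auto simp: zero_less_mult_iff neq_iff)
  have k0: "k b = 0" by (simp add: k_def z)
  have lk: "(k \<longlongrightarrow> 0) (at b)" using DERIV_isCont[OF dk] k0 by (simp add: isCont_def)
  have l1: "((\<lambda>x. g1 x * g1 b) \<longlongrightarrow> g1 b * g1 b) (at b)" using c unfolding isCont_def by (intro tendsto_mult_right)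
  have eq: "g1 x / g x = (g1 x * g1 b) * inverse (k x)" for x using z by (simp add: k_def divide_inverse)
  obtain e where e: "e > 0" "\<And>h. 0 < h \<Longrightarrow> h < e \<Longrightarrow> k (b - h) < k b"
    using DERIV_pos_inc_left[OF dk pos] by blast
  obtain e' where e': "e' > 0" "\<And>h. 0 < h \<Longrightarrow> h < e' \<Longrightarrow> k b < k (b + h)"
    using DERIV_pos_inc_right[OF dk pos] by blast
  have evl: "\<forall>\<^sub>F x in at_left b. k x < 0"
  proof -
    have "k x < 0" if "b - e < x" "x < b" for x using e(2)[of "b - x"] that k0 by simp
    thus ?thesis unfolding eventually_at_left_field using e(1) by (intro exI[of _ "b - e"]) auto
  qed
  have evr: "\<forall>\<^sub>F x in at_right b. 0 < k x"
  proof -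
    have "0 < k x" if "b < x" "x < b + e'" for x using e'(2)[of "x - b"] that k0 by simp
    thus ?thesis unfolding eventually_at_right_field using e'(1) by (intro exI[of _ "b + e'"]) auto
  qed
  show "filterlim (\<lambda>x. g1 x / g x) at_bot (at_left b)" unfolding eq
  proof (rule filterlim_tendsto_pos_mult_at_bot[OF _ pos])
    show "((\<lambda>x. g1 x * g1 b) \<longlongrightarrow> g1 b * g1 b) (at_left b)" by (rule tendsto_within_subset[OF l1]) simp
    show "filterlim (\<lambda>x. inverse (k x)) at_bot (at_left b)"
      by (rule filterlim_inverse_at_bot[OF tendsto_within_subset[OF lk] evl]) simp
  qed
  show "filterlim (\<lambda>x. g1 x / g x) at_top (at_right b)" unfolding eq
  proof (rule filterlim_tendsto_pos_mult_at_top[OF _ pos])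
    show "((\<lambda>x. g1 x * g1 b) \<longlongrightarrow> g1 b * g1 b) (at_right b)" by (rule tendsto_within_subset[OF l1]) simp
    show "filterlim (\<lambda>x. inverse (k x)) at_top (at_right b)"
      by (rule filterlim_inverse_at_top[OF tendsto_within_subset[OF lk] evr]) simp
  qed
qed

lemma card_by_spacing:
  fixes \<Phi> :: "real \<Rightarrow> real"
  assumes "finite Z" "Z \<noteq> {}" "\<And>z z'. z \<in> Z \<Longrightarrow> z' \<in> Z \<Longrightarrow> z < z' \<Longrightarrow> d \<le> \<Phi> z' - \<Phi> z"
  shows "(real (card Z) - 1) * d \<le> \<Phi> (Max Z) - \<Phi> (Min Z)"
  using assms
proof (induction Z rule: finite_linorder_max_induct)
  case (insert b A)
  show ?case
  proof (cases "A = {}")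
    case False
    have m: "Max (insert b A) = b" using insert by (intro Max_eqI) auto
    have mi: "Min (insert b A) = Min A" using insert False
      by (intro Min_eqI) (auto, meson Max_ge Min_in Min_le less_le_not_le linear order_trans)
    have "(real (card A) - 1) * d \<le> \<Phi> (Max A) - \<Phi> (Min A)" using insert False by auto
    moreover have "d \<le> \<Phi> b - \<Phi> (Max A)" using insert False Max_in[of A] by auto
    moreover have "b \<notin> A" using insert by auto
    ultimately show ?thesis using insert m mi by (simp add: algebra_simps)
  qed (use insert in simp)
qed simp

text \<open>Comparison with an integral: \<open>\<Psi>\<close> stands for an antiderivative of -f,
  so each point other than the smallest contributes at most the drop of \<open>\<Psi>\<close> over
  the gap before it, divided by \<open>d\<close>. The smallest point is charged f(s0).\<close>

lemma sum_by_spacing: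
  fixes f \<Psi> :: "real \<Rightarrow> real"
  assumes "finite Z" "Z \<noteq> {}" "\<And>z. z \<in> Z \<Longrightarrow> s0 \<le> z"
    and "\<And>z z'. z \<in> Z \<Longrightarrow> z' \<in> Z \<Longrightarrow> z < z' \<Longrightarrow> d \<le> z' - z" and d: "d > 0"
    and f: "\<And>u v. s0 \<le> u \<Longrightarrow> u \<le> v \<Longrightarrow> f v \<le> f u" "\<And>u. s0 \<le> u \<Longrightarrow> 0 \<le> f u"
    and \<Psi>: "\<And>u v. s0 \<le> u \<Longrightarrow> u \<le> v \<Longrightarrow> f v * (v - u) \<le> \<Psi> u - \<Psi> v"
  shows "sum f Z \<le> f s0 + (\<Psi> s0 - \<Psi> (Max Z)) / d"
  using assms(1-4)
proof (induction Z rule: finite_linorder_max_induct)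
  case (insert b A)
  have b: "s0 \<le> b" using insert by auto
  show ?case
  proof (cases "A = {}")
    case True
    have "0 \<le> f b * (b - s0)" using f(2) b by auto
    hence "0 \<le> \<Psi> s0 - \<Psi> b" using \<Psi>[of s0 b] b by linarith
    thus ?thesis using True f(1)[of s0 b] b d by (simp add: add_increasing2)
  next
    case False
    have M: "Max A \<in> A" "Max A < b" "s0 \<le> Max A" using insert False by auto
    have m: "Max (insert b A) = b" using insert by (intro Max_eqI) auto
    have "sum f A \<le> f s0 + (\<Psi> s0 - \<Psi> (Max A)) / d" using insert False by auto
    moreover have "f b * d \<le> \<Psi> (Max A) - \<Psi> b"
    proof -
      have "d \<le> b - Max A" using insert M by auto
      hence "f b * d \<le> f b * (b - Max A)" using f(2)[OF b] by (intro mult_left_mono) auto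
      also have "\<dots> \<le> \<Psi> (Max A) - \<Psi> b" using M by (intro \<Psi>) auto
      finally show ?thesis .
    qed
    hence "f b \<le> (\<Psi> (Max A) - \<Psi> b) / d" using d by (simp add: pos_le_divide_eq)
    moreover have "b \<notin> A" using insert by auto
    ultimately show ?thesis using insert(1) m by (simp add: diff_divide_distrib)
  qed
qed simp

section \<open>Gaps between zeros and the root count\<close>

context prolate begin

text \<open>The substitution y = g' / g + x / (x^2 - 1) turns the differential equation into y' = - T - y^2.\<close>
definition T :: "real \<Rightarrow> real" where "T x = (c\<^sup>2 * x\<^sup>2 - ch) / (x\<^sup>2 - 1) + 1 / (x\<^sup>2 - 1)\<^sup>2"

lemma y_deriv:
  assumes x: "x\<^sup>2 \<noteq> 1" "g x \<noteq> 0"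
  shows "((\<lambda>x. g1 x / g x + x / (x\<^sup>2 - 1)) has_real_derivative - T x - (g1 x / g x + x / (x\<^sup>2 - 1))\<^sup>2) (at x)"
proof -
  define P where "P = x\<^sup>2 - 1"
  have P: "P \<noteq> 0" using x by (simp add: P_def)
  have "((\<lambda>x. g1 x / g x) has_real_derivative (g2 x * g x - g1 x * g1 x) / (g x * g x)) (at x)"
    by (intro DERIV_divide g_deriv g1_deriv x)
  moreover have "((\<lambda>x. x / (x\<^sup>2 - 1)) has_real_derivative (1 * (x\<^sup>2 - 1) - x * (2 * x)) / ((x\<^sup>2 - 1) * (x\<^sup>2 - 1))) (at x)"
    using x by (intro DERIV_divide) (auto intro!: derivative_eq_intros)
  ultimately have "((\<lambda>x. g1 x / g x + x / (x\<^sup>2 - 1)) has_real_derivative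
     (g2 x * g x - g1 x * g1 x) / (g x * g x) + (1 * (x\<^sup>2 - 1) - x * (2 * x)) / ((x\<^sup>2 - 1) * (x\<^sup>2 - 1))) (at x)"
    by (rule DERIV_add)
  moreover have "(g2 x * g x - g1 x * g1 x) / (g x * g x) + (1 * (x\<^sup>2 - 1) - x * (2 * x)) / ((x\<^sup>2 - 1) * (x\<^sup>2 - 1)) =
     - T x - (g1 x / g x + x / (x\<^sup>2 - 1))\<^sup>2"
  proof -
    define r where "r = g1 x / g x"
    have "P * g2 x = (ch - c\<^sup>2 * x\<^sup>2) * g x - 2 * x * g1 x" using g_ode[of x] unfolding P_def by algebra
    hence g2: "g2 x = ((ch - c\<^sup>2 * x\<^sup>2) * g x - 2 * x * g1 x) / P"
      by (intro eq_divide_imp[OF P]) (simp only: mult.commute)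
    have "(U * G - 2 * x * G1) / P / G = U / P - 2 * x * (G1 / G) / P" if "G \<noteq> 0" for U G G1 :: real
      using that by (simp add: diff_divide_distrib)
    hence "g2 x / g x = (ch - c\<^sup>2 * x\<^sup>2) / P - 2 * x * r / P" unfolding g2 r_def using x(2) by blast
    hence 1: "(g2 x * g x - g1 x * g1 x) / (g x * g x) = (ch - c\<^sup>2 * x\<^sup>2) / P - 2 * x * r / P - r\<^sup>2"
      using x by (simp add: r_def diff_divide_distrib power2_eq_square)
    have 2: "(1 * P - x * (2 * x)) / (P * P) = 1 / P - 2 * x\<^sup>2 / P\<^sup>2" using P by (simp add: field_simps power2_eq_square)
    have 3: "1 / P = x\<^sup>2 / P\<^sup>2 - 1 / P\<^sup>2"
      unfolding diff_divide_distrib[symmetric] P_def[symmetric] using P by (simp add: power2_eq_square)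
    have 5: "(c\<^sup>2 * x\<^sup>2 - ch) / P = - ((ch - c\<^sup>2 * x\<^sup>2) / P)" by (simp only: minus_divide_left minus_diff_eq)
    have 4: "(r + x / P)\<^sup>2 = r\<^sup>2 + 2 * x * r / P + x\<^sup>2 / P\<^sup>2" by (simp add: power2_sum power_divide)
    show ?thesis unfolding T_def P_def[symmetric] r_def[symmetric] 1 2 4 5 using 3 by simp
  qed
  ultimately show ?thesis by (simp only:)
qed

lemma y_limits:
  assumes "b\<^sup>2 \<noteq> 1" "g b = 0" "g1 b \<noteq> 0"
  shows "filterlim (\<lambda>x. g1 x / g x + x / (x\<^sup>2 - 1)) at_bot (at_left b)"
    "filterlim (\<lambda>x. g1 x / g x + x / (x\<^sup>2 - 1)) at_top (at_right b)"
proof -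
  have c: "isCont g1 b" using DERIV_isCont[OF g1_deriv] .
  have l: "((\<lambda>x. x / (x\<^sup>2 - 1)) \<longlongrightarrow> b / (b\<^sup>2 - 1)) (at b within A)" for A
    using assms(1) by (intro tendsto_intros) auto
  show "filterlim (\<lambda>x. g1 x / g x + x / (x\<^sup>2 - 1)) at_bot (at_left b)"
  proof -
    have "filterlim (\<lambda>x. - (g1 x / g x)) at_top (at_left b)"
      using log_deriv_at_zero(1)[OF g_deriv c assms(2,3)] by (simp only: filterlim_uminus_at_bot)
    hence "filterlim (\<lambda>x. - (x / (x\<^sup>2 - 1)) + - (g1 x / g x)) at_top (at_left b)"
      by (rule filterlim_tendsto_add_at_top[OF tendsto_minus[OF l]])
    thus ?thesis unfolding filterlim_uminus_at_bot minus_add_distrib by (simp only: add.commute)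
  qed
  show "filterlim (\<lambda>x. g1 x / g x + x / (x\<^sup>2 - 1)) at_top (at_right b)"
    by (subst add.commute) (rule filterlim_tendsto_add_at_top[OF l log_deriv_at_zero(2)[OF g_deriv c assms(2,3)]])
qed

text \<open>Between consecutive zeros the logarithmic derivative falls from plus to minus infinity,
  so the arctangent drops by pi.\<close>

lemma zero_gap:
  assumes ab: "a < b" and \<omega>: "\<omega> > 0"
    and nz: "\<And>x. a < x \<Longrightarrow> x < b \<Longrightarrow> g x \<noteq> 0" and ne: "\<And>x. a \<le> x \<Longrightarrow> x \<le> b \<Longrightarrow> x\<^sup>2 \<noteq> 1"
    and z: "g a = 0" "g b = 0" "g1 a \<noteq> 0" "g1 b \<noteq> 0"
    and \<Phi>: "\<And>x. a \<le> x \<Longrightarrow> x \<le> b \<Longrightarrow> (\<Phi> has_real_derivative \<Phi>' x) (at x)"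
    and bd: "\<And>x. a < x \<Longrightarrow> x < b \<Longrightarrow> \<omega> \<le> \<Phi>' x \<and> \<omega> + (T x - \<omega>\<^sup>2) / \<omega> \<le> \<Phi>' x"
  shows "pi \<le> \<Phi> b - \<Phi> a"
proof -
  let ?y = "\<lambda>x. g1 x / g x + x / (x\<^sup>2 - 1)"
  have "filterlim (\<lambda>x. inverse \<omega> * ?y x) at_top (at_right a)"
    using \<omega> y_limits(2)[of a] z ne[of a] ab by (intro filterlim_tendsto_pos_mult_at_top[OF tendsto_const]) auto
  hence "((\<lambda>x. arctan (inverse \<omega> * ?y x)) \<longlongrightarrow> pi / 2) (at_right a)"
    by (rule filterlim_compose[OF tendsto_arctan_at_top])
  hence la: "((\<lambda>x. arctan (?y x / \<omega>)) \<longlongrightarrow> pi / 2) (at_right a)" by (simp only: divide_inverse mult.commute)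
  have "pi / 2 + pi / 2 \<le> \<Phi> b - \<Phi> a"
    by (rule riccati_phase[OF ab \<omega> _ \<Phi> bd y_limits(1) la])
       (use ne nz z ab in \<open>auto intro!: y_deriv\<close>)
  thus ?thesis by simp
qed

text \<open>Starting from a point where y \<ge> 0 instead of a zero, the arctangent still has to
  drop by at least pi / 2.\<close>

lemma zero_half_gap:
  assumes ab: "a < b" and \<omega>: "\<omega> > 0"
    and nz: "\<And>x. a \<le> x \<Longrightarrow> x < b \<Longrightarrow> g x \<noteq> 0" and ne: "\<And>x. a \<le> x \<Longrightarrow> x \<le> b \<Longrightarrow> x\<^sup>2 \<noteq> 1"
    and z: "g1 a / g a + a / (a\<^sup>2 - 1) \<ge> 0" "g b = 0" "g1 b \<noteq> 0"
    and \<Phi>: "\<And>x. a \<le> x \<Longrightarrow> x \<le> b \<Longrightarrow> (\<Phi> has_real_derivative \<Phi>' x) (at x)"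
    and bd: "\<And>x. a < x \<Longrightarrow> x < b \<Longrightarrow> \<omega> \<le> \<Phi>' x \<and> \<omega> + (T x - \<omega>\<^sup>2) / \<omega> \<le> \<Phi>' x"
  shows "pi / 2 \<le> \<Phi> b - \<Phi> a"
proof -
  let ?y = "\<lambda>x. g1 x / g x + x / (x\<^sup>2 - 1)"
  have "isCont ?y a" using y_deriv[of a] ne[of a] nz[of a] ab DERIV_isCont by force
  hence "(?y \<longlongrightarrow> ?y a) (at_right a)" unfolding isCont_def by (rule tendsto_within_subset) simp
  hence la: "((\<lambda>x. arctan (?y x / \<omega>)) \<longlongrightarrow> arctan (?y a / \<omega>)) (at_right a)"
    using \<omega> by (intro tendsto_arctan tendsto_divide tendsto_const) auto
  have "arctan (?y a / \<omega>) + pi / 2 \<le> \<Phi> b - \<Phi> a"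
    by (rule riccati_phase[OF ab \<omega> _ \<Phi> bd y_limits(1) la])
       (use ne nz z ab in \<open>auto intro!: y_deriv\<close>)
  moreover have "arctan (?y a / \<omega>) \<ge> 0" using z \<omega> by simp
  ultimately show ?thesis by linarith
qed

text \<open>The zeros need not be consecutive: the estimate is applied up to the first zero after
  \<open>a\<close>, and \<open>\<Phi>\<close> does not decrease afterwards.\<close>

lemma zero_gap_general:
  assumes ab: "a < b" and \<omega>: "\<omega> > 0"
    and fin: "finite {x \<in> {a..b}. g x = 0}" and simple: "\<And>x. a \<le> x \<Longrightarrow> x \<le> b \<Longrightarrow> g x = 0 \<Longrightarrow> g1 x \<noteq> 0"
    and ne: "\<And>x. a \<le> x \<Longrightarrow> x \<le> b \<Longrightarrow> x\<^sup>2 \<noteq> 1" and z: "g a = 0" "g b = 0"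
    and \<Phi>: "\<And>x. a \<le> x \<Longrightarrow> x \<le> b \<Longrightarrow> (\<Phi> has_real_derivative \<Phi>' x) (at x)"
    and bd: "\<And>x. a < x \<Longrightarrow> x < b \<Longrightarrow> \<omega> \<le> \<Phi>' x \<and> \<omega> + (T x - \<omega>\<^sup>2) / \<omega> \<le> \<Phi>' x"
    and bdb: "\<Phi>' b \<ge> 0"
  shows "pi \<le> \<Phi> b - \<Phi> a"
proof -
  define S where "S = {x \<in> {a..b}. g x = 0} - {a}"
  have S: "finite S" "b \<in> S" using fin ab z by (auto simp: S_def)
  define b' where "b' = Min S"
  have b': "b' \<in> S" "\<And>x. x \<in> S \<Longrightarrow> b' \<le> x" unfolding b'_def using S by (auto intro!: Min_in)
  hence b'': "a < b'" "b' \<le> b" "g b' = 0" using S(2) by (auto simp: S_def)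
  have "pi \<le> \<Phi> b' - \<Phi> a"
  proof (rule zero_gap[OF b''(1) \<omega>, where \<Phi>' = \<Phi>'])
    show "g x \<noteq> 0" if "a < x" "x < b'" for x
    proof
      assume "g x = 0"
      hence "x \<in> S" using that b'' by (auto simp: S_def)
      thus False using b'(2)[of x] that by simp
    qed
  qed (use b'' z ne simple \<Phi> bd in auto)
  moreover have "\<Phi> b' \<le> \<Phi> b"
  proof (rule DERIV_nonneg_imp_nondecreasing[OF b''(2)])
    fix x assume x: "b' \<le> x" "x \<le> b"
    have "\<Phi>' x \<ge> 0"
    proof (cases "x = b")
      case False
      thus ?thesis using bd[of x] x b'' \<omega> by auto
    qed (use bdb in simp)
    thus "\<exists>D. (\<Phi> has_real_derivative D) (at x) \<and> 0 \<le> D" using \<Phi>[of x] x b'' by auto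
  qed
  ultimately show ?thesis by linarith
qed

text \<open>On [t,1] the function rises from 0 to its maximum modulus M over a length at most 1 - t,
  while the flux integrated back from 1 limits the slope to c^2 M (1 - t). Together they give 1
  \<le> (c (1 - t))^2. The lemma keeps the zeros away from the endpoints, where \<open>T\<close> is
  singular.\<close>

lemma zero_away_from_one:
  assumes le: "ch \<le> c\<^sup>2" and ch0: "0 \<le> ch" and t: "0 \<le> t" "t < 1" "g t = 0" and nz: "\<And>x. t < x \<Longrightarrow> x < 1 \<Longrightarrow> g x \<noteq> 0"
  shows "1 \<le> c * (1 - t)"
proof (rule ccontr)
  assume "\<not> 1 \<le> c * (1 - t)"
  hence lt: "c * (1 - t) < 1" by simp
  have "\<exists>x\<in>{t..1}. \<forall>y\<in>{t..1}. \<bar>g y\<bar> \<le> \<bar>g x\<bar>"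
    using t by (intro continuous_attains_sup) (auto intro!: continuous_intros cont_g)
  then obtain x where x: "x \<in> {t..1}" "\<And>y. y \<in> {t..1} \<Longrightarrow> \<bar>g y\<bar> \<le> \<bar>g x\<bar>" by blast
  define \<sigma> where "\<sigma> = sgn (g x)"
  define M where "M = \<sigma> * g x"
  have Mabs: "M = \<bar>g x\<bar>" by (simp add: M_def \<sigma>_def abs_sgn)
  have M: "M > 0" using x(2)[of "(t + 1) / 2"] nz[of "(t + 1) / 2"] t by (auto simp: Mabs)
  have sg: "\<bar>\<sigma>\<bar> = 1" using M by (auto simp: Mabs \<sigma>_def)
  have le_M: "\<sigma> * g z \<le> M" if "z \<in> {t..1}" for z
  proof -
    have "\<sigma> * g z \<le> \<bar>\<sigma> * g z\<bar>" by (rule abs_ge_self)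
    also have "\<dots> = \<bar>g z\<bar>" unfolding abs_mult sg by simp
    also have "\<dots> \<le> M" unfolding Mabs by (rule x(2)[OF that])
    finally show ?thesis .
  qed
  have nonneg: "\<sigma> * g z \<ge> 0" if z: "z \<in> {t..1}" for z
  proof (rule ccontr)
    assume n: "\<not> \<sigma> * g z \<ge> 0"
    have ct: "continuous_on {u..v} (\<lambda>z. \<sigma> * g z)" for u v by (intro continuous_intros cont_g)
    have Mx: "0 < \<sigma> * g x" using M by (simp add: M_def)
    obtain w where w: "min x z \<le> w" "w \<le> max x z" "\<sigma> * g w = 0"
    proof (cases "x \<le> z")
      case True
      thus ?thesis using IVT2'[of "\<lambda>z. \<sigma> * g z" z 0 x] n Mx ct that by auto
    next
      case False
      thus ?thesis using IVT'[of "\<lambda>z. \<sigma> * g z" z 0 x] n Mx ct that by auto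
    qed
    have gw: "g w = 0" using w(3) sg by auto
    have "w \<noteq> x" "w \<noteq> z" using n Mx w(3) by auto
    hence "t < w" "w < 1" using w(1,2) x(1) z by (auto simp: min_def max_def split: if_splits)
    thus False using nz gw by blast
  qed
  \<comment> \<open>For z \<ge> s the coefficient ch - c^2 z^2 is at most c^2 (1 - s^2), and the
    factor 1 - s^2 cancels against the one in the flux.\<close>
  have g1b: "\<sigma> * g1 s \<le> c\<^sup>2 * M * (1 - t)" if s: "t \<le> s" "s < 1" for s
  proof -
    define p where "p = 1 - s\<^sup>2"
    have p: "p > 0" using s t by (auto simp: p_def abs_square_less_1)
    define K where "K = c\<^sup>2 * p * M"
    have "\<sigma> * ((1\<^sup>2 - 1) * g1 1) - K * 1 \<le> \<sigma> * ((s\<^sup>2 - 1) * g1 s) - K * s"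
    proof (rule DERIV_nonpos_imp_nonincreasing[of s 1 "\<lambda>z. \<sigma> * ((z\<^sup>2 - 1) * g1 z) - K * z"])
      fix z assume z: "s \<le> z" "z \<le> 1"
      have D: "((\<lambda>z. \<sigma> * ((z\<^sup>2 - 1) * g1 z) - K * z) has_real_derivative \<sigma> * ((ch - c\<^sup>2 * z\<^sup>2) * g z) - K) (at z)"
        by (intro DERIV_diff DERIV_cmult g_flux DERIV_cmult_Id)
      have zt: "z \<in> {t..1}" using z s by auto
      have "c\<^sup>2 * s\<^sup>2 \<le> c\<^sup>2 * z\<^sup>2" using z s t by (intro mult_left_mono power_mono) auto
      hence qp: "ch - c\<^sup>2 * z\<^sup>2 \<le> c\<^sup>2 * p" using le unfolding p_def right_diff_distrib by linarith
      have "(ch - c\<^sup>2 * z\<^sup>2) * (\<sigma> * g z) \<le> (c\<^sup>2 * p) * (\<sigma> * g z)"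
        using qp nonneg[OF zt] by (rule mult_right_mono)
      also have "\<dots> \<le> (c\<^sup>2 * p) * M" using le_M[OF zt] p by (intro mult_left_mono) auto
      finally have "\<sigma> * ((ch - c\<^sup>2 * z\<^sup>2) * g z) - K \<le> 0" unfolding K_def by (simp only: mult.left_commute)
      thus "\<exists>D. ((\<lambda>z. \<sigma> * ((z\<^sup>2 - 1) * g1 z) - K * z) has_real_derivative D) (at z) \<and> D \<le> 0"
        using D by blast
    qed (use s in simp)
    hence "p * (\<sigma> * g1 s) \<le> p * (c\<^sup>2 * M * (1 - s))" by (simp add: K_def p_def algebra_simps)
    hence "\<sigma> * g1 s \<le> c\<^sup>2 * M * (1 - s)" using p by (simp only: mult_le_cancel_left_pos)
    also have "\<dots> \<le> c\<^sup>2 * M * (1 - t)" using s M by (intro mult_left_mono) auto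
    finally show ?thesis .
  qed
  have xt: "t < x" using x(1) t(3) M by (cases "x = t") (auto simp: M_def)
  have "\<sigma> * g x - c\<^sup>2 * M * (1 - t) * x \<le> \<sigma> * g t - c\<^sup>2 * M * (1 - t) * t"
  proof (rule DERIV_nonpos_imp_decreasing_open[OF less_imp_le[OF xt]])
    fix z assume z: "t < z" "z < x"
    have "((\<lambda>z. \<sigma> * g z - c\<^sup>2 * M * (1 - t) * z) has_real_derivative \<sigma> * g1 z - c\<^sup>2 * M * (1 - t)) (at z)"
      by (intro DERIV_diff DERIV_cmult g_deriv DERIV_cmult_Id)
    moreover have "\<sigma> * g1 z - c\<^sup>2 * M * (1 - t) \<le> 0" using g1b[of z] z x(1) by auto
    ultimately show "\<exists>D. ((\<lambda>z. \<sigma> * g z - c\<^sup>2 * M * (1 - t) * z) has_real_derivative D) (at z) \<and> D \<le> 0" by blast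
  qed (intro continuous_intros cont_g)
  hence "M \<le> c\<^sup>2 * M * (1 - t) * (x - t)" using t(3) by (simp add: M_def right_diff_distrib)
  also have "\<dots> \<le> c\<^sup>2 * M * (1 - t) * (1 - t)" using x(1) t M by (intro mult_left_mono mult_nonneg_nonneg) auto
  also have "\<dots> = M * (c * (1 - t))\<^sup>2" by (simp add: power2_eq_square)
  finally have "1 \<le> (c * (1 - t))\<^sup>2" using M by simp
  moreover have "(c * (1 - t))\<^sup>2 < 1" using lt c_pos t by (simp add: power_less_one_iff abs_square_less_1)
  ultimately show False by simp
qed

text \<open>With N zeros the phase grows by at least (N - 1) pi between the outermost two. Its
  linear part contributes at most 2 c and its singular part at most 1, by
  \<open>zero_away_from_one\<close>; then 1 + 1/pi is rounded up to 2.\<close>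

lemma card_zeros_le:
  assumes le: "ch \<le> c\<^sup>2" and ch0: "0 \<le> ch" and c1: "c \<ge> 1"
    and Z: "Z = {x. -1 < x \<and> x < 1 \<and> g x = 0}" and fin: "finite Z"
    and simple: "\<And>x. -1 < x \<Longrightarrow> x < 1 \<Longrightarrow> g x = 0 \<Longrightarrow> g1 x \<noteq> 0"
  shows "real (card Z) \<le> 2 * c / pi + 2"
proof (cases "Z = {}")
  case True
  show ?thesis using True c_pos pi_gt_zero by simp
next
  case False
  have sym: "-x \<in> Z" if "x \<in> Z" for x using that by (simp add: Z g_parity)
  have mx: "Max Z \<in> Z" "\<And>x. x \<in> Z \<Longrightarrow> x \<le> Max Z" using fin False by auto
  have mn: "Min Z \<in> Z" "\<And>x. x \<in> Z \<Longrightarrow> Min Z \<le> x" using fin False by auto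
  have mm: "Min Z = - Max Z" using sym[OF mx(1)] sym[OF mn(1)] mx(2) mn(2) by (smt (verit))
  define t where "t = Max Z"
  have t: "-1 < t" "t < 1" "g t = 0" using mx(1) by (auto simp: t_def Z)
  have t0: "0 \<le> t" using mm mx(2)[OF mn(1)] by (simp add: t_def)
  have "1 \<le> c * (1 - t)"
  proof (rule zero_away_from_one[OF le ch0 t0 t(2,3)])
    fix x assume "t < x" "x < 1"
    thus "g x \<noteq> 0" using mx(2)[of x] t0 by (auto simp: t_def Z)
  qed
  hence tc: "1 / (1 - t) \<le> c" using t(2) by (simp add: field_simps)
  \<comment> \<open>When ch \<le> c^2, \<open>T\<close> exceeds c^2 by at most 1 / (x^2 - 1)^2, the
    square of the mean of 1 / (1 - x) and 1 / (1 + x). Half the sum of the two squares dominates it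
    and has an explicit antiderivative.\<close>
  define \<Phi> where "\<Phi> = (\<lambda>x. c * x + (1 / (1 - x) - 1 / (1 + x)) / (2 * c))"
  define \<Phi>' where "\<Phi>' = (\<lambda>x::real. c + (1 / (1 - x)\<^sup>2 + 1 / (1 + x)\<^sup>2) / (2 * c))"
  have gap: "pi \<le> \<Phi> b - \<Phi> a" if ab: "a \<in> Z" "b \<in> Z" "a < b" for a b
  proof (rule zero_gap_general[OF ab(3) c_pos, where \<Phi>' = \<Phi>'])
    have "{x \<in> {a..b}. g x = 0} \<subseteq> Z" using ab by (auto simp: Z)
    thus "finite {x \<in> {a..b}. g x = 0}" using fin by (rule finite_subset)
    show "g a = 0" "g b = 0" using ab by (auto simp: Z)
    show "\<Phi>' b \<ge> 0" using c_pos unfolding \<Phi>'_def by simp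
    fix x assume "a \<le> x" "x \<le> b"
    hence x: "-1 < x" "x < 1" using ab by (auto simp: Z)
    show "g1 x \<noteq> 0" if "g x = 0" using simple x that by auto
    show "x\<^sup>2 \<noteq> 1" using x by (auto simp: power2_eq_1_iff)
    have "((\<lambda>x. 1 / (1 - x)) has_real_derivative 1 / (1 - x)\<^sup>2) (at x)" "((\<lambda>x. 1 / (1 + x)) has_real_derivative - (1 / (1 + x)\<^sup>2)) (at x)"
      using x by (auto intro!: derivative_eq_intros simp: power2_eq_square)
    from DERIV_diff[OF this]
    have "((\<lambda>x. 1 / (1 - x) - 1 / (1 + x)) has_real_derivative 1 / (1 - x)\<^sup>2 + 1 / (1 + x)\<^sup>2) (at x)" by simp
    thus "(\<Phi> has_real_derivative \<Phi>' x) (at x)" unfolding \<Phi>_def \<Phi>'_def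
      by (intro DERIV_add DERIV_cmult_Id DERIV_cdivide)
  next
    fix x assume "a < x" "x < b"
    hence x: "-1 < x" "x < 1" using ab by (auto simp: Z)
    define A B where "A = 1 / (1 - x)" and "B = 1 / (1 + x)"
    have AB: "A > 0" "B > 0" using x by (auto simp: A_def B_def)
    have P: "x\<^sup>2 - 1 < 0" using x by (simp add: abs_square_less_1)
    have inv: "1 / (x\<^sup>2 - 1) = - ((A + B) / 2)"
    proof -
      define D where "D = (1 - x) * (1 + x)"
      have "x\<^sup>2 - 1 = - D" by (simp add: D_def power2_eq_square algebra_simps)
      moreover have "A + B = 2 / D" using x by (simp add: A_def B_def D_def field_simps)
      ultimately show ?thesis by simp
    qed
    have "(c\<^sup>2 * x\<^sup>2 - ch) / (x\<^sup>2 - 1) \<le> c\<^sup>2"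
    proof -
      have "c\<^sup>2 * (x\<^sup>2 - 1) \<le> c\<^sup>2 * x\<^sup>2 - ch" using le by (simp add: right_diff_distrib)
      thus ?thesis using P by (simp add: divide_le_eq)
    qed
    moreover have "1 / (x\<^sup>2 - 1)\<^sup>2 = ((A + B) / 2)\<^sup>2" using arg_cong[OF inv, of "\<lambda>x. x\<^sup>2"] by (simp add: power_divide)
    moreover have "((A + B) / 2)\<^sup>2 \<le> (A\<^sup>2 + B\<^sup>2) / 2"
    proof -
      have "0 \<le> (A - B)\<^sup>2" by simp
      thus ?thesis by (simp add: power2_eq_square field_simps)
    qed
    ultimately have "T x - c\<^sup>2 \<le> (A\<^sup>2 + B\<^sup>2) / 2" unfolding T_def by linarith
    hence "(T x - c\<^sup>2) / c \<le> (A\<^sup>2 + B\<^sup>2) / 2 / c" using c_pos by (intro divide_right_mono) auto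
    also have "(A\<^sup>2 + B\<^sup>2) / 2 / c = \<Phi>' x - c" by (simp add: \<Phi>'_def A_def B_def power_divide)
    finally have 1: "(T x - c\<^sup>2) / c \<le> \<Phi>' x - c" .
    have "\<Phi>' x \<ge> c" using c_pos unfolding \<Phi>'_def by simp
    thus "c \<le> \<Phi>' x \<and> c + (T x - c\<^sup>2) / c \<le> \<Phi>' x" using 1 by linarith
  qed
  have "(real (card Z) - 1) * pi \<le> \<Phi> t - \<Phi> (- t)"
    using card_by_spacing[OF fin False gap] by (simp only: mm t_def[symmetric])
  also have "\<dots> = 2 * c * t + (1 / (1 - t) - 1 / (1 + t)) / c" by (simp add: \<Phi>_def diff_divide_distrib mult.commute)
  also have "\<dots> \<le> 2 * c + c / c"
  proof (intro add_mono divide_right_mono)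
    show "2 * c * t \<le> 2 * c" using t c_pos by simp
    show "1 / (1 - t) - 1 / (1 + t) \<le> c" using tc t by (smt (verit) divide_nonneg_nonneg)
  qed (use c_pos in auto)
  finally have "(real (card Z) - 1) * pi \<le> 2 * c + 1" using c_pos by simp
  hence "real (card Z) - 1 \<le> (2 * c + 1) / pi" by (simp add: pos_le_divide_eq)
  also have "\<dots> = 2 * c / pi + 1 / pi" by (simp add: add_divide_distrib)
  also have "1 / pi \<le> 1" using pi_gt3 by simp
  finally show ?thesis by simp
qed

end

section \<open>Beyond the turning point\<close>

lemma two_abs_mult_le:
  fixes A B k x y :: real
  assumes "A > 0" "k\<^sup>2 \<le> A * B"
  shows "2 * k * (x * y) \<le> A * x\<^sup>2 + B * y\<^sup>2"
proof -
  have "0 \<le> (A * x - k * y)\<^sup>2 + (A * B - k\<^sup>2) * y\<^sup>2" using assms by simp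
  also have "\<dots> = A * (A * x\<^sup>2 + B * y\<^sup>2 - 2 * k * (x * y))" by algebra
  finally show ?thesis using assms(1) by (simp add: zero_le_mult_iff)
qed

context prolate_high begin

text \<open>Here \<open>a0\<close> is the point x > 1 at which (c^2 x^2 - ch) (x^2 - 1) = 1, and \<open>za = 1 / (a0^2 - 1)\<close>.\<close>
definition za :: real where "za = (sqrt ((ch - c\<^sup>2)\<^sup>2 + 4 * c\<^sup>2) - (ch - c\<^sup>2)) / 2"
definition a0 :: real where "a0 = sqrt (1 + 1 / za)"

text \<open>The quadratic equation is the one defining \<open>a0\<close>, rewritten in the unknown 1
  / (x^2 - 1). The bound by \<open>c\<close> later limits the singular part of
  \<open>T\<close>.\<close>

lemma za_props: "za > 0" "za\<^sup>2 + (ch - c\<^sup>2) * za = c\<^sup>2" "za \<le> c"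
proof -
  define \<delta> where "\<delta> = ch - c\<^sup>2"
  have d: "\<delta> > 0" using ch_gt by (simp add: \<delta>_def)
  define R where "R = sqrt (\<delta>\<^sup>2 + 4 * c\<^sup>2)"
  have R2: "R\<^sup>2 = \<delta>\<^sup>2 + 4 * c\<^sup>2" by (simp add: R_def)
  have z: "za = (R - \<delta>) / 2" by (simp add: za_def R_def \<delta>_def)
  have "\<delta> < R" unfolding R_def using d c_pos by (intro real_less_rsqrt) simp
  thus z0: "za > 0" by (simp add: z)
  have "za\<^sup>2 + \<delta> * za = (R\<^sup>2 - \<delta>\<^sup>2) / 4" unfolding z by (simp add: power2_eq_square field_simps)
  also have "\<dots> = c\<^sup>2" unfolding R2 by simp
  finally show e: "za\<^sup>2 + (ch - c\<^sup>2) * za = c\<^sup>2" by (simp add: \<delta>_def)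
  have "0 \<le> \<delta> * za" using d z0 by simp
  hence "za\<^sup>2 \<le> c\<^sup>2" using e unfolding \<delta>_def[symmetric] by linarith
  thus "za \<le> c" by (rule power2_le_imp_le) (use c_pos in simp)
qed

lemma a0_props: "a0 > 1" "a0\<^sup>2 - 1 = 1 / za"
  using za_props(1) by (auto simp: a0_def)

lemma above_a0:
  assumes "a0 \<le> x"
  shows "x > 1" "x\<^sup>2 - 1 \<ge> 1 / za" "x\<^sup>2 - 1 > 0" "c\<^sup>2 * x\<^sup>2 - ch \<ge> za" "za\<^sup>2 * (x\<^sup>2 - 1) \<le> c\<^sup>2 * x\<^sup>2 - ch"
proof -
  define p where "p = x\<^sup>2 - 1"
  show "x > 1" using assms a0_props by linarith
  have "a0\<^sup>2 \<le> x\<^sup>2" using assms a0_props by (intro power_mono) auto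
  hence p: "p \<ge> 1 / za" using a0_props by (simp add: p_def)
  thus "x\<^sup>2 - 1 \<ge> 1 / za" by (simp add: p_def)
  have zp: "za * p \<ge> 1" using p za_props(1) by (simp add: field_simps)
  have "0 < 1 / za" using za_props(1) by simp
  from less_le_trans[OF this p] show p0: "x\<^sup>2 - 1 > 0" unfolding p_def .
  have q: "c\<^sup>2 * x\<^sup>2 - ch = za\<^sup>2 * p + (ch - c\<^sup>2) * (za * p - 1)"
  proof -
    have "c\<^sup>2 * x\<^sup>2 - ch = c\<^sup>2 * p - (ch - c\<^sup>2)" by (simp add: p_def algebra_simps)
    also have "c\<^sup>2 * p = (za\<^sup>2 + (ch - c\<^sup>2) * za) * p" using za_props(2) by simp
    finally show ?thesis by (simp add: algebra_simps)
  qed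
  have "(ch - c\<^sup>2) * (za * p - 1) \<ge> 0" using zp ch_gt by simp
  thus "za\<^sup>2 * (x\<^sup>2 - 1) \<le> c\<^sup>2 * x\<^sup>2 - ch" using q by (simp add: p_def)
  moreover have "za \<le> za\<^sup>2 * p"
    using mult_left_mono[OF zp, of za] za_props(1) by (simp add: power2_eq_square)
  ultimately show "c\<^sup>2 * x\<^sup>2 - ch \<ge> za" by (simp add: p_def)
qed

text \<open>While \<open>g\<close> keeps its sign, (x^2 - 1) (g1 + za g) times a decaying
  exponential is monotone, and it starts from 0 at x = 1. So up to \<open>a0\<close> the function
  decays no faster than exp (- za x).\<close>

lemma growth_step:
  assumes b: "1 \<le> b" "b \<le> a0" and G: "\<And>x. 1 \<le> x \<Longrightarrow> x \<le> b \<Longrightarrow> \<sigma> * g x \<ge> 0"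
    and x: "1 < x" "x \<le> b"
  shows "\<sigma> * (g1 x + za * g x) \<ge> 0"
proof -
  have "exp (- za * 1) * (\<sigma> * ((1\<^sup>2 - 1) * g1 1 + za * ((1\<^sup>2 - 1) * g 1))) \<le> exp (- za * x) * (\<sigma> * ((x\<^sup>2 - 1) * g1 x + za * ((x\<^sup>2 - 1) * g x)))"
  proof (rule DERIV_nonneg_imp_nondecreasing[OF less_imp_le[OF x(1)]])
    fix t assume "1 \<le> t" "t \<le> x"
    hence t: "1 \<le> t" "t \<le> b" using x by auto
    let ?h = "\<lambda>x. exp (- za * x) * (\<sigma> * ((x\<^sup>2 - 1) * g1 x + za * ((x\<^sup>2 - 1) * g x)))"
    define p where "p = t\<^sup>2 - 1"
    have "((\<lambda>x. exp (- za * x)) has_real_derivative exp (- za * t) * (- za)) (at t)" by (auto intro!: derivative_eq_intros)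
    moreover have "((\<lambda>x. (x\<^sup>2 - 1) * g x) has_real_derivative (2 * t) * g t + g1 t * (t\<^sup>2 - 1)) (at t)"
      by (intro DERIV_mult g_deriv) (auto intro!: derivative_eq_intros)
    hence "((\<lambda>x. \<sigma> * ((x\<^sup>2 - 1) * g1 x + za * ((x\<^sup>2 - 1) * g x))) has_real_derivative
        \<sigma> * ((ch - c\<^sup>2 * t\<^sup>2) * g t + za * ((2 * t) * g t + g1 t * (t\<^sup>2 - 1)))) (at t)"
      by (intro DERIV_cmult DERIV_add g_flux)
    ultimately have D: "(?h has_real_derivative exp (- za * t) * (- za) * (\<sigma> * ((t\<^sup>2 - 1) * g1 t + za * ((t\<^sup>2 - 1) * g t))) +
        \<sigma> * ((ch - c\<^sup>2 * t\<^sup>2) * g t + za * ((2 * t) * g t + g1 t * (t\<^sup>2 - 1))) * exp (- za * t)) (at t)"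
      by (rule DERIV_mult)
    have eq: "exp (- za * t) * (- za) * (\<sigma> * ((t\<^sup>2 - 1) * g1 t + za * ((t\<^sup>2 - 1) * g t))) +
        \<sigma> * ((ch - c\<^sup>2 * t\<^sup>2) * g t + za * ((2 * t) * g t + g1 t * (t\<^sup>2 - 1))) * exp (- za * t) =
        exp (- za * t) * (\<sigma> * g t) * (ch - c\<^sup>2 * t\<^sup>2 + 2 * za * t - za\<^sup>2 * (t\<^sup>2 - 1))"
      by algebra
    have "t\<^sup>2 \<le> a0\<^sup>2" using t b by (intro power_mono) auto
    hence p: "p \<le> 1 / za" using a0_props by (simp add: p_def)
    hence zp: "za * p \<le> 1" using za_props(1) by (simp add: field_simps)
    \<comment> \<open>Replacing c^2 by the quadratic equation for \<open>za\<close> exposes the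
      factor 1 - za p, which is nonnegative exactly up to \<open>a0\<close>.\<close>
    have "ch - c\<^sup>2 * t\<^sup>2 + 2 * za * t - za\<^sup>2 * (t\<^sup>2 - 1) = (ch - c\<^sup>2) * (1 - za * p) + 2 * za * (1 - za * p) + 2 * za * (t - 1)"
    proof -
      have "c\<^sup>2 * t\<^sup>2 = c\<^sup>2 * p + c\<^sup>2" by (simp add: p_def algebra_simps)
      moreover have "c\<^sup>2 * p = (za\<^sup>2 + (ch - c\<^sup>2) * za) * p" using za_props(2) by simp
      ultimately show ?thesis unfolding p_def[symmetric] by algebra
    qed
    also have "\<dots> \<ge> 0" using zp ch_gt t za_props(1) by (intro add_nonneg_nonneg mult_nonneg_nonneg) auto
    finally have "0 \<le> exp (- za * t) * (\<sigma> * g t) * (ch - c\<^sup>2 * t\<^sup>2 + 2 * za * t - za\<^sup>2 * (t\<^sup>2 - 1))"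
      using G[OF t] by (intro mult_nonneg_nonneg[OF mult_nonneg_nonneg[OF exp_ge_zero]])
    thus "\<exists>D. (?h has_real_derivative D) (at t) \<and> 0 \<le> D" using D unfolding eq by blast
  qed
  hence "0 \<le> exp (- za * x) * (\<sigma> * ((x\<^sup>2 - 1) * g1 x + za * ((x\<^sup>2 - 1) * g x)))" by simp
  hence "0 \<le> \<sigma> * ((x\<^sup>2 - 1) * g1 x + za * ((x\<^sup>2 - 1) * g x))" by (simp only: zero_le_mult_iff) (simp add: not_le)
  also have "\<sigma> * ((x\<^sup>2 - 1) * g1 x + za * ((x\<^sup>2 - 1) * g x)) = (x\<^sup>2 - 1) * (\<sigma> * (g1 x + za * g x))" by algebra
  finally have "0 \<le> (x\<^sup>2 - 1) * (\<sigma> * (g1 x + za * g x))" .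
  moreover have "x\<^sup>2 - 1 > 0" using x by simp
  ultimately show ?thesis by (simp only: zero_le_mult_iff) linarith
qed

text \<open>Continuation argument: at the first point where the sign could be lost,
  \<open>growth_step\<close> still holds to its left, so exp (za x) |g x| has not decreased from its
  positive value at 1.\<close>

lemma positive_to_a0:
  assumes x: "1 \<le> x" "x \<le> a0"
  shows "sgn (g 1) * g x > 0"
proof (rule ccontr)
  define \<sigma> where "\<sigma> = sgn (g 1)"
  have s1: "\<sigma> * g 1 > 0" using g_one_nz by (simp add: \<sigma>_def sgn_real_def)
  assume n: "\<not> sgn (g 1) * g x > 0"
  define S where "S = {t \<in> {1..x}. \<sigma> * g t \<le> 0}"
  have "closed ({1..x} \<inter> {t. \<sigma> * g t \<le> 0})"
    by (intro closed_Int closed_atLeastAtMost closed_Collect_le continuous_intros cont_g)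
  moreover have "S = {1..x} \<inter> {t. \<sigma> * g t \<le> 0}" by (auto simp: S_def)
  ultimately have "closed S" by simp
  moreover have "S \<subseteq> {1..x}" by (auto simp: S_def)
  ultimately have "compact S" by (meson bounded_closed_interval bounded_subset compact_eq_bounded_closed)
  moreover have "x \<in> S" using n x by (auto simp: S_def \<sigma>_def)
  ultimately obtain b where b: "b \<in> S" "\<And>t. t \<in> S \<Longrightarrow> b \<le> t" using compact_attains_inf[of S] by blast
  have b1: "1 \<le> b" "b \<le> x" "\<sigma> * g b \<le> 0" using b(1) by (auto simp: S_def)
  have pos: "\<sigma> * g t > 0" if "1 \<le> t" "t < b" for t
    using b(2)[of t] that b1 unfolding S_def by force
  have b2: "1 < b" using b1 s1 by (cases "b = 1") auto
  have nn: "\<sigma> * g t \<ge> 0" if "1 \<le> t" "t < b" for t using pos[OF that] by simp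
  have "((\<lambda>t. \<sigma> * g t) \<longlongrightarrow> \<sigma> * g b) (at_left b)"
    using cont_g[of UNIV] by (intro tendsto_mult_left) (simp add: continuous_on_def, meson UNIV_I subset_UNIV tendsto_within_subset)
  moreover have "\<forall>\<^sub>F t in at_left b. 0 \<le> \<sigma> * g t"
    using eventually_at_left_real[OF b2] by eventually_elim (rule nn, auto)
  ultimately have "0 \<le> \<sigma> * g b" by (rule tendsto_lowerbound) simp
  hence nn': "\<sigma> * g t \<ge> 0" if "1 \<le> t" "t \<le> b" for t using nn[of t] that by (cases "t = b") auto
  have "exp (za * 1) * (\<sigma> * g 1) \<le> exp (za * b) * (\<sigma> * g b)"
  proof (rule DERIV_nonneg_imp_increasing_open[OF b1(1)])
    fix t assume t: "1 < t" "t < b"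
    have "((\<lambda>x. exp (za * x) * (\<sigma> * g x)) has_real_derivative exp (za * t) * za * (\<sigma> * g t) + \<sigma> * g1 t * exp (za * t)) (at t)"
      by (rule DERIV_mult) (auto intro!: derivative_eq_intros DERIV_cmult g_deriv)
    moreover have "exp (za * t) * za * (\<sigma> * g t) + \<sigma> * g1 t * exp (za * t) = exp (za * t) * (\<sigma> * (g1 t + za * g t))" by algebra
    moreover have "0 \<le> exp (za * t) * (\<sigma> * (g1 t + za * g t))"
      by (rule mult_nonneg_nonneg[OF exp_ge_zero growth_step[of b]]) (use b1 x t nn' in auto)
    ultimately show "\<exists>D. ((\<lambda>x. exp (za * x) * (\<sigma> * g x)) has_real_derivative D) (at t) \<and> 0 \<le> D" by (intro exI conjI) (assumption, simp only:)
  qed (intro continuous_intros cont_g)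
  moreover have "0 < exp (za * 1) * (\<sigma> * g 1)" by (rule mult_pos_pos[OF exp_gt_zero s1])
  ultimately have "0 < exp (za * b) * (\<sigma> * g b)" by linarith
  from zero_less_mult_pos[OF this exp_gt_zero] show False using b1(3) by linarith
qed

text \<open>The starting value for the half gap: the logarithmic derivative is at least -za, and the
  correction equals a0 za, which is larger than za.\<close>

lemma y_a0: "g1 a0 / g a0 + a0 / (a0\<^sup>2 - 1) \<ge> 0"
proof -
  define \<sigma> where "\<sigma> = sgn (g 1)"
  have pos: "\<sigma> * g t > 0" if "1 \<le> t" "t \<le> a0" for t using positive_to_a0[OF that] by (simp add: \<sigma>_def)
  have "\<sigma> * (g1 a0 + za * g a0) \<ge> 0"
    using a0_props pos by (intro growth_step[of a0]) (auto intro: less_imp_le)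
  moreover have p: "\<sigma> * g a0 > 0" using pos[of a0] a0_props by simp
  ultimately have "(\<sigma> * (g1 a0 + za * g a0)) / (\<sigma> * g a0) \<ge> 0" by (rule divide_nonneg_pos)
  also have "(\<sigma> * (g1 a0 + za * g a0)) / (\<sigma> * g a0) = g1 a0 / g a0 + za"
    using p by (auto simp: add_divide_distrib)
  finally have "g1 a0 / g a0 \<ge> - za" by simp
  moreover have "a0 / (a0\<^sup>2 - 1) \<ge> za" unfolding a0_props using a0_props(1) za_props(1) by simp
  ultimately show ?thesis by linarith
qed

text \<open>At a zero of \<^term>\<open>g\<close> the value of \<open>E\<close> determines the slope; at infinity \<open>E\<close> is the squared amplitude of the oscillation.\<close>
definition E :: "real \<Rightarrow> real" where "E x = (x\<^sup>2 - 1) * (g x)\<^sup>2 + ((x\<^sup>2 - 1) * g1 x + x * g x)\<^sup>2 / (c\<^sup>2 * x\<^sup>2 - ch)"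

text \<open>The derivative consists of a cross term and of a term that is nonpositive because ch >
  c^2 and is dropped. The cross term is absorbed into \<open>E\<close> by the arithmetic-geometric
  inequality, which works on account of za^2 (x^2 - 1) \<le> c^2 x^2 - ch.\<close>

lemma E_deriv_le:
  assumes x: "a0 \<le> x"
  shows "\<exists>D. (E has_real_derivative D) (at x) \<and> D \<le> (1 / za) * x / (x\<^sup>2 - 1)\<^sup>2 * E x"
proof -
  define p q u \<delta> where "p = x\<^sup>2 - 1" and "q = c\<^sup>2 * x\<^sup>2 - ch" and "u = (x\<^sup>2 - 1) * g1 x + x * g x" and "\<delta> = ch - c\<^sup>2"
  note a = above_a0[OF x]
  have p: "p > 0" and q: "q > 0" using a za_props(1) by (auto simp: p_def q_def)
  have d: "\<delta> > 0" using ch_gt by (simp add: \<delta>_def)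
  have pg: "p * g1 x = u - x * g x" by (simp add: p_def u_def)
  have Dq: "((\<lambda>x. c\<^sup>2 * x\<^sup>2 - ch) has_real_derivative c\<^sup>2 * (2 * x)) (at x)" by (auto intro!: derivative_eq_intros)
  have Du: "((\<lambda>x. (x\<^sup>2 - 1) * g1 x + x * g x) has_real_derivative (ch - c\<^sup>2 * x\<^sup>2) * g x + (1 * g x + g1 x * x)) (at x)"
    by (intro DERIV_add g_flux DERIV_mult g_deriv DERIV_ident)
  have Dp: "((\<lambda>x. (x\<^sup>2 - 1) * (g x)\<^sup>2) has_real_derivative (2 * x) * (g x)\<^sup>2 + (2 * g x * g1 x) * (x\<^sup>2 - 1)) (at x)"
    by (rule DERIV_mult) (auto intro!: derivative_eq_intros g_deriv)
  have Du2: "((\<lambda>x. ((x\<^sup>2 - 1) * g1 x + x * g x)\<^sup>2) has_real_derivative 2 * u * ((ch - c\<^sup>2 * x\<^sup>2) * g x + (1 * g x + g1 x * x))) (at x)"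
  proof -
    have "2 * u * D = of_nat 2 * (D * u ^ (2 - Suc 0))" for D by simp
    from this[of "(ch - c\<^sup>2 * x\<^sup>2) * g x + (1 * g x + g1 x * x)"] DERIV_power[OF Du, of 2]
    show ?thesis unfolding u_def by (simp only:)
  qed
  have "(E has_real_derivative ((2 * x) * (g x)\<^sup>2 + (2 * g x * g1 x) * (x\<^sup>2 - 1)) +
     (2 * u * ((ch - c\<^sup>2 * x\<^sup>2) * g x + (1 * g x + g1 x * x)) * (c\<^sup>2 * x\<^sup>2 - ch) - ((x\<^sup>2 - 1) * g1 x + x * g x)\<^sup>2 * (c\<^sup>2 * (2 * x))) / ((c\<^sup>2 * x\<^sup>2 - ch) * (c\<^sup>2 * x\<^sup>2 - ch))) (at x)"
    unfolding E_def[abs_def] using q by (intro DERIV_add DERIV_divide Dp Du2 Dq) (auto simp: q_def)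
  moreover have "((2 * x) * (g x)\<^sup>2 + (2 * g x * g1 x) * (x\<^sup>2 - 1)) +
     (2 * u * ((ch - c\<^sup>2 * x\<^sup>2) * g x + (1 * g x + g1 x * x)) * (c\<^sup>2 * x\<^sup>2 - ch) - ((x\<^sup>2 - 1) * g1 x + x * g x)\<^sup>2 * (c\<^sup>2 * (2 * x))) / ((c\<^sup>2 * x\<^sup>2 - ch) * (c\<^sup>2 * x\<^sup>2 - ch))
     = - (2 * (g x * u) / (p * q)) - 2 * x * \<delta> * u\<^sup>2 / (p * q\<^sup>2)" (is "?L = ?R")
  proof -
    have g1: "g1 x = (u - x * g x) / p" using pg p by (simp add: eq_divide_imp mult.commute)
    have x2: "x\<^sup>2 = p + 1" by (simp add: p_def)
    have de: "\<delta> = c\<^sup>2 * p - q" by (simp add: \<delta>_def p_def q_def algebra_simps)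
    have "?L = ((2 * x) * (g x)\<^sup>2 + 2 * g x * (p * g1 x)) + (2 * u * (- q * g x + (g x + g1 x * x)) * q - u\<^sup>2 * (c\<^sup>2 * (2 * x))) / (q * q)"
      unfolding u_def[symmetric] unfolding p_def[symmetric] q_def[symmetric] by (simp add: q_def mult_ac)
    also have "\<dots> = 2 * g x * u + (2 * u * (- q * g x + (g x + g1 x * x)) * q - u\<^sup>2 * (c\<^sup>2 * (2 * x))) / (q * q)"
      unfolding pg by (simp add: power2_eq_square algebra_simps)
    also have "\<dots> = ?R"
    proof -
      have e1: "g x + g1 x * x = (x * u - g x) / p"
      proof -
        have "p * (g x + g1 x * x) = p * g x + x * (p * g1 x)" by (simp add: algebra_simps)
        also have "\<dots> = x * u - (x\<^sup>2 - p) * g x" unfolding pg by (simp add: power2_eq_square algebra_simps)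
        also have "\<dots> = x * u - g x" by (simp add: x2)
        finally show ?thesis using p by (simp add: eq_divide_imp mult.commute)
      qed
      have "2 * g x * u + (2 * u * (- q * g x + (x * u - g x) / p) * q - u\<^sup>2 * (c\<^sup>2 * (2 * x))) / (q * q) =
         - (2 * (g x * u) / (p * q)) - 2 * x * (c\<^sup>2 * p - q) * u\<^sup>2 / (p * q\<^sup>2)"
        using p q by (simp add: field_simps power2_eq_square)
      thus ?thesis unfolding e1 de .
    qed
    finally show ?thesis .
  qed
  moreover have "?R \<le> (1 / za) * x / (x\<^sup>2 - 1)\<^sup>2 * E x"
  proof -
    define \<alpha> where "\<alpha> = 1 / za / p\<^sup>2"
    have al: "\<alpha> > 0" using za_props(1) p by (simp add: \<alpha>_def)
    have "2 * (1 / (p * q)) * (g x * (- u)) \<le> (\<alpha> * p) * (g x)\<^sup>2 + (\<alpha> / q) * (- u)\<^sup>2"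
    proof (rule two_abs_mult_le)
      show "\<alpha> * p > 0" using al p by simp
      have "1 / za * (1 / za) * (za\<^sup>2 * p) \<le> 1 / za * (1 / za) * q"
        using a(5) za_props(1) unfolding p_def q_def by (intro mult_left_mono) auto
      hence "p \<le> 1 / za\<^sup>2 * q" using za_props(1) by (simp add: power2_eq_square)
      hence "p / (p ^ 3 * q\<^sup>2) \<le> (1 / za\<^sup>2 * q) / (p ^ 3 * q\<^sup>2)" using p q by (intro divide_right_mono) auto
      moreover have "p / (p ^ 3 * q\<^sup>2) = (1 / (p * q))\<^sup>2" using p q by (simp add: field_simps power2_eq_square power3_eq_cube)
      moreover have "(1 / za\<^sup>2 * q) / (p ^ 3 * q\<^sup>2) = \<alpha> * p * (\<alpha> / q)" using p q za_props(1)
        by (simp add: \<alpha>_def field_simps power2_eq_square power3_eq_cube)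
      ultimately show "(1 / (p * q))\<^sup>2 \<le> \<alpha> * p * (\<alpha> / q)" by simp
    qed
    moreover have "2 * (1 / (p * q)) * (g x * (- u)) = - (2 * (g x * u) / (p * q))" by simp
    moreover have "(\<alpha> * p) * (g x)\<^sup>2 + (\<alpha> / q) * (- u)\<^sup>2 = \<alpha> * E x"
      unfolding E_def u_def[symmetric] unfolding p_def[symmetric] q_def[symmetric] by (simp add: algebra_simps)
    moreover have "0 \<le> 2 * x * \<delta> * u\<^sup>2 / (p * q\<^sup>2)" using p q d a(1) by simp
    \<comment> \<open>The factor x > 1 is given away in order to have a coefficient with an
      elementary antiderivative.\<close>
    moreover have "\<alpha> * E x \<le> (1 / za) * x / (x\<^sup>2 - 1)\<^sup>2 * E x"
    proof (rule mult_right_mono)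
      show "0 \<le> E x" unfolding E_def p_def[symmetric] q_def[symmetric] using p q by simp
      show "\<alpha> \<le> 1 / za * x / (x\<^sup>2 - 1)\<^sup>2" unfolding \<alpha>_def p_def[symmetric] using a(1) za_props(1) p
        by (intro divide_right_mono) (auto simp: divide_simps)
    qed
    ultimately show ?thesis by linarith
  qed
  ultimately show ?thesis by (intro exI conjI) (assumption, simp only:)
qed

text \<open>Gronwall with the integrating factor of \<open>E_deriv_le\<close>; at \<open>a0\<close>
  its exponent equals 1/2, which bounds the total relative growth of \<open>E\<close> on the way to
  infinity.\<close>

lemma E_exp_antimono:
  assumes "a0 \<le> x" "x \<le> y"
  shows "E y * exp (1 / (2 * za) / (y\<^sup>2 - 1)) \<le> E x * exp (1 / (2 * za) / (x\<^sup>2 - 1))"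
proof (rule DERIV_nonpos_imp_nonincreasing[OF assms(2)])
  fix t assume "x \<le> t" "t \<le> y"
  hence t: "a0 \<le> t" using assms by simp
  obtain D where D: "(E has_real_derivative D) (at t)" "D \<le> (1 / za) * t / (t\<^sup>2 - 1)\<^sup>2 * E t" using E_deriv_le[OF t] by blast
  have p: "t\<^sup>2 - 1 > 0" using above_a0[OF t] by simp
  define e where "e = exp (1 / (2 * za) / (t\<^sup>2 - 1))"
  have De: "((\<lambda>x. exp (1 / (2 * za) / (x\<^sup>2 - 1))) has_real_derivative e * (- ((1 / za) * t / (t\<^sup>2 - 1)\<^sup>2))) (at t)"
  proof -
    have "((\<lambda>x. 1 / (2 * za) / (x\<^sup>2 - 1)) has_real_derivative (0 * (t\<^sup>2 - 1) - 1 / (2 * za) * (2 * t)) / ((t\<^sup>2 - 1) * (t\<^sup>2 - 1))) (at t)"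
      using p by (intro DERIV_divide) (auto intro!: derivative_eq_intros)
    moreover have "(0 * (t\<^sup>2 - 1) - 1 / (2 * za) * (2 * t)) / ((t\<^sup>2 - 1) * (t\<^sup>2 - 1)) = - ((1 / za) * t / (t\<^sup>2 - 1)\<^sup>2)"
      by (simp add: power2_eq_square)
    ultimately have "((\<lambda>x. 1 / (2 * za) / (x\<^sup>2 - 1)) has_real_derivative - ((1 / za) * t / (t\<^sup>2 - 1)\<^sup>2)) (at t)" by (simp only:)
    from DERIV_chain2[OF DERIV_exp this] show ?thesis by (simp add: e_def)
  qed
  have "((\<lambda>x. E x * exp (1 / (2 * za) / (x\<^sup>2 - 1))) has_real_derivative D * e + e * (- ((1 / za) * t / (t\<^sup>2 - 1)\<^sup>2)) * E t) (at t)"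
    using DERIV_mult[OF D(1) De] by (simp add: e_def)
  moreover have "D * e + e * (- ((1 / za) * t / (t\<^sup>2 - 1)\<^sup>2)) * E t = e * (D - (1 / za) * t / (t\<^sup>2 - 1)\<^sup>2 * E t)" by (simp add: algebra_simps)
  moreover have "\<dots> \<le> 0" using D(2) by (intro mult_nonneg_nonpos) (auto simp: e_def)
  ultimately show "\<exists>D. ((\<lambda>x. E x * exp (1 / (2 * za) / (x\<^sup>2 - 1))) has_real_derivative D) (at t) \<and> D \<le> 0"
    by (intro exI conjI) (assumption, simp only:)
qed

end

section \<open>Slopes and spacing of the outer zeros\<close>

lemma tendsto_zero_mult_bounded:
  fixes f h :: "'a \<Rightarrow> real"
  assumes "(f \<longlongrightarrow> 0) F" "\<forall>\<^sub>F x in F. \<bar>h x\<bar> \<le> M"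
  shows "((\<lambda>x. f x * h x) \<longlongrightarrow> 0) F"
proof (rule Lim_null_comparison)
  show "\<forall>\<^sub>F x in F. norm (f x * h x) \<le> \<bar>f x\<bar> * M"
    using assms(2) by eventually_elim (simp add: abs_mult mult_left_mono)
  show "((\<lambda>x. \<bar>f x\<bar> * M) \<longlongrightarrow> 0) F"
    using tendsto_mult_left_zero[OF tendsto_rabs_zero[OF assms(1)]] .
qed

lemma cmod_mult_diff_le:
  fixes a b v w :: complex
  assumes "cmod (a - v) \<le> e" "cmod (b - w) \<le> e" "cmod v \<le> L" "cmod w \<le> L"
  shows "cmod (a * b - v * w) \<le> e * (2 * L + e)"
proof -
  have e: "e \<ge> 0" using assms(1) norm_ge_zero order_trans by blast
  have L: "L \<ge> 0" using assms(3) norm_ge_zero order_trans by blast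
  have "a * b - v * w = (a - v) * (b - w) + (a - v) * w + v * (b - w)" by (simp add: algebra_simps)
  also have "cmod \<dots> \<le> cmod ((a - v) * (b - w)) + cmod ((a - v) * w) + cmod (v * (b - w))"
    by (intro order_trans[OF norm_triangle_ineq] add_mono order_refl)
  also have "\<dots> \<le> e * e + e * L + L * e" unfolding norm_mult using assms e L
    by (intro add_mono mult_mono) auto
  finally show ?thesis by (simp add: algebra_simps)
qed

context prolate begin

text \<open>\<open>wp\<close> and \<open>wm\<close> are the oscillations to which \<open>up\<close>
  and \<open>um\<close>, the rescaled derivative and the rescaled function, are asymptotic on the
  real axis. The letters p and m refer to the sign between the exponentials.\<close>

definition wp :: "real \<Rightarrow> complex" where "wp x = of_real (g 1) * (exp (\<i> * of_real (c * x)) + (-1)^k * exp (- (\<i> * of_real (c * x))))"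
definition wm :: "real \<Rightarrow> complex" where "wm x = of_real (g 1) * (exp (\<i> * of_real (c * x)) - (-1)^k * exp (- (\<i> * of_real (c * x))))"
definition up :: "real \<Rightarrow> complex" where "up x = of_real x * \<mu> * of_real (g1 x)"
definition um :: "real \<Rightarrow> complex" where "um x = \<i> * of_real (c * x) * \<mu> * of_real (g x)"

lemma norm_w: "cmod (wp x) \<le> 2 * \<bar>g 1\<bar>" "cmod (wm x) \<le> 2 * \<bar>g 1\<bar>"
proof -
  have e: "cmod (exp (\<i> * of_real (c * x))) = 1" "cmod ((-1)^k * exp (- (\<i> * of_real (c * x)))) = 1"
    by (auto simp: norm_mult norm_power)
  have "cmod (exp (\<i> * of_real (c * x)) + (-1)^k * exp (- (\<i> * of_real (c * x)))) \<le> 2"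
    using norm_triangle_ineq[of "exp (\<i> * of_real (c * x))" "(-1)^k * exp (- (\<i> * of_real (c * x)))"] unfolding e by simp
  from mult_left_mono[OF this, of "\<bar>g 1\<bar>"]
  show "cmod (wp x) \<le> 2 * \<bar>g 1\<bar>" unfolding wp_def norm_mult norm_of_real by simp
  have "cmod (exp (\<i> * of_real (c * x)) - (-1)^k * exp (- (\<i> * of_real (c * x)))) \<le> 2"
    using norm_triangle_ineq4[of "exp (\<i> * of_real (c * x))" "(-1)^k * exp (- (\<i> * of_real (c * x)))"] unfolding e by simp
  from mult_left_mono[OF this, of "\<bar>g 1\<bar>"]
  show "cmod (wm x) \<le> 2 * \<bar>g 1\<bar>" unfolding wm_def norm_mult norm_of_real by simp
qed

text \<open>The parallelogram law: each oscillation varies, the joint amplitude does not.\<close>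

lemma sum_sq_w: "(cmod (wp x))\<^sup>2 + (cmod (wm x))\<^sup>2 = 4 * (g 1)\<^sup>2"
proof -
  define a b where "a = exp (\<i> * of_real (c * x))" and "b = (-1)^k * exp (- (\<i> * of_real (c * x)))"
  have e: "cmod a = 1" "cmod b = 1" unfolding a_def b_def by (auto simp: norm_mult norm_power)
  have "(cmod (a + b))\<^sup>2 + (cmod (a - b))\<^sup>2 = 2 * (cmod a)\<^sup>2 + 2 * (cmod b)\<^sup>2"
    unfolding cmod_power2 plus_complex.sel minus_complex.sel by algebra
  thus ?thesis unfolding wp_def wm_def a_def[symmetric] b_def[symmetric] norm_mult
    using e by (simp add: power_mult_distrib flip: distrib_left)
qed

lemma asymp_real:
  obtains K where "K \<ge> 0" "\<And>x. x > 0 \<Longrightarrow> cmod (um x - wm x) \<le> K / x" "\<And>x. x > 0 \<Longrightarrow> cmod (up x - wp x) \<le> K / x"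
proof -
  obtain K1 where K1: "K1 \<ge> 0" "\<And>z. z \<noteq> 0 \<Longrightarrow> cmod (\<mu> * F z - of_real (g 1) * (exp (\<i> * (of_real c * z)) - (-1)^k * exp (- (\<i> * (of_real c * z)))) / (\<i> * (of_real c * z)))
     \<le> K1 * exp (c * \<bar>Im z\<bar>) / (cmod z)\<^sup>2" using F_asymp by blast
  obtain K2 where K2: "K2 \<ge> 0" "\<And>z. z \<noteq> 0 \<Longrightarrow> cmod (\<mu> * deriv F z - of_real (g 1) * (exp (\<i> * (of_real c * z)) + (-1)^k * exp (- (\<i> * (of_real c * z)))) / z)
     \<le> K2 * exp (c * \<bar>Im z\<bar>) / (cmod z)\<^sup>2" using dF_asymp by blast
  show ?thesis
  proof
    show "c * K1 + K2 \<ge> 0" using K1 K2 c_pos by simp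
    fix x :: real assume x: "x > 0"
    have w: "\<i> * complex_of_real (c * x) \<noteq> 0" "complex_of_real x \<noteq> 0" using x c_pos by auto
    have "um x - wm x = (\<i> * of_real (c * x)) * (\<mu> * of_real (g x) - wm x / (\<i> * of_real (c * x)))"
    proof -
      have "w * (a - b / w) = w * a - b" if "w \<noteq> 0" for w a b :: complex using that by (simp add: field_simps)
      from this[OF w(1)] show ?thesis by (simp add: um_def mult.assoc)
    qed
    hence "cmod (um x - wm x) = cmod (\<i> * of_real (c * x)) * cmod (\<mu> * of_real (g x) - wm x / (\<i> * of_real (c * x)))" by (simp only: norm_mult)
    also have "cmod (\<i> * of_real (c * x)) = c * x" using x c_pos by (simp add: norm_mult)
    also have "cmod (\<mu> * of_real (g x) - wm x / (\<i> * of_real (c * x))) \<le> K1 / x\<^sup>2"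
      using K1(2)[OF w(2)] by (simp add: F_of_real wm_def)
    hence "c * x * cmod (\<mu> * of_real (g x) - wm x / (\<i> * of_real (c * x))) \<le> c * x * (K1 / x\<^sup>2)"
      using x c_pos by (intro mult_left_mono) auto
    also have "c * x * (K1 / x\<^sup>2) = c * K1 / x" using x by (simp add: power2_eq_square)
    also have "\<dots> \<le> (c * K1 + K2) / x" using x K2 by (intro divide_right_mono) auto
    finally show "cmod (um x - wm x) \<le> (c * K1 + K2) / x" .
    have "up x - wp x = of_real x * (\<mu> * of_real (g1 x) - wp x / of_real x)"
      using w by (simp add: up_def right_diff_distrib)
    hence "cmod (up x - wp x) = x * cmod (\<mu> * of_real (g1 x) - wp x / of_real x)" using x by (simp add: norm_mult)
    also have "cmod (\<mu> * of_real (g1 x) - wp x / of_real x) \<le> K2 / x\<^sup>2"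
      using K2(2)[OF w(2)] by (simp add: dF_of_real wp_def)
    hence "x * cmod (\<mu> * of_real (g1 x) - wp x / of_real x) \<le> x * (K2 / x\<^sup>2)"
      using x by (intro mult_left_mono) auto
    also have "x * (K2 / x\<^sup>2) = K2 / x" using x by (simp add: power2_eq_square)
    also have "\<dots> \<le> (c * K1 + K2) / x" using x K1 c_pos by (intro divide_right_mono) auto
    finally show "cmod (up x - wp x) \<le> (c * K1 + K2) / x" .
  qed
qed

lemma amplitude_limit: "((\<lambda>x. c\<^sup>2 * (x * g x)\<^sup>2 + (x * g1 x)\<^sup>2) \<longlongrightarrow> 4 * (g 1)\<^sup>2 / (cmod \<mu>)\<^sup>2) at_top"
proof -
  obtain K where K: "K \<ge> 0" "\<And>x. x > 0 \<Longrightarrow> cmod (um x - wm x) \<le> K / x" "\<And>x. x > 0 \<Longrightarrow> cmod (up x - wp x) \<le> K / x"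
    using asymp_real by blast
  define L where "L = 2 * \<bar>g 1\<bar>"
  have sq: "\<bar>(cmod a)\<^sup>2 - (cmod v)\<^sup>2\<bar> \<le> e * (2 * L + e)" if "cmod (a - v) \<le> e" "cmod v \<le> L" for a v e
  proof -
    have "cmod (cnj a - cnj v) \<le> e" using that(1) by (metis complex_cnj_diff complex_mod_cnj)
    hence "cmod (a * cnj a - v * cnj v) \<le> e * (2 * L + e)" using that by (intro cmod_mult_diff_le) auto
    also have "a * cnj a - v * cnj v = of_real ((cmod a)\<^sup>2 - (cmod v)\<^sup>2)" by (simp only: of_real_diff complex_norm_square)
    finally show ?thesis unfolding norm_of_real .
  qed
  have bd: "\<bar>(cmod \<mu>)\<^sup>2 * (c\<^sup>2 * (x * g x)\<^sup>2 + (x * g1 x)\<^sup>2) - 4 * (g 1)\<^sup>2\<bar> \<le> 2 * ((K / x) * (2 * L + K / x))" if x: "x > 0" for x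
  proof -
    have "(cmod (um x))\<^sup>2 = (cmod \<mu>)\<^sup>2 * (c\<^sup>2 * (x * g x)\<^sup>2)" "(cmod (up x))\<^sup>2 = (cmod \<mu>)\<^sup>2 * (x * g1 x)\<^sup>2"
      unfolding um_def up_def norm_mult norm_of_real power_mult_distrib by (simp_all add: power_mult_distrib mult_ac)
    hence "(cmod \<mu>)\<^sup>2 * (c\<^sup>2 * (x * g x)\<^sup>2 + (x * g1 x)\<^sup>2) - 4 * (g 1)\<^sup>2 = ((cmod (um x))\<^sup>2 - (cmod (wm x))\<^sup>2) + ((cmod (up x))\<^sup>2 - (cmod (wp x))\<^sup>2)"
      using sum_sq_w[of x] by (simp add: distrib_left)
    moreover have "\<bar>(cmod (um x))\<^sup>2 - (cmod (wm x))\<^sup>2\<bar> \<le> (K / x) * (2 * L + K / x)"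
      by (rule sq[OF K(2)[OF x]]) (simp add: L_def norm_w)
    moreover have "\<bar>(cmod (up x))\<^sup>2 - (cmod (wp x))\<^sup>2\<bar> \<le> (K / x) * (2 * L + K / x)"
      by (rule sq[OF K(3)[OF x]]) (simp add: L_def norm_w)
    ultimately show ?thesis by linarith
  qed
  have "((\<lambda>x. 2 * ((K / x) * (2 * L + K / x))) \<longlongrightarrow> 0) at_top" by real_asymp
  moreover have "\<forall>\<^sub>F x in at_top. norm ((cmod \<mu>)\<^sup>2 * (c\<^sup>2 * (x * g x)\<^sup>2 + (x * g1 x)\<^sup>2) - 4 * (g 1)\<^sup>2) \<le> 2 * ((K / x) * (2 * L + K / x))"
    using eventually_gt_at_top[of 0] by eventually_elim (unfold real_norm_def, rule bd)
  ultimately have "((\<lambda>x. (cmod \<mu>)\<^sup>2 * (c\<^sup>2 * (x * g x)\<^sup>2 + (x * g1 x)\<^sup>2) - 4 * (g 1)\<^sup>2) \<longlongrightarrow> 0) at_top"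
    by (rule Lim_null_comparison[rotated])
  hence "((\<lambda>x. (cmod \<mu>)\<^sup>2 * (c\<^sup>2 * (x * g x)\<^sup>2 + (x * g1 x)\<^sup>2)) \<longlongrightarrow> 4 * (g 1)\<^sup>2) at_top" by (rule Lim_null[THEN iffD2])
  hence "((\<lambda>x. (cmod \<mu>)\<^sup>2 * (c\<^sup>2 * (x * g x)\<^sup>2 + (x * g1 x)\<^sup>2) / (cmod \<mu>)\<^sup>2) \<longlongrightarrow> 4 * (g 1)\<^sup>2 / (cmod \<mu>)\<^sup>2) at_top"
    using mu_nz by (intro tendsto_divide tendsto_const) auto
  thus ?thesis using mu_nz by simp
qed

end

section \<open>Slopes and gaps of the zeros beyond the turning point\<close>

context prolate_high begin

text \<open>Neither x g nor x g1 converges, so the limit is not taken termwise: \<open>E\<close>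
  differs from the amplitude divided by c^2 by bounded quadratic expressions whose coefficients tend
  to 0.\<close>

lemma E_limit: "(E \<longlongrightarrow> 4 * (g 1)\<^sup>2 / (c\<^sup>2 * (cmod \<mu>)\<^sup>2)) at_top"
proof -
  define ll where "ll = 4 * (g 1)\<^sup>2 / (cmod \<mu>)\<^sup>2"
  define a b where "a = (\<lambda>x. x * g x)" and "b = (\<lambda>x. x * g1 x)"
  define N where "N = (\<lambda>x. c\<^sup>2 * (a x)\<^sup>2 + (b x)\<^sup>2)"
  have N: "(N \<longlongrightarrow> ll) at_top" unfolding N_def a_def b_def ll_def by (rule amplitude_limit)
  have evN: "\<forall>\<^sub>F x in at_top. N x < ll + 1" by (rule order_tendstoD(2)[OF N]) simp
  define M where "M = (ll + 1) * (1 / c\<^sup>2 + 1)"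
  have sqb: "(a x)\<^sup>2 \<le> M \<and> (b x)\<^sup>2 \<le> M \<and> \<bar>a x * b x\<bar> \<le> M" if "N x < ll + 1" for x
  proof -
    have n: "c\<^sup>2 * (a x)\<^sup>2 + (b x)\<^sup>2 \<le> ll + 1" using that by (simp add: N_def)
    have l: "ll + 1 > 0" unfolding ll_def by (simp add: add_nonneg_pos)
    have "0 \<le> c\<^sup>2 * (a x)\<^sup>2" "0 \<le> (b x)\<^sup>2" by auto
    hence 0: "c\<^sup>2 * (a x)\<^sup>2 \<le> ll + 1" and 1: "(b x)\<^sup>2 \<le> ll + 1" using n by linarith+
    have 2: "(a x)\<^sup>2 \<le> (ll + 1) / c\<^sup>2" using 0 c_pos by (simp add: pos_le_divide_eq mult.commute)
    have M: "M = (ll + 1) / c\<^sup>2 + (ll + 1)" by (simp add: M_def distrib_left)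
    have "0 \<le> (ll + 1) / c\<^sup>2" using l by simp
    moreover have "2 * \<bar>a x * b x\<bar> \<le> (a x)\<^sup>2 + (b x)\<^sup>2" using sum_squares_bound[of "\<bar>a x\<bar>" "\<bar>b x\<bar>"] by (simp add: abs_mult mult.assoc)
    ultimately show ?thesis using 1 2 l unfolding M by linarith
  qed
  define P S where "P = (\<lambda>x::real. (x\<^sup>2 - 1) / x\<^sup>2)" and "S = (\<lambda>x::real. x\<^sup>2 / (c\<^sup>2 * x\<^sup>2 - ch))"
  have P: "(P \<longlongrightarrow> 1) at_top" unfolding P_def by real_asymp
  have S: "(S \<longlongrightarrow> 1 / c\<^sup>2) at_top" unfolding S_def inverse_eq_divide[symmetric] using c_pos by real_asymp
  have R: "((\<lambda>x::real. 1 / x) \<longlongrightarrow> 0) at_top" by real_asymp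
  have "((\<lambda>x. (P x - 1) * (a x)\<^sup>2 + (S x * (P x)\<^sup>2 - 1 / c\<^sup>2) * (b x)\<^sup>2 + (2 * S x * P x * (1 / x)) * (a x * b x) + (S x * (1 / x)\<^sup>2) * (a x)\<^sup>2) \<longlongrightarrow> 0 + 0 + 0 + 0) at_top"
  proof -
    have b: "\<forall>\<^sub>F x in at_top. \<bar>(a x)\<^sup>2\<bar> \<le> M" "\<forall>\<^sub>F x in at_top. \<bar>(b x)\<^sup>2\<bar> \<le> M" "\<forall>\<^sub>F x in at_top. \<bar>a x * b x\<bar> \<le> M"
      using evN by (eventually_elim, use sqb in auto)+
    have 1: "((\<lambda>x. P x - 1) \<longlongrightarrow> 0) at_top" using tendsto_diff[OF P tendsto_const[of 1]] by simp
    have 2: "((\<lambda>x. S x * (P x)\<^sup>2 - 1 / c\<^sup>2) \<longlongrightarrow> 0) at_top"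
      using tendsto_diff[OF tendsto_mult[OF S tendsto_power[OF P, of 2]] tendsto_const[of "1 / c\<^sup>2"]] by simp
    have 3: "((\<lambda>x. 2 * S x * P x * (1 / x)) \<longlongrightarrow> 0) at_top"
      using tendsto_mult[OF tendsto_mult[OF tendsto_mult[OF tendsto_const[of 2] S] P] R] by simp
    have 4: "((\<lambda>x. S x * (1 / x)\<^sup>2) \<longlongrightarrow> 0) at_top"
      using tendsto_mult[OF S tendsto_power[OF R, of 2]] by simp
    show ?thesis
      by (intro tendsto_add tendsto_zero_mult_bounded[OF 1 b(1)] tendsto_zero_mult_bounded[OF 2 b(2)]
          tendsto_zero_mult_bounded[OF 3 b(3)] tendsto_zero_mult_bounded[OF 4 b(1)])
  qed
  moreover have "((\<lambda>x. N x / c\<^sup>2) \<longlongrightarrow> ll / c\<^sup>2) at_top" using c_pos by (intro tendsto_divide N tendsto_const) auto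
  ultimately have "((\<lambda>x. ((P x - 1) * (a x)\<^sup>2 + (S x * (P x)\<^sup>2 - 1 / c\<^sup>2) * (b x)\<^sup>2 + (2 * S x * P x * (1 / x)) * (a x * b x) + (S x * (1 / x)\<^sup>2) * (a x)\<^sup>2) + N x / c\<^sup>2) \<longlongrightarrow> (0 + 0 + 0 + 0) + ll / c\<^sup>2) at_top"
    by (rule tendsto_add)
  moreover have "\<forall>\<^sub>F x in at_top. ((P x - 1) * (a x)\<^sup>2 + (S x * (P x)\<^sup>2 - 1 / c\<^sup>2) * (b x)\<^sup>2 + (2 * S x * P x * (1 / x)) * (a x * b x) + (S x * (1 / x)\<^sup>2) * (a x)\<^sup>2) + N x / c\<^sup>2 = E x"
    using eventually_gt_at_top[of 0]
  proof eventually_elim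
    fix x :: real assume x: "x > 0"
    have N': "N x / c\<^sup>2 = (a x)\<^sup>2 + 1 / c\<^sup>2 * (b x)\<^sup>2" using c_pos by (simp add: N_def add_divide_distrib)
    have "E x = P x * (a x)\<^sup>2 + S x * (P x * b x + 1 / x * a x)\<^sup>2"
    proof -
      have e1: "(x\<^sup>2 - 1) * (g x)\<^sup>2 = P x * (a x)\<^sup>2" using x by (simp add: P_def a_def power_mult_distrib)
      have "(x\<^sup>2 - 1) * g1 x + x * g x = x * (P x * b x + 1 / x * a x)" using x by (simp add: P_def a_def b_def field_simps power2_eq_square)
      hence e2: "((x\<^sup>2 - 1) * g1 x + x * g x)\<^sup>2 / (c\<^sup>2 * x\<^sup>2 - ch) = S x * (P x * b x + 1 / x * a x)\<^sup>2"
        by (simp add: S_def power_mult_distrib)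
      show ?thesis unfolding E_def e1 e2 ..
    qed
    thus "((P x - 1) * (a x)\<^sup>2 + (S x * (P x)\<^sup>2 - 1 / c\<^sup>2) * (b x)\<^sup>2 + (2 * S x * P x * (1 / x)) * (a x * b x) + (S x * (1 / x)\<^sup>2) * (a x)\<^sup>2) + N x / c\<^sup>2 = E x"
      unfolding N' by algebra
  qed
  ultimately have "(E \<longlongrightarrow> (0 + 0 + 0 + 0) + ll / c\<^sup>2) at_top" by (rule Lim_transform_eventually)
  thus ?thesis by (simp add: ll_def mult.commute)
qed

text \<open>The limit at infinity bounds earlier values from below up to the factor exp (1/2), the
  largest value of the integrating factor on the half-line from \<open>a0\<close>.\<close>

lemma E_lower:
  assumes x: "a0 \<le> x"
  shows "exp (- 1 / 2) * (4 * (g 1)\<^sup>2 / (c\<^sup>2 * (cmod \<mu>)\<^sup>2)) \<le> E x"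
proof -
  define l where "l = 4 * (g 1)\<^sup>2 / (c\<^sup>2 * (cmod \<mu>)\<^sup>2)"
  have "\<forall>\<^sub>F y in at_top. E y \<le> E x * exp (1 / (2 * za) / (x\<^sup>2 - 1))"
    using eventually_ge_at_top[of x]
  proof eventually_elim
    fix y assume y: "x \<le> y"
    have yp: "y\<^sup>2 - 1 > 0" "c\<^sup>2 * y\<^sup>2 - ch \<ge> za" using above_a0[of y] x y by auto
    have "E y \<ge> 0" unfolding E_def using yp za_props(1) by simp
    moreover have "1 \<le> exp (1 / (2 * za) / (y\<^sup>2 - 1))" using yp za_props(1) by simp
    ultimately have "E y * 1 \<le> E y * exp (1 / (2 * za) / (y\<^sup>2 - 1))" by (intro mult_left_mono)
    also have "\<dots> \<le> E x * exp (1 / (2 * za) / (x\<^sup>2 - 1))" by (rule E_exp_antimono[OF x y])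
    finally show "E y \<le> E x * exp (1 / (2 * za) / (x\<^sup>2 - 1))" by simp
  qed
  hence 1: "l \<le> E x * exp (1 / (2 * za) / (x\<^sup>2 - 1))"
    unfolding l_def by (rule tendsto_upperbound[OF E_limit]) simp
  have xp: "x\<^sup>2 - 1 \<ge> 1 / za" "c\<^sup>2 * x\<^sup>2 - ch \<ge> za" "x\<^sup>2 - 1 > 0" using above_a0[OF x] by auto
  have "1 / (2 * za) / (x\<^sup>2 - 1) \<le> 1 / (2 * za) / (1 / za)" using xp za_props(1) by (intro divide_left_mono) auto
  hence "1 / (2 * za) / (x\<^sup>2 - 1) \<le> 1 / 2" using za_props(1) by simp
  moreover have "E x \<ge> 0" unfolding E_def using xp za_props(1) by simp
  ultimately have "E x * exp (1 / (2 * za) / (x\<^sup>2 - 1)) \<le> E x * exp (1 / 2)" by (intro mult_left_mono) auto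
  hence "l \<le> E x * exp (1 / 2)" using 1 by linarith
  hence "exp (- 1 / 2) * l \<le> exp (- 1 / 2) * (E x * exp (1 / 2))" by (intro mult_left_mono) auto
  also have "\<dots> = E x" by (simp add: mult.left_commute flip: exp_add)
  finally show ?thesis by (simp add: l_def)
qed

text \<open>At a zero only the second summand of \<open>E\<close> remains, and it contains the
  slope. The bound shows that slopes at outer zeros are of order 1 / |\<mu>|.\<close>

lemma slope_at_zero:
  assumes x: "a0 \<le> x" "g x = 0"
  shows "exp (- 1 / 2) * (4 * (g 1)\<^sup>2 / (c\<^sup>2 * (cmod \<mu>)\<^sup>2)) * (c\<^sup>2 * x\<^sup>2 - ch) / (x\<^sup>2 - 1)\<^sup>2 \<le> (g1 x)\<^sup>2"
proof -
  define p q where "p = x\<^sup>2 - 1" and "q = c\<^sup>2 * x\<^sup>2 - ch"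
  have p: "p > 0" and q: "q > 0" using above_a0[OF x(1)] za_props(1) by (auto simp: p_def q_def)
  have "E x = p\<^sup>2 * (g1 x)\<^sup>2 / q" unfolding E_def p_def q_def using x by (simp add: power_mult_distrib)
  hence "exp (- 1 / 2) * (4 * (g 1)\<^sup>2 / (c\<^sup>2 * (cmod \<mu>)\<^sup>2)) \<le> p\<^sup>2 * (g1 x)\<^sup>2 / q" using E_lower[OF x(1)] by simp
  hence "exp (- 1 / 2) * (4 * (g 1)\<^sup>2 / (c\<^sup>2 * (cmod \<mu>)\<^sup>2)) * q \<le> p\<^sup>2 * (g1 x)\<^sup>2" using q by (simp only: pos_le_divide_eq)
  hence "exp (- 1 / 2) * (4 * (g 1)\<^sup>2 / (c\<^sup>2 * (cmod \<mu>)\<^sup>2)) * q \<le> (g1 x)\<^sup>2 * p\<^sup>2" by (simp only: mult.commute)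
  thus ?thesis unfolding p_def[symmetric] q_def[symmetric] using p by (simp only: pos_divide_le_eq zero_less_power)
qed

lemma zero_gt_a0: assumes "1 \<le> x" "g x = 0" shows "a0 < x"
  using positive_to_a0[of x] assms by force

lemma slope_nonzero: assumes "1 \<le> x" "g x = 0" shows "g1 x \<noteq> 0"
proof
  assume z: "g1 x = 0"
  have x: "a0 \<le> x" using zero_gt_a0[OF assms] by simp
  have "0 < exp (- 1 / 2) * (4 * (g 1)\<^sup>2 / (c\<^sup>2 * (cmod \<mu>)\<^sup>2)) * (c\<^sup>2 * x\<^sup>2 - ch) / (x\<^sup>2 - 1)\<^sup>2"
    using above_a0[OF x] za_props(1) g_one_nz c_pos mu_nz by (intro divide_pos_pos mult_pos_pos) auto
  thus False using slope_at_zero[OF x assms(2)] z by simp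
qed

text \<open>Each summand of \<open>T\<close> is at most c^2, the second because 1 / (x^2 - 1) \<le>
  za \<le> c. This is the origin of the frequency sqrt 2 * c in the gap estimates.\<close>

lemma T_le: assumes "a0 \<le> x" shows "T x \<le> 2 * c\<^sup>2"
proof -
  note a = above_a0[OF assms]
  have "c\<^sup>2 * x\<^sup>2 - ch \<le> c\<^sup>2 * (x\<^sup>2 - 1)" using ch_gt by (simp add: right_diff_distrib)
  hence "(c\<^sup>2 * x\<^sup>2 - ch) / (x\<^sup>2 - 1) \<le> c\<^sup>2" using a by (simp add: pos_divide_le_eq)
  moreover have "1 / (x\<^sup>2 - 1)\<^sup>2 \<le> c\<^sup>2"
  proof -
    have "1 / (x\<^sup>2 - 1) \<le> za" using a(2,3) za_props(1) by (simp add: field_simps)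
    hence "1 / (x\<^sup>2 - 1) \<le> c" using za_props by linarith
    hence "(1 / (x\<^sup>2 - 1))\<^sup>2 \<le> c\<^sup>2" using a(3) by (intro power_mono) auto
    thus ?thesis by (simp add: power_divide)
  qed
  ultimately show ?thesis by (simp add: T_def)
qed

lemma finite_zeros: "finite {x \<in> {a..b}. g x = 0}"
proof -
  have "finite {z \<in> cball 0 (\<bar>a\<bar> + \<bar>b\<bar>). F z = 0}"
  proof (rule holomorphic_compact_finite_zeros[OF F_holo, of UNIV])
    show "\<not> F constant_on UNIV"
    proof
      assume "F constant_on UNIV"
      then obtain C where C: "\<And>z. F z = C" by (auto simp: constant_on_def)
      hence F': "F = (\<lambda>z. C)" by auto
      have "deriv F = (\<lambda>z. 0)" by (simp add: F')
      hence "deriv (deriv F) = (\<lambda>z. 0)" by simp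
      hence "(of_real ch - of_real (c\<^sup>2) * z\<^sup>2) * C = 0" for z
        using F_ode[of z] \<open>deriv F = _\<close> C by simp
      from this[of 0] have "C = 0" using ch_pos by simp
      thus False using C[of 1] F_of_real[of 1] g_one_nz by simp
    qed
  qed auto
  hence "finite (Re ` {z \<in> cball 0 (\<bar>a\<bar> + \<bar>b\<bar>). F z = 0})" by simp
  moreover have "{x \<in> {a..b}. g x = 0} \<subseteq> Re ` {z \<in> cball 0 (\<bar>a\<bar> + \<bar>b\<bar>). F z = 0}"
  proof
    fix x assume x: "x \<in> {x \<in> {a..b}. g x = 0}"
    hence "of_real x \<in> {z \<in> cball 0 (\<bar>a\<bar> + \<bar>b\<bar>). F z = 0}" by (auto simp: F_of_real)
    thus "x \<in> Re ` {z \<in> cball 0 (\<bar>a\<bar> + \<bar>b\<bar>). F z = 0}" by (rule rev_image_eqI) simp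
  qed
  ultimately show ?thesis by (rule finite_subset[rotated])
qed

lemma outer_zero_spacing:
  assumes "1 \<le> a" "g a = 0" "a < b" "g b = 0"
  shows "pi \<le> sqrt 2 * c * (b - a)"
proof -
  have a: "a0 < a" by (rule zero_gt_a0[OF assms(1,2)])
  have "pi \<le> sqrt 2 * c * b - sqrt 2 * c * a"
  proof (rule zero_gap_general[where \<Phi> = "\<lambda>x. sqrt 2 * c * x" and \<Phi>' = "\<lambda>_. sqrt 2 * c" and \<omega> = "sqrt 2 * c"])
    show "sqrt 2 * c > 0" using c_pos by simp
    show "finite {x \<in> {a..b}. g x = 0}" by (rule finite_zeros)
    fix x assume x: "a \<le> x" "x \<le> b"
    show "g1 x \<noteq> 0" if "g x = 0" using slope_nonzero[OF _ that] x assms by simp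
    show "x\<^sup>2 \<noteq> 1" using above_a0(3)[of x] x a by simp
    show "((\<lambda>x. sqrt 2 * c * x) has_real_derivative sqrt 2 * c) (at x)" by (rule DERIV_cmult_Id)
  next
    fix x assume "a < x" "x < b"
    hence "T x \<le> 2 * c\<^sup>2" using a by (intro T_le) auto
    hence "(T x - (sqrt 2 * c)\<^sup>2) / (sqrt 2 * c) \<le> 0" using c_pos by (intro divide_nonpos_pos) (auto simp: power_mult_distrib)
    thus "sqrt 2 * c \<le> sqrt 2 * c \<and> sqrt 2 * c + (T x - (sqrt 2 * c)\<^sup>2) / (sqrt 2 * c) \<le> sqrt 2 * c" by simp
  qed (use assms c_pos in auto)
  thus ?thesis by (simp add: right_diff_distrib)
qed

text \<open>\<open>y_a0\<close> allows the half-gap estimate to start at \<open>a0\<close>; it is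
  applied to the first zero beyond it.\<close>

lemma first_outer_zero:
  assumes "1 \<le> b" "g b = 0"
  shows "pi / 2 \<le> sqrt 2 * c * (b - a0)"
proof -
  define S where "S = {x \<in> {a0..b}. g x = 0}"
  have S: "finite S" "b \<in> S" using finite_zeros assms zero_gt_a0[OF assms] by (auto simp: S_def)
  define b' where "b' = Min S"
  have b': "b' \<in> S" "\<And>x. x \<in> S \<Longrightarrow> b' \<le> x" unfolding b'_def using S by (auto intro!: Min_in)
  have b'': "a0 \<le> b'" "b' \<le> b" "g b' = 0" using b'(1) by (auto simp: S_def)
  have b1: "1 \<le> b'" using a0_props b'' by simp
  have lt: "a0 < b'" by (rule zero_gt_a0[OF b1 b''(3)])
  have "pi / 2 \<le> sqrt 2 * c * b' - sqrt 2 * c * a0"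
  proof (rule zero_half_gap[where \<Phi> = "\<lambda>x. sqrt 2 * c * x" and \<Phi>' = "\<lambda>_. sqrt 2 * c" and \<omega> = "sqrt 2 * c"])
    show "sqrt 2 * c > 0" using c_pos by simp
    show "0 \<le> g1 a0 / g a0 + a0 / (a0\<^sup>2 - 1)" by (rule y_a0)
    show "g1 b' \<noteq> 0" by (rule slope_nonzero[OF b1 b''(3)])
    fix x assume x: "a0 \<le> x"
    show "x\<^sup>2 \<noteq> 1" using above_a0(3)[OF x] by simp
    show "((\<lambda>x. sqrt 2 * c * x) has_real_derivative sqrt 2 * c) (at x)" by (rule DERIV_cmult_Id)
    show "g x \<noteq> 0" if "x < b'"
    proof
      assume "g x = 0"
      hence "x \<in> S" using x that b'' by (auto simp: S_def)
      thus False using b'(2)[of x] that by simp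
    qed
  next
    fix x assume "a0 < x" "x < b'"
    hence "T x \<le> 2 * c\<^sup>2" by (intro T_le) auto
    hence "(T x - (sqrt 2 * c)\<^sup>2) / (sqrt 2 * c) \<le> 0" using c_pos by (intro divide_nonpos_pos) (auto simp: power_mult_distrib)
    thus "sqrt 2 * c \<le> sqrt 2 * c \<and> sqrt 2 * c + (T x - (sqrt 2 * c)\<^sup>2) / (sqrt 2 * c) \<le> sqrt 2 * c" by simp
  qed (use lt b'' in auto)
  also have "\<dots> = sqrt 2 * c * (b' - a0)" by (simp add: right_diff_distrib)
  also have "\<dots> \<le> sqrt 2 * c * (b - a0)" using b'' c_pos by (intro mult_left_mono) auto
  finally show ?thesis .
qed

end

text \<open>The second function is an instance of the weaker locale, because its parameter
  \<open>ch'\<close> may lie below c^2. Its variation is therefore controlled through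
  \<open>ch\<close>.\<close>

locale prolate_pair = prolate_high c ch \<mu> f k + M: prolate c ch' \<mu>' f' k'
  for c ch \<mu> f k ch' \<mu>' f' k' +
  assumes ch'_le: "ch' \<le> ch"
begin

text \<open>The Wronskian weighted by x^2 - 1, so that Lagrange's identity gives it a derivative
  without derivatives of the two functions. At a zero of \<open>g\<close> it yields the value of
  \<open>M.g\<close>.\<close>

definition Wr :: "real \<Rightarrow> real" where "Wr x = (x\<^sup>2 - 1) * g1 x * M.g x - (x\<^sup>2 - 1) * M.g1 x * g x"

lemma Wr_deriv: "(Wr has_real_derivative (ch - ch') * (g x * M.g x)) (at x)"
proof -
  have "(Wr has_real_derivative ((ch - c\<^sup>2 * x\<^sup>2) * g x * M.g x + M.g1 x * ((x\<^sup>2 - 1) * g1 x)) -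
    ((ch' - c\<^sup>2 * x\<^sup>2) * M.g x * g x + g1 x * ((x\<^sup>2 - 1) * M.g1 x))) (at x)"
    unfolding Wr_def[abs_def] by (intro DERIV_diff DERIV_mult g_flux M.g_flux g_deriv M.g_deriv)
  moreover have "((ch - c\<^sup>2 * x\<^sup>2) * g x * M.g x + M.g1 x * ((x\<^sup>2 - 1) * g1 x)) -
    ((ch' - c\<^sup>2 * x\<^sup>2) * M.g x * g x + g1 x * ((x\<^sup>2 - 1) * M.g1 x)) = (ch - ch') * (g x * M.g x)" by algebra
  ultimately show ?thesis by (simp only:)
qed

text \<open>For equal parities both functions oscillate in phase at infinity, and the leading terms
  cancel by the identity \<open>cross\<close>.\<close>

lemma Wr_limit:
  assumes par: "even k \<longleftrightarrow> even k'"
  shows "(Wr \<longlongrightarrow> 0) at_top"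
proof -
  obtain K where K: "K \<ge> 0" "\<And>x. x > 0 \<Longrightarrow> cmod (um x - wm x) \<le> K / x" "\<And>x. x > 0 \<Longrightarrow> cmod (up x - wp x) \<le> K / x"
    using asymp_real by blast
  obtain K' where K': "K' \<ge> 0" "\<And>x. x > 0 \<Longrightarrow> cmod (M.um x - M.wm x) \<le> K' / x" "\<And>x. x > 0 \<Longrightarrow> cmod (M.up x - M.wp x) \<le> K' / x"
    using M.asymp_real by blast
  define L where "L = 2 * \<bar>g 1\<bar> + 2 * \<bar>M.g 1\<bar>"
  have L: "cmod (wp x) \<le> L" "cmod (wm x) \<le> L" "cmod (M.wp x) \<le> L" "cmod (M.wm x) \<le> L" for x
    using norm_w[of x] M.norm_w[of x] by (auto simp: L_def)
  have sgn_eq: "(-1::complex)^k = (-1)^k'" using par by (cases "even k") auto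
  have cross: "wp x * M.wm x = wm x * M.wp x" for x
    unfolding wp_def wm_def M.wp_def M.wm_def sgn_eq by (simp add: algebra_simps)
  define k0 where "k0 = c * cmod \<mu> * cmod \<mu>'"
  have k0: "k0 > 0" using c_pos mu_nz M.mu_nz by (simp add: k0_def)
  define e where "e = (\<lambda>x. (K + K') / x)"
  have bd: "\<bar>x * g1 x * (x * M.g x) - x * M.g1 x * (x * g x)\<bar> \<le> 2 * (e x * (2 * L + e x)) / k0" if x: "x > 0" for x
  proof -
    have "K / x \<le> e x" "K' / x \<le> e x" unfolding e_def using K(1) K'(1) x by (auto intro!: divide_right_mono)
    hence e1: "cmod (um x - wm x) \<le> e x" "cmod (up x - wp x) \<le> e x" "cmod (M.um x - M.wm x) \<le> e x" "cmod (M.up x - M.wp x) \<le> e x"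
      using K(2,3)[OF x] K'(2,3)[OF x] by linarith+
    have "up x * M.um x - um x * M.up x = \<i> * of_real c * \<mu> * \<mu>' * of_real (x * g1 x * (x * M.g x) - x * M.g1 x * (x * g x))"
      unfolding up_def um_def M.up_def M.um_def by (simp add: algebra_simps)
    hence "k0 * \<bar>x * g1 x * (x * M.g x) - x * M.g1 x * (x * g x)\<bar> = cmod (up x * M.um x - um x * M.up x)"
      using c_pos by (simp add: norm_mult k0_def del: of_real_mult of_real_diff)
    also have "\<dots> = cmod ((up x * M.um x - wp x * M.wm x) - (um x * M.up x - wm x * M.wp x))" by (simp add: cross)
    also have "\<dots> \<le> e x * (2 * L + e x) + e x * (2 * L + e x)"
      by (intro order_trans[OF norm_triangle_ineq4] add_mono cmod_mult_diff_le e1 L)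
    finally have "\<bar>x * g1 x * (x * M.g x) - x * M.g1 x * (x * g x)\<bar> * k0 \<le> 2 * (e x * (2 * L + e x))" by (simp add: mult.commute)
    thus ?thesis using k0 by (simp add: pos_le_divide_eq)
  qed
  have "((\<lambda>x. 2 * (e x * (2 * L + e x)) / k0) \<longlongrightarrow> 0) at_top"
  proof -
    have "((\<lambda>x. 2 * (e x * (2 * L + e x))) \<longlongrightarrow> 0) at_top" unfolding e_def by real_asymp
    from tendsto_divide_zero[OF this] show ?thesis .
  qed
  moreover have "\<forall>\<^sub>F x in at_top. norm (x * g1 x * (x * M.g x) - x * M.g1 x * (x * g x)) \<le> 2 * (e x * (2 * L + e x)) / k0"
    using eventually_gt_at_top[of 0] by eventually_elim (unfold real_norm_def, rule bd)
  ultimately have "((\<lambda>x. x * g1 x * (x * M.g x) - x * M.g1 x * (x * g x)) \<longlongrightarrow> 0) at_top"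
    by (rule Lim_null_comparison[rotated])
  moreover have "((\<lambda>x::real. (x\<^sup>2 - 1) / x\<^sup>2) \<longlongrightarrow> 1) at_top" by real_asymp
  ultimately have "((\<lambda>x. (x * g1 x * (x * M.g x) - x * M.g1 x * (x * g x)) * ((x\<^sup>2 - 1) / x\<^sup>2)) \<longlongrightarrow> 0 * 1) at_top"
    by (rule tendsto_mult)
  moreover have "\<forall>\<^sub>F x in at_top. (x * g1 x * (x * M.g x) - x * M.g1 x * (x * g x)) * ((x\<^sup>2 - 1) / x\<^sup>2) = Wr x"
    using eventually_gt_at_top[of 0]
  proof eventually_elim
    fix x :: real assume "x > 0"
    hence c: "x\<^sup>2 * A * ((x\<^sup>2 - 1) / x\<^sup>2) = (x\<^sup>2 - 1) * A" for A by simp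
    have "x * g1 x * (x * M.g x) - x * M.g1 x * (x * g x) = x\<^sup>2 * (g1 x * M.g x - M.g1 x * g x)" by algebra
    moreover have "Wr x = (x\<^sup>2 - 1) * (g1 x * M.g x - M.g1 x * g x)" unfolding Wr_def by algebra
    ultimately show "(x * g1 x * (x * M.g x) - x * M.g1 x * (x * g x)) * ((x\<^sup>2 - 1) / x\<^sup>2) = Wr x"
      by (simp only: c)
  qed
  ultimately have "(Wr \<longlongrightarrow> 0 * 1) at_top" by (rule Lim_transform_eventually)
  thus ?thesis by simp
qed

text \<open>The derivative is O(1/x^2) by the decay of both functions, so adding or subtracting D /
  x makes \<open>Wr\<close> monotone, and the limit 0 at infinity turns this into a bound.\<close>

lemma Wr_bound:
  assumes par: "even k \<longleftrightarrow> even k'" and x: "x > 0"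
  shows "\<bar>Wr x\<bar> \<le> (ch - ch') * B * M.B / (c\<^sup>2 * cmod \<mu> * cmod \<mu>') / x"
proof -
  define D where "D = (ch - ch') * B * M.B / (c\<^sup>2 * cmod \<mu> * cmod \<mu>')"
  have d: "\<bar>(ch - ch') * (g t * M.g t)\<bar> \<le> D / t\<^sup>2" if t: "t > 0" for t
  proof -
    have mu: "cmod \<mu> > 0" "cmod \<mu>' > 0" using mu_nz M.mu_nz by auto
    have "\<bar>g t\<bar> \<le> B / (c * t) / cmod \<mu>" "\<bar>M.g t\<bar> \<le> M.B / (c * t) / cmod \<mu>'"
      using g_decay[OF t] M.g_decay[OF t] by (simp_all only: pos_le_divide_eq[OF mu(1)] pos_le_divide_eq[OF mu(2)] mult.commute)
    hence "\<bar>g t\<bar> * \<bar>M.g t\<bar> \<le> (B / (c * t) / cmod \<mu>) * (M.B / (c * t) / cmod \<mu>')"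
      using B_nonneg c_pos t by (intro mult_mono) auto
    hence "(ch - ch') * (\<bar>g t\<bar> * \<bar>M.g t\<bar>) \<le> (ch - ch') * ((B / (c * t) / cmod \<mu>) * (M.B / (c * t) / cmod \<mu>'))"
      using ch'_le by (intro mult_left_mono) auto
    also have "\<dots> = D / t\<^sup>2" by (simp add: D_def power2_eq_square mult_ac)
    finally show ?thesis using ch'_le by (simp add: abs_mult)
  qed
  have inv: "((\<lambda>t. D / t) has_real_derivative - (D / t\<^sup>2)) (at t)" if "t > 0" for t
    using that by (auto intro!: derivative_eq_intros simp: power2_eq_square)
  have lD: "((\<lambda>t. D / t) \<longlongrightarrow> 0) at_top" by real_asymp
  have "\<forall>\<^sub>F y in at_top. Wr y + D / y \<le> Wr x + D / x"
    using eventually_ge_at_top[of x]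
  proof eventually_elim
    fix y assume y: "x \<le> y"
    show "Wr y + D / y \<le> Wr x + D / x"
    proof (rule DERIV_nonpos_imp_nonincreasing[OF y])
      fix t assume "x \<le> t"
      hence t: "t > 0" using x by simp
      show "\<exists>d. ((\<lambda>t. Wr t + D / t) has_real_derivative d) (at t) \<and> d \<le> 0"
        using DERIV_add[OF Wr_deriv inv[OF t]] d[OF t] by (intro exI conjI) (assumption, linarith)
    qed
  qed
  moreover have "((\<lambda>y. Wr y + D / y) \<longlongrightarrow> 0 + 0) at_top" by (intro tendsto_add Wr_limit par lD)
  ultimately have 1: "0 + 0 \<le> Wr x + D / x" by (intro tendsto_upperbound) auto
  have "\<forall>\<^sub>F y in at_top. Wr x - D / x \<le> Wr y - D / y"
    using eventually_ge_at_top[of x]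
  proof eventually_elim
    fix y assume y: "x \<le> y"
    show "Wr x - D / x \<le> Wr y - D / y"
    proof (rule DERIV_nonneg_imp_nondecreasing[OF y])
      fix t assume "x \<le> t"
      hence t: "t > 0" using x by simp
      show "\<exists>d. ((\<lambda>t. Wr t - D / t) has_real_derivative d) (at t) \<and> 0 \<le> d"
        using DERIV_diff[OF Wr_deriv inv[OF t]] d[OF t] by (intro exI conjI) (assumption, linarith)
    qed
  qed
  moreover have "((\<lambda>y. Wr y - D / y) \<longlongrightarrow> 0 - 0) at_top" by (intro tendsto_diff Wr_limit par lD)
  ultimately have 2: "Wr x - D / x \<le> 0 - 0" by (intro tendsto_lowerbound) auto
  show ?thesis using 1 2 unfolding D_def[symmetric] by linarith
qed

end

section \<open>Partial fractions\<close>

lemma contour_integrable_rectpath: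
  assumes f: "continuous_on (path_image (rectpath a b)) f"
  shows "f contour_integrable_on rectpath a b"
proof -
  define a2 a4 where "a2 = Complex (Re b) (Im a)" and "a4 = Complex (Re a) (Im b)"
  have im: "path_image (rectpath a b) = closed_segment a a2 \<union> closed_segment a2 b \<union> closed_segment b a4 \<union> closed_segment a4 a"
    by (simp add: rectpath_def Let_def path_image_join Un_assoc a2_def a4_def)
  have "f contour_integrable_on linepath a a2" "f contour_integrable_on linepath a2 b"
    "f contour_integrable_on linepath b a4" "f contour_integrable_on linepath a4 a"
    using f unfolding im by (auto intro!: contour_integrable_continuous_linepath intro: continuous_on_subset)
  thus ?thesis
    unfolding rectpath_def Let_def a2_def[symmetric] a4_def[symmetric] by (intro contour_integrable_joinI) auto
qed

lemma contour_integral_rectpath_bound: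
  assumes f: "continuous_on (path_image (rectpath a b)) f"
    and ab: "Re a \<le> Re b" "Im a \<le> Im b" and L: "0 \<le> L" "\<And>z. z \<in> path_image (rectpath a b) \<Longrightarrow> cmod (f z) \<le> L"
  shows "cmod (contour_integral (rectpath a b) f) \<le> L * (2 * (Re b - Re a) + 2 * (Im b - Im a))"
proof -
  define a2 a4 where "a2 = Complex (Re b) (Im a)" and "a4 = Complex (Re a) (Im b)"
  have im: "path_image (rectpath a b) = closed_segment a a2 \<union> closed_segment a2 b \<union> closed_segment b a4 \<union> closed_segment a4 a"
    by (simp add: rectpath_def Let_def path_image_join Un_assoc a2_def a4_def)
  have i: "f contour_integrable_on linepath a a2" "f contour_integrable_on linepath a2 b"
    "f contour_integrable_on linepath b a4" "f contour_integrable_on linepath a4 a"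
    using f unfolding im by (auto intro!: contour_integrable_continuous_linepath intro: continuous_on_subset)
  have "contour_integral (rectpath a b) f = contour_integral (linepath a a2) f +
     (contour_integral (linepath a2 b) f + (contour_integral (linepath b a4) f + contour_integral (linepath a4 a) f))"
    unfolding rectpath_def Let_def a2_def[symmetric] a4_def[symmetric] using i by simp
  also have "cmod \<dots> \<le> L * cmod (a2 - a) + (L * cmod (b - a2) + (L * cmod (a4 - b) + L * cmod (a - a4)))"
    using L i im by (intro order_trans[OF norm_triangle_ineq] add_mono contour_integral_bound_linepath) auto
  finally have le: "cmod (contour_integral (rectpath a b) f) \<le> L * cmod (a2 - a) + (L * cmod (b - a2) + (L * cmod (a4 - b) + L * cmod (a - a4)))" .
  have n: "cmod (a2 - a) = Re b - Re a" "cmod (b - a2) = Im b - Im a" "cmod (a4 - b) = Re b - Re a" "cmod (a - a4) = Im b - Im a"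
    using ab by (auto simp: a2_def a4_def cmod_def)
  show ?thesis using le unfolding n by (simp add: algebra_simps)
qed

context prolate_pair begin

definition r :: "complex \<Rightarrow> complex" where "r z = M.F z / F z"

lemma slope_nonzero_everywhere:
  assumes simple: "\<And>t. -1 < t \<Longrightarrow> t < 1 \<Longrightarrow> g t = 0 \<Longrightarrow> g1 t \<noteq> 0" and z: "g x = 0"
  shows "g1 x \<noteq> 0"
proof -
  consider "1 \<le> x" | "-1 < x" "x < 1" | "x \<le> -1" by linarith
  thus ?thesis
  proof cases
    case 3
    hence "g1 (- x) \<noteq> 0" using z by (intro slope_nonzero) (auto simp: g_parity)
    thus ?thesis by (simp add: g1_parity)
  qed (use simple z slope_nonzero in auto)
qed

lemma F_zero_iff: "F z = 0 \<longleftrightarrow> (\<exists>x. z = of_real x \<and> g x = 0)"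
  using zeros_real[of z] by (auto simp: F_of_real elim!: Reals_cases)

text \<open>The residue theorem for r(z) / (z - s) on the square: the pole at \<open>s\<close>
  contributes r(s), and every zero of \<open>g\<close> inside, being simple, contributes a Cauchy
  kernel.\<close>

lemma partial_fractions:
  assumes simple: "\<And>t. -1 < t \<Longrightarrow> t < 1 \<Longrightarrow> g t = 0 \<Longrightarrow> g1 t \<noteq> 0"
    and A: "A > 0" and nz: "\<And>z. z \<in> path_image (rectpath (Complex (-A) (-A)) (Complex A A)) \<Longrightarrow> F z \<noteq> 0"
    and s: "\<bar>s\<bar> < A" "g s \<noteq> 0"
  shows "of_real (M.g s) = of_real (g s * (\<Sum>x | \<bar>x\<bar> < A \<and> g x = 0. M.g x / g1 x / (s - x))) +
     of_real (g s) * (contour_integral (rectpath (Complex (-A) (-A)) (Complex A A)) (\<lambda>z. r z / (z - of_real s)) / (2 * pi * \<i>))"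
proof -
  define Rec where "Rec = rectpath (Complex (-A) (-A)) (Complex A A)"
  \<comment> \<open>A connected open neighbourhood of the square. The zeros between the square and
    the border of \<open>S\<close> also enter \<open>Z\<close>; they have winding number 0 and drop
    out below.\<close>
  define S where "S = box (Complex (-A-1) (-A-1)) (Complex (A+1) (A+1))"
  define Z where "Z = {x. \<bar>x\<bar> < A + 1 \<and> g x = 0}"
  define pts where "pts = of_real ` Z \<union> {complex_of_real s}"
  define f where "f = (\<lambda>z. M.F z / (F z * (z - of_real s)))"
  have finZ: "finite Z" by (rule finite_subset[OF _ finite_zeros[of "-A-1" "A+1"]]) (auto simp: Z_def)
  have fin: "finite pts" unfolding pts_def using finZ by simp
  have openS: "open S" unfolding S_def by (rule open_box)
  have Fz: "z \<in> pts" if "z \<in> S" "F z = 0" for z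
    using that by (auto simp: F_zero_iff pts_def Z_def S_def in_box_complex_iff)
  have holo: "f holomorphic_on S - pts"
    unfolding f_def using Fz by (intro holomorphic_intros F_holo M.F_holo) (auto simp: pts_def)
  have im: "path_image Rec \<subseteq> S - pts"
  proof
    fix z assume z: "z \<in> path_image Rec"
    have zc: "z \<in> cbox (Complex (-A) (-A)) (Complex A A)"
      using path_image_rectpath_subset_cbox[of "Complex (-A) (-A)" "Complex A A"] z A by (auto simp: Rec_def)
    have "F z \<noteq> 0" using nz z by (auto simp: Rec_def)
    moreover have "z \<noteq> of_real s"
      using z s A by (auto simp: Rec_def path_image_rectpath)
    ultimately show "z \<in> S - pts" using zc
      by (auto simp: pts_def Z_def S_def in_box_complex_iff in_cbox_complex_iff F_of_real)
  qed
  have "contour_integral Rec f = 2 * pi * \<i> * (\<Sum>p\<in>pts. winding_number Rec p * residue f p)"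
  proof (rule Residue_theorem[OF openS _ fin holo])
    show "connected S" unfolding S_def by (intro convex_connected convex_box)
    show "valid_path Rec" "pathfinish Rec = pathstart Rec" by (auto simp: Rec_def)
    show "path_image Rec \<subseteq> S - pts" by (rule im)
    show "\<forall>z. z \<notin> S \<longrightarrow> winding_number Rec z = 0"
      unfolding Rec_def using A by (auto intro!: winding_number_rectpath_outside simp: S_def in_box_complex_iff in_cbox_complex_iff)
  qed
  also have "(\<Sum>p\<in>pts. winding_number Rec p * residue f p) =
      winding_number Rec (of_real s) * residue f (of_real s) + (\<Sum>x\<in>Z. winding_number Rec (of_real x) * residue f (of_real x))"
  proof -
    have "complex_of_real s \<notin> of_real ` Z" using s by (auto simp: Z_def)
    moreover have "pts = insert (of_real s) (of_real ` Z)" by (auto simp: pts_def)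
    ultimately show ?thesis using finZ by (simp add: sum.reindex inj_on_def)
  qed
  also have "winding_number Rec (of_real s) = 1"
    unfolding Rec_def using s by (intro winding_number_rectpath) (auto simp: in_box_complex_iff)
  also have "residue f (of_real s) = r (of_real s)"
  proof -
    have "residue (\<lambda>w. r w / (w - of_real s)) (of_real s) = r (of_real s)"
    proof (rule residue_simple[where s = "S - of_real ` Z"])
      show "open (S - of_real ` Z)" using openS finZ by (intro open_Diff finite_imp_closed) auto
      show "of_real s \<in> S - of_real ` Z" using s A by (auto simp: S_def in_box_complex_iff Z_def)
      show "r holomorphic_on S - of_real ` Z" unfolding r_def[abs_def]
      proof (intro holomorphic_intros F_holo M.F_holo)
        fix z assume "z \<in> S - of_real ` Z"
        thus "F z \<noteq> 0" by (auto simp: F_zero_iff Z_def S_def in_box_complex_iff)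
      qed
    qed
    moreover have "(\<lambda>w. r w / (w - of_real s)) = f" by (simp add: f_def r_def fun_eq_iff)
    ultimately show ?thesis by simp
  qed
  also have "(\<Sum>x\<in>Z. winding_number Rec (of_real x) * residue f (of_real x)) = (\<Sum>x\<in>{x. \<bar>x\<bar> < A \<and> g x = 0}. winding_number Rec (of_real x) * residue f (of_real x))"
  proof (rule sum.mono_neutral_right[OF finZ])
    show "\<forall>x\<in>Z - {x. \<bar>x\<bar> < A \<and> g x = 0}. winding_number Rec (of_real x) * residue f (of_real x) = 0"
    proof
      fix x assume x: "x \<in> Z - {x. \<bar>x\<bar> < A \<and> g x = 0}"
      hence gx: "g x = 0" "\<bar>x\<bar> \<ge> A" by (auto simp: Z_def)
      have "\<bar>x\<bar> \<noteq> A"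
      proof
        assume "\<bar>x\<bar> = A"
        hence "of_real x \<in> path_image Rec" using A by (auto simp: Rec_def path_image_rectpath)
        thus False using nz[of "of_real x"] gx by (auto simp: Rec_def F_of_real)
      qed
      hence "winding_number Rec (of_real x) = 0" unfolding Rec_def using gx A
        by (intro winding_number_rectpath_outside) (auto simp: in_cbox_complex_iff)
      thus "winding_number Rec (of_real x) * residue f (of_real x) = 0" by simp
    qed
  qed (auto simp: Z_def)
  also have "\<dots> = (\<Sum>x\<in>{x. \<bar>x\<bar> < A \<and> g x = 0}. - of_real (M.g x / g1 x / (s - x)))"
  proof (rule sum.cong[OF refl])
    fix x assume "x \<in> {x. \<bar>x\<bar> < A \<and> g x = 0}"
    hence x: "\<bar>x\<bar> < A" "g x = 0" by auto
    have xs: "x \<noteq> s" using x s by auto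
    have g1x: "g1 x \<noteq> 0" by (rule slope_nonzero_everywhere[OF simple x(2)])
    have "winding_number Rec (of_real x) = 1"
      unfolding Rec_def using x by (intro winding_number_rectpath) (auto simp: in_box_complex_iff)
    moreover have "residue f (of_real x) = M.F (of_real x) / (deriv F (of_real x) * (of_real x - of_real s))"
    proof (rule residue_simple'[where s = "S - (pts - {of_real x})"])
      show "open (S - (pts - {of_real x}))" using openS fin by (intro open_Diff finite_imp_closed) auto
      show "of_real x \<in> S - (pts - {of_real x})" using x by (auto simp: S_def in_box_complex_iff)
      show "f holomorphic_on S - (pts - {of_real x}) - {of_real x}"
        by (rule holomorphic_on_subset[OF holo]) auto
      have 1: "((\<lambda>w. (F w - F (of_real x)) / (w - of_real x)) \<longlongrightarrow> deriv F (of_real x)) (at (of_real x))"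
        using dF[of "of_real x" UNIV] by (simp add: has_field_derivative_iff)
      have "(M.F \<longlongrightarrow> M.F (of_real x)) (at (of_real x))"
        using DERIV_isCont[OF M.dF[of "of_real x" UNIV]] by (simp add: isCont_def)
      hence "((\<lambda>w. M.F w / (((F w - F (of_real x)) / (w - of_real x)) * (w - of_real s))) \<longlongrightarrow> M.F (of_real x) / (deriv F (of_real x) * (of_real x - of_real s))) (at (of_real x))"
        using g1x xs by (intro tendsto_divide tendsto_mult 1 tendsto_intros) (auto simp: dF_of_real)
      moreover have "\<forall>\<^sub>F w in at (of_real x). M.F w / (((F w - F (of_real x)) / (w - of_real x)) * (w - of_real s)) = f w * (w - of_real x)"
        by (auto simp: eventually_at_filter f_def F_of_real x)
      ultimately show "((\<lambda>w. f w * (w - of_real x)) \<longlongrightarrow> M.F (of_real x) / (deriv F (of_real x) * (of_real x - of_real s))) (at (of_real x))"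
        by (rule Lim_transform_eventually)
    qed
    moreover have "M.F (of_real x) / (deriv F (of_real x) * (of_real x - of_real s)) = - of_real (M.g x / g1 x / (s - x))"
    proof -
      have "M.F (of_real x) / (deriv F (of_real x) * (of_real x - of_real s)) = of_real (M.g x / (g1 x * (x - s)))"
        by (simp add: M.F_of_real dF_of_real)
      also have "M.g x / (g1 x * (x - s)) = - (M.g x / g1 x / (s - x))"
        by (simp add: minus_divide_right mult_minus_right[symmetric] del: mult_minus_right)
      finally show ?thesis by simp
    qed
    ultimately show "winding_number Rec (of_real x) * residue f (of_real x) = - of_real (M.g x / g1 x / (s - x))" by simp
  qed
  finally have eq: "contour_integral Rec f = 2 * pi * \<i> * (r (of_real s) - of_real (\<Sum>x | \<bar>x\<bar> < A \<and> g x = 0. M.g x / g1 x / (s - x)))"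
    by (simp add: sum_negf)
  have "(\<lambda>z. r z / (z - of_real s)) = f" by (simp add: f_def r_def fun_eq_iff)
  hence "contour_integral Rec (\<lambda>z. r z / (z - of_real s)) / (2 * pi * \<i>) = r (of_real s) - of_real (\<Sum>x | \<bar>x\<bar> < A \<and> g x = 0. M.g x / g1 x / (s - x))"
    using eq by simp
  moreover have "of_real (g s) * r (of_real s) = of_real (M.g s)" using s by (simp add: r_def F_of_real M.F_of_real)
  ultimately show ?thesis unfolding Rec_def by (simp add: right_diff_distrib)
qed

text \<open>The singularity at a zero is removable, with value \<open>g1 t\<close>. The quotient
  itself takes the value 0 there by convention, which changes a single point.\<close>

lemma cauchy_quotient_integrable:
  assumes "g t = 0" shows "(\<lambda>s. g s / (s - t)) integrable_on {-1..1}"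
proof -
  define h where "h = (\<lambda>s. if s = t then g1 t else (g s - g t) / (s - t))"
  have "isCont h x" for x
  proof (cases "x = t")
    case True
    have "((\<lambda>s. (g s - g t) / (s - t)) \<longlongrightarrow> g1 t) (at t)"
      using g_deriv[of t UNIV] by (simp add: has_field_derivative_iff)
    hence "(h \<longlongrightarrow> g1 t) (at t)"
      by (rule Lim_transform_eventually) (auto simp: h_def eventually_at_filter)
    thus ?thesis unfolding isCont_def True by (simp add: h_def)
  next
    case False
    have "isCont (\<lambda>s. (g s - g t) / (s - t)) x"
      using False by (intro continuous_intros DERIV_isCont[OF g_deriv]) auto
    moreover have "\<forall>\<^sub>F s in nhds x. (g s - g t) / (s - t) = h s"
      using t1_space_nhds[OF False] by eventually_elim (simp add: h_def)
    ultimately show ?thesis using isCont_cong by fastforce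
  qed
  hence "continuous_on {-1..1} h" by (simp add: continuous_at_imp_continuous_on)
  hence "h integrable_on {-1..1}" by (rule integrable_continuous_real)
  thus ?thesis by (rule integrable_spike_finite[of "{t}", rotated 2]) (auto simp: h_def assms)
qed

text \<open>Integrating the partial fractions over [-1,1] turns the inner zeros into the quadrature
  sum exactly. The outer zeros and the contour term remain.\<close>

lemma error_bound_box:
  assumes simple: "\<And>t. -1 < t \<Longrightarrow> t < 1 \<Longrightarrow> g t = 0 \<Longrightarrow> g1 t \<noteq> 0"
    and A: "A > 2" and nz: "\<And>z. z \<in> path_image (rectpath (Complex (-A) (-A)) (Complex A A)) \<Longrightarrow> F z \<noteq> 0"
    and R: "\<And>z. z \<in> path_image (rectpath (Complex (-A) (-A)) (Complex A A)) \<Longrightarrow> cmod (r z) \<le> R" and R0: "0 \<le> R"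
  shows "\<bar>integral {-1..1} M.g - (\<Sum>t | -1 < t \<and> t < 1 \<and> g t = 0. M.g t * (integral {-1..1} (\<lambda>s. g s / (s - t)) / g1 t))\<bar>
     \<le> (\<Sum>x | 1 < \<bar>x\<bar> \<and> \<bar>x\<bar> < A \<and> g x = 0. \<bar>M.g x / g1 x\<bar> * \<bar>integral {-1..1} (\<lambda>s. g s / (x - s))\<bar>)
       + 4 / pi * R * (cmod \<mu> * \<bar>g 0\<bar>) + 8 / pi * R / A * integral {-1..1} (\<lambda>s. \<bar>g s\<bar>)"
proof -
  define Rec where "Rec = rectpath (Complex (-A) (-A)) (Complex A A)"
  define R1 where "R1 = {t. -1 < t \<and> t < 1 \<and> g t = 0}"
  define R2 where "R2 = {x. 1 < \<bar>x\<bar> \<and> \<bar>x\<bar> < A \<and> g x = 0}"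
  define cx where "cx = (\<lambda>x. M.g x / g1 x)"
  have g1nz: "g 1 \<noteq> 0" "g (-1) \<noteq> 0" using g_one_nz by (auto simp: g_minus_one)
  have split: "{x. \<bar>x\<bar> < A \<and> g x = 0} = R1 \<union> R2" "R1 \<inter> R2 = {}"
  proof -
    have ne: "\<bar>x\<bar> \<noteq> 1" if "g x = 0" for x using that g1nz by (auto simp: abs_if split: if_splits)
    show "{x. \<bar>x\<bar> < A \<and> g x = 0} = R1 \<union> R2"
    proof (intro set_eqI iffI)
      fix x assume "x \<in> {x. \<bar>x\<bar> < A \<and> g x = 0}"
      thus "x \<in> R1 \<union> R2" using ne[of x] unfolding R1_def R2_def by (cases "\<bar>x\<bar> < 1") auto
    qed (use A in \<open>auto simp: R1_def R2_def\<close>)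
    show "R1 \<inter> R2 = {}" by (auto simp: R1_def R2_def)
  qed
  have fin: "finite R1" "finite R2"
    by (rule finite_subset[OF _ finite_zeros[of "-A" "A"]]; use A in \<open>auto simp: R1_def R2_def\<close>)+
  define D where "D = (\<lambda>s. M.g s - ((\<Sum>x\<in>R1. cx x * (g s / (s - x))) + (\<Sum>x\<in>R2. cx x * (g s / (s - x)))))"
  define Bc where "Bc = (\<lambda>s::real. contour_integral Rec (\<lambda>z. r z / (z - of_real s)) / (2 * pi * \<i>))"
  define b0 where "b0 = Re (Bc 0)"
  have imA: "cmod z \<ge> A \<and> z \<noteq> 0" if "z \<in> path_image Rec" for z
  proof -
    have "\<bar>Re z\<bar> = A \<or> \<bar>Im z\<bar> = A" using that A by (auto simp: Rec_def path_image_rectpath)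
    thus ?thesis using abs_Re_le_cmod[of z] abs_Im_le_cmod[of z] A by auto
  qed
  have rcont: "continuous_on (path_image Rec) r"
    unfolding r_def[abs_def] using nz unfolding Rec_def[symmetric]
    by (intro continuous_intros holomorphic_on_imp_continuous_on[OF F_holo] holomorphic_on_imp_continuous_on[OF M.F_holo]) auto
  have dist: "cmod (z - of_real s) \<ge> A / 2" "z - of_real s \<noteq> 0" if "z \<in> path_image Rec" "\<bar>s\<bar> \<le> 1" for z s
  proof -
    have "cmod z \<le> cmod (z - of_real s) + cmod (of_real s :: complex)" by (metis diff_add_cancel norm_triangle_ineq)
    thus "cmod (z - of_real s) \<ge> A / 2" using imA[OF that(1)] that(2) A by simp
    thus "z - of_real s \<noteq> 0" using A by auto
  qed
  have len: "2 * (Re (Complex A A) - Re (Complex (-A) (-A))) + 2 * (Im (Complex A A) - Im (Complex (-A) (-A))) = 8 * A" by simp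
  have b0: "\<bar>b0\<bar> \<le> 4 / pi * R"
  proof -
    have "cmod (contour_integral Rec (\<lambda>z. r z / (z - of_real 0))) \<le> R / A * (8 * A)"
      unfolding Rec_def len[symmetric]
    proof (rule contour_integral_rectpath_bound)
      show "continuous_on (path_image (rectpath (Complex (-A) (-A)) (Complex A A))) (\<lambda>z. r z / (z - of_real 0))"
        unfolding Rec_def[symmetric] using imA by (intro continuous_intros rcont) auto
      fix z assume z: "z \<in> path_image (rectpath (Complex (-A) (-A)) (Complex A A))"
      have "cmod (r z) / cmod z \<le> R / A" using R[OF z] imA[of z] z A R0 unfolding Rec_def by (intro frac_le) auto
      thus "cmod (r z / (z - of_real 0)) \<le> R / A" by (simp add: norm_divide)
    qed (use A R0 in auto)
    hence "cmod (Bc 0) \<le> R / A * (8 * A) / (2 * pi)"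
      unfolding Bc_def norm_divide norm_mult by (simp add: divide_right_mono)
    also have "\<dots> = 4 / pi * R" using A by simp
    finally show ?thesis unfolding b0_def using abs_Re_le_cmod order_trans by blast
  qed
  \<comment> \<open>The quotient \<open>r\<close> is bounded but need not decay, so the contour term
    does not disappear; only its dependence on \<open>s\<close> does, since 1/(z - s) - 1/z is
    O(1/A^2) against a perimeter of 8 A.\<close>
  have Bdiff: "cmod (Bc s - Bc 0) \<le> 8 / pi * R / A" if s: "\<bar>s\<bar> \<le> 1" for s
  proof -
    have int: "(\<lambda>z. r z / (z - of_real s)) contour_integrable_on Rec" if "\<bar>s\<bar> \<le> 1" for s
      unfolding Rec_def using dist(2)[OF _ that] unfolding Rec_def
      by (intro contour_integrable_rectpath continuous_intros rcont[unfolded Rec_def]) auto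
    have "Bc s - Bc 0 = contour_integral Rec (\<lambda>z. r z / (z - of_real s) - r z / (z - of_real 0)) / (2 * pi * \<i>)"
      unfolding Bc_def using contour_integral_diff[OF int[OF s] int[of 0]] by (simp add: diff_divide_distrib)
    also have "cmod \<dots> \<le> (2 * R / A\<^sup>2) * (8 * A) / (2 * pi)"
    proof -
      have "cmod (contour_integral Rec (\<lambda>z. r z / (z - of_real s) - r z / (z - of_real 0))) \<le> (2 * R / A\<^sup>2) * (8 * A)"
        unfolding Rec_def len[symmetric]
      proof (rule contour_integral_rectpath_bound)
        show "continuous_on (path_image (rectpath (Complex (-A) (-A)) (Complex A A))) (\<lambda>z. r z / (z - of_real s) - r z / (z - of_real 0))"
          unfolding Rec_def[symmetric] using imA dist(2)[OF _ s] by (intro continuous_intros rcont) auto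
        fix z assume z: "z \<in> path_image (rectpath (Complex (-A) (-A)) (Complex A A))"
        note z' = z[folded Rec_def]
        have "r z / (z - of_real s) - r z / (z - of_real 0) = r z * of_real s / ((z - of_real s) * z)"
          using imA[OF z'] dist(2)[OF z' s] by (simp add: field_simps)
        also have "cmod \<dots> = cmod (r z) * \<bar>s\<bar> / (cmod (z - of_real s) * cmod z)" by (simp add: norm_divide norm_mult)
        also have "\<dots> \<le> R * 1 / (A / 2 * A)"
          using R[OF z] s imA[OF z'] dist(1)[OF z' s] A R0 by (intro frac_le mult_mono) auto
        also have "\<dots> = 2 * R / A\<^sup>2" by (simp add: power2_eq_square)
        finally show "cmod (r z / (z - of_real s) - r z / (z - of_real 0)) \<le> 2 * R / A\<^sup>2" .
      qed (use A R0 in auto)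
      moreover have "cmod (complex_of_real (2 * pi) * \<i>) = 2 * pi" by (simp add: norm_mult)
      ultimately show ?thesis unfolding norm_divide by (simp only:) (rule divide_right_mono, auto)
    qed
    also have "\<dots> = 8 / pi * R / A" using A by (simp add: power2_eq_square)
    finally show ?thesis .
  qed
  have Dint: "D integrable_on {-1..1}"
    "integral {-1..1} D = integral {-1..1} M.g - ((\<Sum>x\<in>R1. cx x * integral {-1..1} (\<lambda>s. g s / (s - x))) + (\<Sum>x\<in>R2. cx x * integral {-1..1} (\<lambda>s. g s / (s - x))))"
  proof -
    have i: "((\<lambda>s. \<Sum>x\<in>S. cx x * (g s / (s - x))) has_integral (\<Sum>x\<in>S. cx x * integral {-1..1} (\<lambda>s. g s / (s - x)))) {-1..1}"
      if "finite S" "\<And>x. x \<in> S \<Longrightarrow> g x = 0" for S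
      using that by (intro has_integral_sum has_integral_mult_right integrable_integral cauchy_quotient_integrable) auto
    have "(M.g has_integral integral {-1..1} M.g) {-1..1}"
      by (intro integrable_integral integrable_continuous_real M.cont_g)
    note hM = this
    have z: "\<And>x. x \<in> R1 \<Longrightarrow> g x = 0" "\<And>x. x \<in> R2 \<Longrightarrow> g x = 0" by (auto simp: R1_def R2_def)
    from has_integral_diff[OF hM has_integral_add[OF i[OF fin(1) z(1)] i[OF fin(2) z(2)]]]
    have hi: "(D has_integral (integral {-1..1} M.g - ((\<Sum>x\<in>R1. cx x * integral {-1..1} (\<lambda>s. g s / (s - x))) + (\<Sum>x\<in>R2. cx x * integral {-1..1} (\<lambda>s. g s / (s - x)))))) {-1..1}"
      unfolding D_def .
    show "D integrable_on {-1..1}" using hi by blast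
    show "integral {-1..1} D = integral {-1..1} M.g - ((\<Sum>x\<in>R1. cx x * integral {-1..1} (\<lambda>s. g s / (s - x))) + (\<Sum>x\<in>R2. cx x * integral {-1..1} (\<lambda>s. g s / (s - x))))"
      using hi by (rule integral_unique)
  qed
  have Dpt: "\<bar>D s - b0 * g s\<bar> \<le> 8 / pi * R / A * \<bar>g s\<bar>" if s: "s \<in> {-1..1} - R1" for s
  proof -
    have gs: "g s \<noteq> 0"
    proof
      assume "g s = 0"
      moreover have "s \<noteq> 1" "s \<noteq> -1" using \<open>g s = 0\<close> g1nz by auto
      ultimately show False using s by (auto simp: R1_def)
    qed
    have sA: "\<bar>s\<bar> < A" "\<bar>s\<bar> \<le> 1" using s A by auto
    have sm: "g s * (\<Sum>x | \<bar>x\<bar> < A \<and> g x = 0. M.g x / g1 x / (s - x)) = (\<Sum>x\<in>R1. cx x * (g s / (s - x))) + (\<Sum>x\<in>R2. cx x * (g s / (s - x)))"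
      unfolding split(1) by (subst sum.union_disjoint[OF fin split(2)]) (simp add: cx_def sum_distrib_left distrib_left mult_ac)
    have "A > 0" using A by simp
    from partial_fractions[OF simple this nz sA(1) gs]
    have "of_real (M.g s) = of_real (g s * (\<Sum>x | \<bar>x\<bar> < A \<and> g x = 0. M.g x / g1 x / (s - x))) + of_real (g s) * Bc s"
      unfolding Bc_def Rec_def by blast
    hence "of_real (D s) = of_real (g s) * Bc s" unfolding D_def sm of_real_diff by simp
    hence "of_real (D s) - of_real (g s) * Bc 0 = of_real (g s) * (Bc s - Bc 0)" by (simp add: right_diff_distrib)
    moreover have "D s - b0 * g s = Re (of_real (D s) - of_real (g s) * Bc 0)" by (simp add: b0_def)
    ultimately have "\<bar>D s - b0 * g s\<bar> \<le> cmod (of_real (g s) * (Bc s - Bc 0))" using abs_Re_le_cmod by metis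
    also have "\<dots> = \<bar>g s\<bar> * cmod (Bc s - Bc 0)" by (simp add: norm_mult)
    also have "\<dots> \<le> \<bar>g s\<bar> * (8 / pi * R / A)" by (intro mult_left_mono Bdiff sA) auto
    finally show ?thesis by (simp add: mult.commute)
  qed
  have I1: "\<bar>integral {-1..1} D - b0 * integral {-1..1} g\<bar> \<le> 8 / pi * R / A * integral {-1..1} (\<lambda>s. \<bar>g s\<bar>)"
  proof -
    \<comment> \<open>At the inner zeros the identity, obtained where \<open>g s\<close> is nonzero,
      says nothing; finitely many points do not affect the integral.\<close>
    define h where "h = (\<lambda>s. if s \<in> R1 then 0 else D s - b0 * g s)"
    have gi: "g integrable_on {-1..1}" by (intro integrable_continuous_real cont_g)
    have "((\<lambda>s. D s - b0 * g s) has_integral integral {-1..1} D - b0 * integral {-1..1} g) {-1..1}"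
      using Dint(1) gi by (intro has_integral_diff has_integral_mult_right integrable_integral)
    hence hi: "(h has_integral integral {-1..1} D - b0 * integral {-1..1} g) {-1..1}"
      by (rule has_integral_spike_finite[OF fin(1), rotated]) (auto simp: h_def)
    hence "\<bar>integral {-1..1} D - b0 * integral {-1..1} g\<bar> = norm (integral {-1..1} h)" by (simp add: integral_unique)
    also have "\<dots> \<le> integral {-1..1} (\<lambda>s. 8 / pi * R / A * \<bar>g s\<bar>)"
    proof (rule integral_norm_bound_integral)
      show "h integrable_on {-1..1}" using hi by blast
      show "(\<lambda>s. 8 / pi * R / A * \<bar>g s\<bar>) integrable_on {-1..1}" by (intro integrable_continuous_real continuous_intros cont_g)
      fix s :: real assume "s \<in> {-1..1}"
      thus "norm (h s) \<le> 8 / pi * R / A * \<bar>g s\<bar>" using Dpt[of s] R0 A by (auto simp: h_def)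
    qed
    also have "\<dots> = 8 / pi * R / A * integral {-1..1} (\<lambda>s. \<bar>g s\<bar>)" by (rule Henstock_Kurzweil_Integration.integral_mult_right)
    finally show ?thesis .
  qed
  have I2: "\<bar>integral {-1..1} g\<bar> = cmod \<mu> * \<bar>g 0\<bar>" using J_zero(1) by (simp add: J_def)
  have S2: "\<bar>\<Sum>x\<in>R2. cx x * integral {-1..1} (\<lambda>s. g s / (s - x))\<bar> \<le> (\<Sum>x\<in>R2. \<bar>cx x\<bar> * \<bar>integral {-1..1} (\<lambda>s. g s / (x - s))\<bar>)"
  proof -
    have "integral {-1..1} (\<lambda>s. g s / (s - x)) = - integral {-1..1} (\<lambda>s. g s / (x - s))" for x
    proof -
      have "(\<lambda>s. g s / (s - x)) = (\<lambda>s. - (g s / (x - s)))" by (simp add: fun_eq_iff minus_divide_right)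
      thus ?thesis by (simp only: integral_neg)
    qed
    thus ?thesis by (intro order_trans[OF sum_abs]) (simp add: abs_mult)
  qed
  have S1: "(\<Sum>t\<in>R1. M.g t * (integral {-1..1} (\<lambda>s. g s / (s - t)) / g1 t)) = (\<Sum>x\<in>R1. cx x * integral {-1..1} (\<lambda>s. g s / (s - x)))"
    by (simp add: cx_def)
  have "\<bar>b0 * integral {-1..1} g\<bar> \<le> 4 / pi * R * (cmod \<mu> * \<bar>g 0\<bar>)"
    unfolding abs_mult I2 by (intro mult_right_mono b0) auto
  thus ?thesis using I1 S2 Dint(2) S1 unfolding R1_def[symmetric] R2_def[symmetric] cx_def by linarith
qed

end

section \<open>Squares on which the quotient stays bounded\<close>

lemma cmod_exp_pair_le:
  "cmod (exp (\<i> * (of_real c * z)) - (-1)^n * exp (- (\<i> * (of_real c * z)))) \<le> exp (c * \<bar>Im z\<bar>) + exp (- (c * \<bar>Im z\<bar>))"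
proof -
  have "cmod (exp (\<i> * (of_real c * z)) - (-1)^n * exp (- (\<i> * (of_real c * z)))) \<le> exp (- (c * Im z)) + exp (c * Im z)"
    by (rule order_trans[OF norm_triangle_ineq4]) (simp add: norm_mult norm_power)
  thus ?thesis by (cases "Im z \<ge> 0") auto
qed

lemma cmod_exp_pair_ge:
  "exp (c * \<bar>Im z\<bar>) - exp (- (c * \<bar>Im z\<bar>)) \<le> cmod (exp (\<i> * (of_real c * z)) - (-1)^n * exp (- (\<i> * (of_real c * z))))"
proof -
  have "\<bar>exp (- (c * Im z)) - exp (c * Im z)\<bar> \<le> cmod (exp (\<i> * (of_real c * z)) - (-1)^n * exp (- (\<i> * (of_real c * z))))"
    by (rule order_trans[OF _ norm_triangle_ineq3]) (simp add: norm_mult norm_power)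
  thus ?thesis by (cases "Im z \<ge> 0") auto
qed

text \<open>The phase condition aligns the two exponentials, so their moduli add up and no
  cancellation occurs on the vertical line.\<close>

lemma cmod_exp_pair_eq:
  assumes "(-1)^n * exp (2 * (\<i> * of_real (c * Re z))) = (-1::complex)"
  shows "cmod (exp (\<i> * (of_real c * z)) - (-1)^n * exp (- (\<i> * (of_real c * z)))) = exp (c * \<bar>Im z\<bar>) + exp (- (c * \<bar>Im z\<bar>))"
proof -
  define u where "u = exp (\<i> * of_real (c * Re z))"
  have u: "u * exp (- (\<i> * of_real (c * Re z))) = 1" unfolding u_def by (simp flip: exp_add)
  have "(-1)^n * (u * u) = -1" using assms unfolding u_def by (simp flip: exp_add)
  hence s: "(-1)^n * exp (- (\<i> * of_real (c * Re z))) = - u"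
  proof -
    assume a: "(-1)^n * (u * u) = -1"
    have sq: "(-1)^n * (-1)^n = (1::complex)" by (simp flip: power_mult_distrib)
    have "u * u = - ((-1)^n)" using arg_cong[OF a, of "\<lambda>w. (-1)^n * w"] sq by (simp flip: mult.assoc)
    hence "u * u * exp (- (\<i> * of_real (c * Re z))) = - ((-1)^n) * exp (- (\<i> * of_real (c * Re z)))" by simp
    thus ?thesis using u by (simp add: mult.assoc)
  qed
  have z: "\<i> * (of_real c * z) = \<i> * of_real (c * Re z) + of_real (- (c * Im z))"
    by (simp add: complex_eq_iff)
  have e1: "exp (\<i> * (of_real c * z)) = u * of_real (exp (- (c * Im z)))"
    unfolding z exp_add u_def by (simp only: exp_of_real)
  have z2: "- (\<i> * (of_real c * z)) = - (\<i> * of_real (c * Re z)) + of_real (c * Im z)"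
    by (simp add: complex_eq_iff)
  have e2: "exp (- (\<i> * (of_real c * z))) = exp (- (\<i> * of_real (c * Re z))) * of_real (exp (c * Im z))"
    unfolding z2 exp_add by (simp only: exp_of_real)
  have "exp (\<i> * (of_real c * z)) - (-1)^n * exp (- (\<i> * (of_real c * z))) = u * of_real (exp (- (c * Im z)) + exp (c * Im z))"
  proof -
    have "(-1)^n * exp (- (\<i> * (of_real c * z))) = (-1)^n * exp (- (\<i> * of_real (c * Re z))) * of_real (exp (c * Im z))"
      unfolding e2 by (rule mult.assoc[symmetric])
    hence "(-1)^n * exp (- (\<i> * (of_real c * z))) = - u * of_real (exp (c * Im z))" unfolding s .
    thus ?thesis unfolding e1 by (simp add: distrib_left)
  qed
  also have "cmod \<dots> = exp (- (c * Im z)) + exp (c * Im z)"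
    unfolding norm_mult norm_of_real u_def by simp
  finally show ?thesis by (cases "Im z \<ge> 0") auto
qed

context prolate_pair begin

text \<open>The ratio of the leading amplitudes of the two functions at infinity.\<close>

definition rho :: real where "rho = cmod \<mu> * \<bar>M.g 1\<bar> / (cmod \<mu>' * \<bar>g 1\<bar>)"

lemma boxes_exist:
  assumes \<eta>: "\<eta> > 0"
  shows "\<exists>A>N. \<forall>z\<in>path_image (rectpath (Complex (-A) (-A)) (Complex A A)). F z \<noteq> 0 \<and> cmod (r z) \<le> 2 * rho + \<eta>"
proof -
  define Dn where "Dn = (\<lambda>z. exp (\<i> * (of_real c * z)) - (-1)^k * exp (- (\<i> * (of_real c * z))))"
  define Dm where "Dm = (\<lambda>z. exp (\<i> * (of_real c * z)) - (-1)^k' * exp (- (\<i> * (of_real c * z))))"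
  obtain K where K: "K \<ge> 0" "\<And>z. z \<noteq> 0 \<Longrightarrow> cmod (\<mu> * F z - of_real (g 1) * Dn z / (\<i> * (of_real c * z))) \<le> K * exp (c * \<bar>Im z\<bar>) / (cmod z)\<^sup>2"
    using F_asymp unfolding Dn_def by metis
  obtain K' where K': "K' \<ge> 0" "\<And>z. z \<noteq> 0 \<Longrightarrow> cmod (\<mu>' * M.F z - of_real (M.g 1) * Dm z / (\<i> * (of_real c * z))) \<le> K' * exp (c * \<bar>Im z\<bar>) / (cmod z)\<^sup>2"
    using M.F_asymp unfolding Dm_def by metis
  define a b where "a = \<bar>g 1\<bar>" and "b = \<bar>M.g 1\<bar>"
  have a: "a > 0" using g_one_nz by (simp add: a_def)
  have b: "b \<ge> 0" by (simp add: b_def)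
  have mu: "cmod \<mu> > 0" "cmod \<mu>' > 0" using mu_nz M.mu_nz by auto
  define \<eta>' where "\<eta>' = \<eta> * cmod \<mu>' / cmod \<mu>"
  have \<eta>': "\<eta>' > 0" using \<eta> mu by (simp add: \<eta>'_def)
  \<comment> \<open>The first bound keeps the denominator above 3/4 of \<open>a\<close>, the second
    keeps the excess of the quotient below \<open>\<eta>'\<close>; the factor 2 in front of
    \<open>rho\<close> is 3/2 divided by 3/4.\<close>
  define \<epsilon> where "\<epsilon> = min (a / 4) (3 / 4 * a * \<eta>')"
  have eps: "\<epsilon> > 0" "\<epsilon> \<le> a / 4" "\<epsilon> \<le> 3 / 4 * a * \<eta>'" using a \<eta>' by (auto simp: \<epsilon>_def)
  define K0 where "K0 = 2 * (K + K') * c"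
  have K0: "K0 \<ge> 0" using K(1) K'(1) c_pos by (simp add: K0_def)
  define N' where "N' = Max {N, 2 / c, K0 / \<epsilon>, 1}"
  obtain j :: nat where j: "real j > N' * c / pi" using reals_Archimedean2 by blast
  \<comment> \<open>The vertical sides pass through maxima of |sin (c x)| for even \<open>k\<close>
    and of |cos (c x)| for odd \<open>k\<close>.\<close>
  define A where "A = (real j * pi + (if even k then pi / 2 else 0)) / c"
  have "N' < A"
  proof -
    have "N' * c < real j * pi" using j by (simp add: pos_divide_less_eq)
    also have "\<dots> \<le> real j * pi + (if even k then pi / 2 else 0)" using pi_ge_zero by auto
    finally show ?thesis using c_pos by (simp add: A_def pos_less_divide_eq)
  qed
  moreover have "N \<le> N'" "2 / c \<le> N'" "K0 / \<epsilon> \<le> N'" "1 \<le> N'" unfolding N'_def by (auto intro!: Max_ge)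
  ultimately have A: "N < A" "2 / c < A" "K0 / \<epsilon> < A" "1 < A" by linarith+
  have cA: "c * A > 2" using A(2) c_pos by (simp add: field_simps)
  have KA: "K0 / A \<le> \<epsilon>" using A(3,4) eps(1) by (simp add: field_simps)
  have phase0: "(-1)^k * exp (2 * (\<i> * of_real (c * A))) = (-1::complex)"
  proof -
    have e: "c * A = real j * pi + (if even k then pi / 2 else 0)" using c_pos by (simp add: A_def)
    have "exp (2 * (\<i> * of_real (c * A))) = exp (of_real (2 * real j * pi) * \<i>) * exp (of_real (2 * (if even k then pi / 2 else 0)) * \<i>)"
      unfolding e exp_add[symmetric] by (rule arg_cong[of _ _ exp]) (simp add: algebra_simps)
    also have "exp (of_real (2 * real j * pi) * \<i>) = 1"
      using exp_integer_2pi[of "of_nat j"] by (simp add: mult_ac)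
    finally have E: "exp (2 * (\<i> * of_real (c * A))) = exp (of_real (2 * (if even k then pi / 2 else 0)) * \<i>)"
      by (simp only: mult_1_left)
    show ?thesis unfolding E by (cases "even k") (simp_all add: exp_pi_i)
  qed
  have phase1: "(-1)^k * exp (2 * (\<i> * of_real (c * - A))) = (-1::complex)"
    using arg_cong[OF phase0, of cnj] by (simp add: exp_cnj)
  have main: "F z \<noteq> 0 \<and> cmod (r z) \<le> 2 * rho + \<eta>" if z: "z \<in> path_image (rectpath (Complex (-A) (-A)) (Complex A A))" for z
  proof -
    define w where "w = exp (c * \<bar>Im z\<bar>)"
    have w: "w \<ge> 1" "exp (- (c * \<bar>Im z\<bar>)) = 1 / w" using c_pos by (auto simp: w_def exp_minus inverse_eq_divide)
    have zc: "\<bar>Re z\<bar> = A \<or> \<bar>Im z\<bar> = A" using z A by (auto simp: path_image_rectpath)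
    have zA: "cmod z \<ge> A" using zc abs_Re_le_cmod[of z] abs_Im_le_cmod[of z] by auto
    have z0: "z \<noteq> 0" "cmod z > 0" using zA A by auto
    \<comment> \<open>On the vertical sides |Dn| attains its maximum w + 1/w. On the horizontal ones
      w \<ge> 3, where (w + 1/w) / (w - 1/w) \<le> 5/4.\<close>
    have D: "w \<le> 2 * cmod (Dn z)" "cmod (Dm z) \<le> 3 / 2 * cmod (Dn z)"
    proof -
      have up: "cmod (Dm z) \<le> w + 1 / w" unfolding Dm_def using cmod_exp_pair_le[of c z k'] w by (simp add: w_def)
      have iw: "0 < 1 / w" "1 / w \<le> 1" using w(1) by auto
      have "w \<le> 2 * cmod (Dn z) \<and> cmod (Dm z) \<le> 3 / 2 * cmod (Dn z)"
      proof (cases "\<bar>Re z\<bar> = A")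
        case True
        hence "(-1)^k * exp (2 * (\<i> * of_real (c * Re z))) = (-1::complex)" using phase0 phase1 by (auto simp: abs_if split: if_splits)
        hence "cmod (Dn z) = w + 1 / w" unfolding Dn_def using cmod_exp_pair_eq[of k c z] w by (simp add: w_def)
        thus ?thesis using up iw w(1) by linarith
      next
        case False
        hence "\<bar>Im z\<bar> = A" using zc by simp
        hence "w \<ge> 1 + c * A" unfolding w_def using exp_ge_add_one_self[of "c * A"] by simp
        hence w3: "w \<ge> 3" using cA by simp
        hence "1 / w \<le> 1 / 3" by (intro divide_left_mono) auto
        moreover have "w - 1 / w \<le> cmod (Dn z)" unfolding Dn_def using cmod_exp_pair_ge[of c z k] w by (simp add: w_def)
        ultimately show ?thesis using up w3 by linarith
      qed
      thus "w \<le> 2 * cmod (Dn z)" "cmod (Dm z) \<le> 3 / 2 * cmod (Dn z)" by auto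
    qed
    define d where "d = cmod (Dn z)"
    have d: "d > 0" using D(1) w(1) unfolding d_def by linarith
    define h where "h = d / (c * cmod z)"
    have h: "h > 0" using d c_pos z0 by (simp add: h_def)
    have small: "Kx * w / (cmod z)\<^sup>2 \<le> h * \<epsilon>" if "0 \<le> Kx" "Kx \<le> K + K'" for Kx
    proof -
      have "Kx * w / (cmod z)\<^sup>2 \<le> (K + K') * (2 * d) / (cmod z)\<^sup>2"
        using that D(1) w(1) K(1) K'(1) by (intro divide_right_mono mult_mono) (auto simp: d_def)
      also have "\<dots> = h * (K0 / cmod z)" using c_pos z0 by (simp add: h_def K0_def power2_eq_square)
      also have "\<dots> \<le> h * (K0 / A)" using h K0 zA A by (intro mult_left_mono divide_left_mono mult_pos_pos) auto
      also have "\<dots> \<le> h * \<epsilon>" using h KA by (intro mult_left_mono) auto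
      finally show ?thesis .
    qed
    have nF: "h * (a - \<epsilon>) \<le> cmod (\<mu> * F z)"
    proof -
      have "cmod (of_real (g 1) * Dn z / (\<i> * (of_real c * z))) = h * a"
        using c_pos by (simp add: norm_divide norm_mult h_def d_def a_def)
      moreover have "cmod (\<mu> * F z - of_real (g 1) * Dn z / (\<i> * (of_real c * z))) \<le> h * \<epsilon>"
        using K(2)[OF z0(1)] small[of K] K(1) K'(1) unfolding w_def by (meson le_add_same_cancel1 order_trans)
      moreover have "cmod (of_real (g 1) * Dn z / (\<i> * (of_real c * z))) - cmod (\<mu> * F z) \<le> cmod (\<mu> * F z - of_real (g 1) * Dn z / (\<i> * (of_real c * z)))"
        using norm_triangle_ineq2[of "of_real (g 1) * Dn z / (\<i> * (of_real c * z))" "\<mu> * F z"] by (simp add: norm_minus_commute)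
      ultimately show ?thesis unfolding right_diff_distrib by linarith
    qed
    have nM: "cmod (\<mu>' * M.F z) \<le> h * (3 / 2 * b + \<epsilon>)"
    proof -
      have "cmod (of_real (M.g 1) * Dm z / (\<i> * (of_real c * z))) = b * cmod (Dm z) / (c * cmod z)"
        using c_pos by (simp add: norm_divide norm_mult b_def)
      also have "\<dots> \<le> b * (3 / 2 * d) / (c * cmod z)" using D(2) b c_pos z0 by (intro divide_right_mono mult_left_mono) (auto simp: d_def)
      also have "\<dots> = h * (3 / 2 * b)" by (simp add: h_def mult_ac)
      finally have "cmod (of_real (M.g 1) * Dm z / (\<i> * (of_real c * z))) \<le> h * (3 / 2 * b)" .
      moreover have "cmod (\<mu>' * M.F z - of_real (M.g 1) * Dm z / (\<i> * (of_real c * z))) \<le> h * \<epsilon>"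
        using K'(2)[OF z0(1)] small[of K'] K(1) K'(1) unfolding w_def by (meson le_add_same_cancel2 order_trans)
      moreover have "cmod (\<mu>' * M.F z) \<le> cmod (of_real (M.g 1) * Dm z / (\<i> * (of_real c * z))) + cmod (\<mu>' * M.F z - of_real (M.g 1) * Dm z / (\<i> * (of_real c * z)))"
        using norm_triangle_sub by blast
      ultimately show ?thesis unfolding distrib_left by linarith
    qed
    have ae: "a - \<epsilon> \<ge> 3 / 4 * a" using eps by linarith
    have Fpos: "cmod (\<mu> * F z) > 0"
    proof -
      have "0 < h * (a - \<epsilon>)" using h ae a by (intro mult_pos_pos) auto
      thus ?thesis using nF by linarith
    qed
    hence Fnz: "F z \<noteq> 0" by auto
    have rz: "cmod (r z) = (cmod \<mu> / cmod \<mu>') * (cmod (\<mu>' * M.F z) / cmod (\<mu> * F z))"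
      using mu by (simp add: r_def norm_divide norm_mult)
    have "cmod (\<mu>' * M.F z) / cmod (\<mu> * F z) \<le> (h * (3 / 2 * b + \<epsilon>)) / (h * (3 / 4 * a))"
    proof (rule frac_le)
      have "h * (3 / 4 * a) \<le> h * (a - \<epsilon>)" using ae h by (intro mult_left_mono) auto
      thus "h * (3 / 4 * a) \<le> cmod (\<mu> * F z)" using nF by linarith
    qed (use h a b eps nM in auto)
    also have "(h * (3 / 2 * b + \<epsilon>)) / (h * (3 / 4 * a)) = (3 / 2 * b + \<epsilon>) / (3 / 4 * a)" using h by simp
    also have "\<dots> \<le> (3 / 2 * b + 3 / 4 * a * \<eta>') / (3 / 4 * a)" using eps a by (intro divide_right_mono) auto
    also have "\<dots> = 2 * b / a + \<eta>'" using a by (simp add: field_simps)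
    finally have "cmod (r z) \<le> cmod \<mu> / cmod \<mu>' * (2 * b / a + \<eta>')" unfolding rz by (rule mult_left_mono) simp
    also have "\<dots> = 2 * rho + \<eta>" using mu by (simp add: rho_def \<eta>'_def a_def b_def distrib_left)
    finally show ?thesis using Fnz by simp
  qed
  show ?thesis using A(1) main by blast
qed

lemma error_bound_limit:
  assumes simple: "\<And>t. -1 < t \<Longrightarrow> t < 1 \<Longrightarrow> g t = 0 \<Longrightarrow> g1 t \<noteq> 0"
    and S: "\<And>A. (\<Sum>x | 1 < \<bar>x\<bar> \<and> \<bar>x\<bar> < A \<and> g x = 0. \<bar>M.g x / g1 x\<bar> * \<bar>integral {-1..1} (\<lambda>s. g s / (x - s))\<bar>) \<le> S"
  shows "\<bar>integral {-1..1} M.g - (\<Sum>t | -1 < t \<and> t < 1 \<and> g t = 0. M.g t * (integral {-1..1} (\<lambda>s. g s / (s - t)) / g1 t))\<bar>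
     \<le> S + 8 / pi * rho * (cmod \<mu> * \<bar>g 0\<bar>)"
proof (rule field_le_epsilon)
  fix e :: real assume e: "e > 0"
  define X where "X = cmod \<mu> * \<bar>g 0\<bar>"
  define Y where "Y = integral {-1..1} (\<lambda>s. \<bar>g s\<bar>)"
  have X: "X \<ge> 0" by (simp add: X_def)
  have Y: "Y \<ge> 0" unfolding Y_def by (intro integral_nonneg integrable_continuous_real continuous_intros cont_g) auto
  have rho: "rho \<ge> 0" by (simp add: rho_def)
  \<comment> \<open>Everything that is multiplied by \<open>\<eta>\<close>; the summand 1 keeps it
    positive. Taking A > 1 / \<eta> brings the last term of the box estimate under the same
    bound.\<close>
  define C where "C = 4 / pi * X + 8 / pi * (2 * rho + 1) * Y + 1"
  have C: "C > 0" using X Y rho by (simp add: C_def add_nonneg_pos)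
  define \<eta> where "\<eta> = min 1 (e / C)"
  have h: "\<eta> > 0" "\<eta> \<le> 1" "\<eta> * C \<le> e" using e C by (auto simp: \<eta>_def min_def field_simps)
  obtain A where A: "A > max 2 (1 / \<eta>)" and AR: "\<And>z. z \<in> path_image (rectpath (Complex (-A) (-A)) (Complex A A)) \<Longrightarrow> F z \<noteq> 0 \<and> cmod (r z) \<le> 2 * rho + \<eta>"
    using boxes_exist[OF h(1), of "max 2 (1 / \<eta>)"] by blast
  have A2: "A > 2" "1 / A \<le> \<eta>" using A h(1) by (auto simp: field_simps)
  let ?E = "\<bar>integral {-1..1} M.g - (\<Sum>t | -1 < t \<and> t < 1 \<and> g t = 0. M.g t * (integral {-1..1} (\<lambda>s. g s / (s - t)) / g1 t))\<bar>"
  have "?E \<le> (\<Sum>x | 1 < \<bar>x\<bar> \<and> \<bar>x\<bar> < A \<and> g x = 0. \<bar>M.g x / g1 x\<bar> * \<bar>integral {-1..1} (\<lambda>s. g s / (x - s))\<bar>)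
       + 4 / pi * (2 * rho + \<eta>) * X + 8 / pi * (2 * rho + \<eta>) / A * Y"
    unfolding X_def Y_def by (rule error_bound_box[OF simple A2(1)]) (use AR rho h in auto)
  also have "\<dots> \<le> S + 4 / pi * (2 * rho + \<eta>) * X + 8 / pi * (2 * rho + 1) * \<eta> * Y"
  proof (intro add_mono S order_refl mult_right_mono Y)
    have "8 / pi * (2 * rho + \<eta>) / A = 8 / pi * (2 * rho + \<eta>) * (1 / A)" by simp
    also have "\<dots> \<le> 8 / pi * (2 * rho + 1) * \<eta>" using h rho A2 by (intro mult_mono) auto
    finally show "8 / pi * (2 * rho + \<eta>) / A \<le> 8 / pi * (2 * rho + 1) * \<eta>" .
  qed
  also have "\<dots> = S + 8 / pi * rho * X + \<eta> * (4 / pi * X + 8 / pi * (2 * rho + 1) * Y)" by (simp add: algebra_simps)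
  also have "\<eta> * (4 / pi * X + 8 / pi * (2 * rho + 1) * Y) \<le> \<eta> * C" using h by (intro mult_left_mono) (auto simp: C_def)
  finally show "?E \<le> S + 8 / pi * rho * (cmod \<mu> * \<bar>g 0\<bar>) + e" using h(3) by (simp add: X_def)
qed

end

section \<open>Bounds for the outer terms\<close>

text \<open>The constants here and in the next two sums are pi / (2 sqrt 2) = 1.1107... and pi /
  sqrt 2 = 2.2214..., rounded down: the first position and the gaps of the outer zeros in the
  variable c x - sqrt ch.\<close>

lemma sum_inverse_spaced:
  fixes Z :: "real set"
  assumes "finite Z" "\<And>z. z \<in> Z \<Longrightarrow> 1.1 \<le> z \<and> z \<le> L" "\<And>z z'. z \<in> Z \<Longrightarrow> z' \<in> Z \<Longrightarrow> z < z' \<Longrightarrow> 2.2 \<le> z' - z" "1.1 \<le> L"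
  shows "(\<Sum>z\<in>Z. 1 / z) \<le> 10 / 11 + ln L / 2.2"
proof (cases "Z = {}")
  case True
  have "ln L \<ge> 0" using assms(4) by simp
  thus ?thesis using True by simp
next
  case False
  have "(\<Sum>z\<in>Z. 1 / z) \<le> 1 / 1.1 + (- ln 1.1 - - ln (Max Z)) / 2.2"
  proof (rule sum_by_spacing[where f = "\<lambda>z. 1 / z" and \<Psi> = "\<lambda>z. - ln z", OF assms(1) False _ assms(3)])
    fix u v :: real assume uv: "1.1 \<le> u" "u \<le> v"
    show "1 / v \<le> 1 / u" using uv by (intro divide_left_mono) auto
    have "ln (u / v) \<le> u / v - 1" using uv by (intro ln_le_minus_one) auto
    hence "ln u - ln v \<le> u / v - 1" using uv by (simp add: ln_div)
    moreover have "1 / v * (v - u) = 1 - u / v" using uv by (simp add: field_simps)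
    ultimately show "1 / v * (v - u) \<le> - ln u - - ln v" by linarith
  qed (use assms in auto)
  moreover have "ln (1.1::real) \<ge> 0" by simp
  moreover have "ln (Max Z) \<le> ln L"
  proof -
    have "Max Z \<in> Z" using assms(1) False by simp
    thus ?thesis using assms(2)[of "Max Z"] by simp
  qed
  moreover from calculation(2,3) have "(- ln 1.1 - - ln (Max Z)) / 2.2 \<le> ln L / 2.2" by (intro divide_right_mono) linarith+
  moreover have "\<alpha> \<le> \<beta>' + \<delta>'" if "\<alpha> \<le> \<beta> + \<gamma>" "\<gamma> \<le> \<delta>" "\<beta> = \<beta>'" "\<delta> = \<delta>'" for \<alpha> \<beta> \<gamma> \<delta> \<beta>' \<delta>' :: real using that by linarith
  moreover have "1 / 1.1 = (10 / 11 :: real)" by simp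
  ultimately show ?thesis by blast
qed

lemma sum_inverse_sqrt_spaced:
  fixes Z :: "real set"
  assumes "finite Z" "\<And>z. z \<in> Z \<Longrightarrow> 1.1 \<le> z" "\<And>z z'. z \<in> Z \<Longrightarrow> z' \<in> Z \<Longrightarrow> z < z' \<Longrightarrow> 2.2 \<le> z' - z"
  shows "(\<Sum>z\<in>Z. 1 / (z * sqrt z)) \<le> 1.734"
proof (cases "Z = {}")
  case False
  have "(\<Sum>z\<in>Z. 1 / (z * sqrt z)) \<le> 1 / (1.1 * sqrt 1.1) + (2 / sqrt 1.1 - 2 / sqrt (Max Z)) / 2.2"
  proof (rule sum_by_spacing[where f = "\<lambda>z. 1 / (z * sqrt z)" and \<Psi> = "\<lambda>z. 2 / sqrt z", OF assms(1) False _ assms(3)])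
    fix u v :: real assume uv: "1.1 \<le> u" "u \<le> v"
    show "1 / (v * sqrt v) \<le> 1 / (u * sqrt u)" using uv by (intro divide_left_mono mult_mono) auto
    define a b where "a = sqrt u" and "b = sqrt v"
    have ab: "a > 0" "a \<le> b" "b > 0" "u = a * a" "v = b * b" using uv by (auto simp: a_def b_def)
    have "a * a + a * b \<le> b * b + b * b" using ab by (intro add_mono mult_mono) auto
    hence "(b - a) * (a * a + a * b) \<le> (b - a) * (2 * (b * b))" using ab by (intro mult_left_mono) auto
    hence "(v - u) * a \<le> 2 * (b - a) * (b * b)" unfolding ab by (simp add: algebra_simps)
    hence "(v - u) * a / (a * (b * b * b)) \<le> 2 * (b - a) * (b * b) / (a * (b * b * b))" using ab by (intro divide_right_mono) auto
    moreover have "(v - u) * a / (a * (b * b * b)) = 1 / (v * sqrt v) * (v - u)" using ab by (simp add: b_def[symmetric])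
    moreover have "2 * (b - a) * (b * b) / (a * (b * b * b)) = 2 / a - 2 / b" using ab by (simp add: field_simps)
    ultimately show "1 / (v * sqrt v) * (v - u) \<le> 2 / sqrt u - 2 / sqrt v" by (simp add: a_def b_def)
  qed (use assms(2) in auto)
  also have "\<dots> \<le> 1 / (1.1 * sqrt 1.1) + (2 / sqrt 1.1) / 2.2"
  proof -
    have "Max Z \<in> Z" using assms(1) False by simp
    hence "Max Z \<ge> 1.1" by (rule assms(2))
    hence "2 / sqrt (Max Z) \<ge> 0" by simp
    thus ?thesis by (intro add_left_mono divide_right_mono) auto
  qed
  also have "\<dots> = 2 / 1.1 / sqrt 1.1" by simp
  also have "\<dots> \<le> 1.734"
  proof -
    have "1.0487 \<le> sqrt (1.1::real)" by (rule real_le_rsqrt) (simp add: power2_eq_square)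
    thus ?thesis by (simp add: divide_simps)
  qed
  finally show ?thesis .
qed simp

lemma sum_inverse_square_spaced:
  fixes Z :: "real set"
  assumes "finite Z" "\<And>z. z \<in> Z \<Longrightarrow> L \<le> z" "\<And>z z'. z \<in> Z \<Longrightarrow> z' \<in> Z \<Longrightarrow> z < z' \<Longrightarrow> 2.2 \<le> z' - z" "L > 0"
  shows "(\<Sum>z\<in>Z. 1 / z\<^sup>2) \<le> 1 / L\<^sup>2 + 1 / (2.2 * L)"
proof (cases "Z = {}")
  case False
  have "(\<Sum>z\<in>Z. 1 / z\<^sup>2) \<le> 1 / L\<^sup>2 + (1 / L - 1 / Max Z) / 2.2"
  proof (rule sum_by_spacing[where f = "\<lambda>z. 1 / z\<^sup>2" and \<Psi> = "\<lambda>z. 1 / z", OF assms(1) False _ assms(3)])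
    fix u v :: real assume uv: "L \<le> u" "u \<le> v"
    have u: "u > 0" "v > 0" using uv assms(4) by auto
    show "1 / v\<^sup>2 \<le> 1 / u\<^sup>2" using uv u by (intro divide_left_mono power_mono) auto
    have "(v - u) / (v * v) \<le> (v - u) / (u * v)" using uv u by (intro divide_left_mono mult_right_mono) auto
    moreover have "(v - u) / (u * v) = 1 / u - 1 / v" using u by (simp add: field_simps)
    ultimately show "1 / v\<^sup>2 * (v - u) \<le> 1 / u - 1 / v" by (simp add: power2_eq_square)
  qed (use assms in auto)
  moreover have "1 / Max Z \<ge> 0"
  proof -
    have "Max Z \<in> Z" using assms(1) False by simp
    hence "Max Z \<ge> L" by (rule assms(2))
    thus ?thesis using assms(4) by simp
  qed
  moreover from calculation(2) have "(1 / L - 1 / Max Z) / 2.2 \<le> 1 / L / 2.2" by (intro divide_right_mono) linarith+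
  moreover have "\<alpha> \<le> \<beta>' + \<delta>'" if "\<alpha> \<le> \<beta> + \<gamma>" "\<gamma> \<le> \<delta>" "\<beta> = \<beta>'" "\<delta> = \<delta>'" for \<alpha> \<beta> \<gamma> \<delta> \<beta>' \<delta>' :: real using that by linarith
  moreover have "1 / L / 2.2 = 1 / (2.2 * L)" by (simp add: mult.commute)
  ultimately show ?thesis by blast
qed (use assms in simp)

text \<open>1.285 is slightly larger than exp (1/4) = 1.2840..., the square root of the loss in
  \<open>E_lower\<close>.\<close>

lemma exp_quarter_bound: "1 / 1.285\<^sup>2 \<le> exp (- 1 / 2 :: real)"
proof -
  have "exp (1 / 2 :: real) \<le> 1.285\<^sup>2"
  proof (rule power2_le_imp_le)
    have "(exp (1 / 2 :: real))\<^sup>2 = exp 1" by (simp flip: exp_of_nat_mult exp_double)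
    also have "\<dots> \<le> (1.285\<^sup>2)\<^sup>2" using e_less_272 by (simp add: power2_eq_square)
    finally show "(exp (1 / 2 :: real))\<^sup>2 \<le> (1.285\<^sup>2)\<^sup>2" .
  qed simp
  hence "1 / 1.285\<^sup>2 \<le> 1 / exp (1 / 2 :: real)" by (intro divide_left_mono) auto
  thus ?thesis by (simp add: exp_minus inverse_eq_divide)
qed

context prolate_high begin

lemma outer_zero_params:
  assumes "1 < x" "g x = 0"
  shows "c * x - sqrt ch \<ge> 1.1" "c\<^sup>2 * x\<^sup>2 - ch = (c * x - sqrt ch) * (c * x - sqrt ch + 2 * sqrt ch)"
proof -
  have R: "sqrt ch * sqrt ch = ch" "sqrt ch > 0" using ch_pos by auto
  show "c\<^sup>2 * x\<^sup>2 - ch = (c * x - sqrt ch) * (c * x - sqrt ch + 2 * sqrt ch)"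
    using R by (simp add: power2_eq_square algebra_simps)
  have "ch < (c * a0)\<^sup>2" using above_a0(4)[of a0] za_props(1) by (simp add: power_mult_distrib)
  hence "sqrt ch \<le> c * a0" using c_pos a0_props by (intro real_le_lsqrt) auto
  moreover have "1.1 \<le> c * (x - a0)"
  proof -
    have "pi / 2 \<le> sqrt 2 * (c * (x - a0))" using first_outer_zero[of x] assms by (simp add: mult.assoc)
    moreover have "sqrt 2 \<le> (1.415::real)" by (rule real_le_lsqrt) (simp_all add: power2_eq_square)
    moreover have "0 \<le> c * (x - a0)" using zero_gt_a0[of x] assms c_pos by simp
    ultimately have "pi / 2 \<le> 1.415 * (c * (x - a0))" by (meson mult_right_mono order_trans)
    thus ?thesis using pi_approx(1) by simp
  qed
  ultimately show "c * x - sqrt ch \<ge> 1.1" by (simp add: right_diff_distrib)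
qed

lemma outer_zero_spacing':
  assumes "1 < x" "g x = 0" "x < y" "g y = 0"
  shows "2.2 \<le> (c * y - sqrt ch) - (c * x - sqrt ch)"
proof -
  have "pi \<le> sqrt 2 * (c * (y - x))" using outer_zero_spacing[of x y] assms by (simp add: mult.assoc)
  moreover have "sqrt 2 \<le> (1.415::real)" by (rule real_le_lsqrt) (simp_all add: power2_eq_square)
  moreover have "0 \<le> c * (y - x)" using assms c_pos by simp
  ultimately have "pi \<le> 1.415 * (c * (y - x))" by (meson mult_right_mono order_trans)
  thus ?thesis using pi_approx(1) by (simp add: right_diff_distrib)
qed

text \<open>By parity one of the two initial values vanishes. For even \<open>k\<close> the survivor
  comes with the factor c x, for odd \<open>k\<close> only with sqrt ch, so the odd case decays
  faster by one power of x.\<close>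

lemma stieltjes_bound':
  assumes x: "1 < x" "c\<^sup>2 * x\<^sup>2 > ch"
  shows "\<bar>integral {-1..1} (\<lambda>t. g t / (x - t))\<bar> \<le> cmod \<mu> * \<bar>g 1\<bar> * c * (if even k then c * x else sqrt ch) / (c\<^sup>2 * x\<^sup>2 - ch)"
proof -
  have b: "c * x * \<bar>g 0\<bar> + \<bar>g1 0\<bar> \<le> \<bar>g 1\<bar> * (if even k then c * x else sqrt ch)"
  proof (cases "even k")
    case True
    hence "g1 0 = 0" using g1_parity[of 0] by simp
    thus ?thesis using True g0_bounds(1) c_pos x by (simp add: mult_left_mono mult.commute)
  next
    case False
    hence "g 0 = 0" using g_parity[of 0] by simp
    moreover have "\<bar>g1 0\<bar> \<le> \<bar>g 1\<bar> * sqrt ch"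
    proof (rule power2_le_imp_le)
      show "\<bar>g1 0\<bar>\<^sup>2 \<le> (\<bar>g 1\<bar> * sqrt ch)\<^sup>2" using g0_bounds(2) ch_pos by (simp add: power_mult_distrib mult.commute)
    qed (use ch_pos in auto)
    ultimately show ?thesis using False by simp
  qed
  have "\<bar>integral {-1..1} (\<lambda>t. g t / (x - t))\<bar> \<le> cmod \<mu> * c * (c * x * \<bar>g 0\<bar> + \<bar>g1 0\<bar>) / (c\<^sup>2 * x\<^sup>2 - ch)"
    by (rule stieltjes_bound[OF x])
  also have "\<dots> \<le> cmod \<mu> * c * (\<bar>g 1\<bar> * (if even k then c * x else sqrt ch)) / (c\<^sup>2 * x\<^sup>2 - ch)"
    using b c_pos x by (intro divide_right_mono mult_left_mono) auto
  finally show ?thesis by (simp add: mult_ac)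
qed

lemma slope_lower:
  assumes "1 < x" "g x = 0"
  shows "2 * \<bar>g 1\<bar> * sqrt (c\<^sup>2 * x\<^sup>2 - ch) / (1.285 * c * cmod \<mu> * (x\<^sup>2 - 1)) \<le> \<bar>g1 x\<bar>"
proof (rule power2_le_imp_le)
  have a: "a0 \<le> x" using zero_gt_a0[of x] assms by simp
  note ab = above_a0[OF a]
  have q: "c\<^sup>2 * x\<^sup>2 - ch > 0" using ab(4) za_props(1) by linarith
  have "(2 * \<bar>g 1\<bar> * sqrt (c\<^sup>2 * x\<^sup>2 - ch) / (1.285 * c * cmod \<mu> * (x\<^sup>2 - 1)))\<^sup>2 =
     1 / 1.285\<^sup>2 * (4 * (g 1)\<^sup>2 / (c\<^sup>2 * (cmod \<mu>)\<^sup>2)) * (c\<^sup>2 * x\<^sup>2 - ch) / (x\<^sup>2 - 1)\<^sup>2"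
    using q by (simp add: power_mult_distrib power_divide)
  also have "\<dots> \<le> exp (- 1 / 2) * (4 * (g 1)\<^sup>2 / (c\<^sup>2 * (cmod \<mu>)\<^sup>2)) * (c\<^sup>2 * x\<^sup>2 - ch) / (x\<^sup>2 - 1)\<^sup>2"
    using q by (intro divide_right_mono mult_right_mono exp_quarter_bound) auto
  also have "\<dots> \<le> (g1 x)\<^sup>2" by (rule slope_at_zero[OF a assms(2)])
  finally show "(2 * \<bar>g 1\<bar> * sqrt (c\<^sup>2 * x\<^sup>2 - ch) / (1.285 * c * cmod \<mu> * (x\<^sup>2 - 1)))\<^sup>2 \<le> \<bar>g1 x\<bar>\<^sup>2" by simp
qed simp

end

context prolate_pair begin

definition tm :: "real \<Rightarrow> real" where "tm x = \<bar>M.g x / g1 x\<bar> * \<bar>integral {-1..1} (\<lambda>s. g s / (x - s))\<bar>"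

text \<open>The eigenvalues combine to |\<mu>|^2 / |\<mu>'|, of which one quotient is at most 1. The
  amplitude |g 1| cancels between slope and transform, and 0.6425 is half of 1.285.\<close>

lemma term_bound:
  assumes le: "cmod \<mu> \<le> cmod \<mu>'" and x: "1 < x" "g x = 0"
  shows "tm x \<le> 0.6425 * cmod \<mu> * M.B * (c * x * (if even k then c * x else sqrt ch) / ((c\<^sup>2 * x\<^sup>2 - ch) * sqrt (c\<^sup>2 * x\<^sup>2 - ch)))"
proof -
  define q H p where "q = c\<^sup>2 * x\<^sup>2 - ch" and "H = (if even k then c * x else sqrt ch)" and "p = x\<^sup>2 - 1"
  have a: "a0 \<le> x" using zero_gt_a0[of x] x by simp
  note ab = above_a0[OF a]
  have q: "q > 0" using ab(4) za_props(1) unfolding q_def by linarith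
  have p: "p > 0" "p \<le> x * x" using ab(3) by (auto simp: p_def power2_eq_square)
  have H: "H \<ge> 0" using c_pos x ch_pos by (simp add: H_def)
  have mu: "cmod \<mu> > 0" "cmod \<mu>' > 0" using mu_nz M.mu_nz by auto
  have g1: "\<bar>g 1\<bar> > 0" using g_one_nz by simp
  define X where "X = 2 * \<bar>g 1\<bar> * sqrt q / (1.285 * c * cmod \<mu> * p)"
  have X: "X > 0" "X \<le> \<bar>g1 x\<bar>" using slope_lower[OF x] q p mu g1 c_pos by (auto simp: X_def q_def p_def)
  have mg: "\<bar>M.g x\<bar> \<le> M.B / (c * x * cmod \<mu>')"
    using M.g_decay[of x] x mu c_pos by (simp add: field_simps)
  have "tm x = \<bar>M.g x\<bar> / \<bar>g1 x\<bar> * \<bar>integral {-1..1} (\<lambda>s. g s / (x - s))\<bar>" by (simp add: tm_def abs_divide)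
  also have "\<dots> \<le> (M.B / (c * x * cmod \<mu>')) / X * (cmod \<mu> * \<bar>g 1\<bar> * c * H / q)"
  proof (rule mult_mono)
    show "\<bar>M.g x\<bar> / \<bar>g1 x\<bar> \<le> (M.B / (c * x * cmod \<mu>')) / X" using mg X by (intro frac_le) auto
    show "\<bar>integral {-1..1} (\<lambda>s. g s / (x - s))\<bar> \<le> cmod \<mu> * \<bar>g 1\<bar> * c * H / q"
      using stieltjes_bound'[of x] x q unfolding q_def H_def by simp
  qed (use M.B_nonneg X c_pos x mu in auto)
  also have "\<dots> = 0.6425 * cmod \<mu> * M.B * (cmod \<mu> / cmod \<mu>') * (c * p * H / (x * (q * sqrt q)))"
    using mu g1 c_pos x q p by (simp add: X_def field_simps)
  also have "\<dots> \<le> 0.6425 * cmod \<mu> * M.B * 1 * (c * x * H / (q * sqrt q))"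
  proof (intro mult_mono mult_nonneg_nonneg)
    show "cmod \<mu> / cmod \<mu>' \<le> 1" using le mu by simp
    have "c * p * H / (x * (q * sqrt q)) \<le> c * (x * x) * H / (x * (q * sqrt q))"
      using p c_pos H q x by (intro divide_right_mono mult_right_mono mult_left_mono) auto
    also have "\<dots> = c * x * H / (q * sqrt q)" using x by simp
    finally show "c * p * H / (x * (q * sqrt q)) \<le> c * x * H / (q * sqrt q)" .
  qed (use M.B_nonneg H q p c_pos x in auto)
  finally show ?thesis by (simp add: q_def H_def)
qed

text \<open>At a zero of \<open>g\<close> the value of \<open>M.g\<close> equals the Wronskian
  divided by (x^2 - 1) \<open>g1\<close>, so the slope bound is used twice. The constant rounds up
  1.285^2 / 4 times sqrt 2, the last factor bounding 1 / |g 1|.\<close>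

lemma term_bound_tail:
  assumes le: "cmod \<mu> \<le> cmod \<mu>'" and par: "even k" "even k'" and ch'0: "0 \<le> ch'" and x: "1 < x" "g x = 0"
  shows "tm x \<le> 0.585 * cmod \<mu> * ch * B * M.B * (1 / (c * x - sqrt ch)\<^sup>2)"
proof -
  define q p s where "q = c\<^sup>2 * x\<^sup>2 - ch" and "p = x\<^sup>2 - 1" and "s = c * x - sqrt ch"
  have a: "a0 \<le> x" using zero_gt_a0[of x] x by simp
  note ab = above_a0[OF a]
  have q: "q > 0" using ab(4) za_props(1) unfolding q_def by linarith
  have p: "p > 0" "p \<le> x * x" using ab(3) by (auto simp: p_def power2_eq_square)
  have s: "s > 0" using outer_zero_params(1)[OF x] by (simp add: s_def)
  have mu: "cmod \<mu> > 0" "cmod \<mu>' > 0" using mu_nz M.mu_nz by auto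
  have g1: "\<bar>g 1\<bar> > 0" using g_one_nz by simp
  define X where "X = 2 * \<bar>g 1\<bar> * sqrt q / (1.285 * c * cmod \<mu> * p)"
  have X: "X > 0" "X \<le> \<bar>g1 x\<bar>" using slope_lower[OF x] q p mu g1 c_pos by (auto simp: X_def q_def p_def)
  have g1x: "\<bar>g1 x\<bar> > 0" using X by linarith
  define W where "W = (ch - ch') * B * M.B / (c\<^sup>2 * cmod \<mu> * cmod \<mu>') / x"
  have W: "\<bar>Wr x\<bar> \<le> W" unfolding W_def using par x by (intro Wr_bound) auto
  have Wr: "\<bar>Wr x\<bar> = p * \<bar>g1 x\<bar> * \<bar>M.g x\<bar>" using x p unfolding Wr_def p_def[symmetric] by (simp add: abs_mult)
  have "\<bar>M.g x\<bar> / \<bar>g1 x\<bar> = \<bar>Wr x\<bar> / (p * \<bar>g1 x\<bar>\<^sup>2)"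
  proof -
    have "m / G = p * G * m / (p * G\<^sup>2)" if "G > 0" for m G :: real using p that by (simp add: power2_eq_square)
    thus ?thesis unfolding Wr using g1x by blast
  qed
  also have "\<dots> \<le> W / (p * X\<^sup>2)"
    using W X p by (intro frac_le mult_left_mono power_mono) (auto intro: order_trans[OF abs_ge_zero])
  finally have quot: "\<bar>M.g x\<bar> / \<bar>g1 x\<bar> \<le> W / (p * X\<^sup>2)" .
  have W0: "W \<ge> 0" using W by linarith
  have "tm x = \<bar>M.g x\<bar> / \<bar>g1 x\<bar> * \<bar>integral {-1..1} (\<lambda>s. g s / (x - s))\<bar>" by (simp add: tm_def abs_divide)
  also have "\<dots> \<le> (W / (p * X\<^sup>2)) * (cmod \<mu> * \<bar>g 1\<bar> * c * (c * x) / q)"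
  proof (rule mult_mono[OF quot])
    show "\<bar>integral {-1..1} (\<lambda>s. g s / (x - s))\<bar> \<le> cmod \<mu> * \<bar>g 1\<bar> * c * (c * x) / q"
      using stieltjes_bound'[of x] x q par unfolding q_def by simp
  qed (use W0 X p in auto)
  also have "\<dots> = 1.285\<^sup>2 / 4 * cmod \<mu> * B * M.B * ((ch - ch') * (cmod \<mu> / cmod \<mu>') * (1 / \<bar>g 1\<bar>) * (c\<^sup>2 * p / q\<^sup>2))"
  proof -
    have X2: "X\<^sup>2 = 4 * \<bar>g 1\<bar>\<^sup>2 * q / (1.285\<^sup>2 * c\<^sup>2 * (cmod \<mu>)\<^sup>2 * p\<^sup>2)"
      unfolding X_def using q by (simp add: power_mult_distrib power_divide)
    have "p * X\<^sup>2 = 4 * \<bar>g 1\<bar>\<^sup>2 * q / (1.285\<^sup>2 * c\<^sup>2 * (cmod \<mu>)\<^sup>2 * p)" unfolding X2 using p by (simp add: power2_eq_square)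
    hence "W / (p * X\<^sup>2) = W * (1.285\<^sup>2 * c\<^sup>2 * (cmod \<mu>)\<^sup>2 * p) / (4 * \<bar>g 1\<bar>\<^sup>2 * q)" by simp
    moreover have "D * b * b' / (c\<^sup>2 * m * m') / x * (N * c\<^sup>2 * m\<^sup>2 * p) / (4 * G\<^sup>2 * q) * (m * G * c * (c * x) / q)
        = N / 4 * m * b * b' * (D * (m / m') * (1 / G) * (c\<^sup>2 * p / q\<^sup>2))"
      if "m > 0" "m' > 0" "G > 0" for m m' G b b' D N :: real
      using that c_pos x q by (simp add: field_simps power2_eq_square)
    moreover have "cmod \<mu> > 0" "cmod \<mu>' > 0" "\<bar>g 1\<bar> > 0" by fact+
    ultimately show ?thesis unfolding W_def by (simp only:)
  qed
  also have "\<dots> \<le> 1.285\<^sup>2 / 4 * cmod \<mu> * B * M.B * (ch * 1 * 1.4143 * (1 / s\<^sup>2))"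
  proof (rule mult_left_mono)
    have "ch - ch' \<le> ch" "0 \<le> ch - ch'" using ch'0 ch'_le by auto
    moreover have "cmod \<mu> / cmod \<mu>' \<le> 1" using le mu by simp
    moreover have "1 / \<bar>g 1\<bar> \<le> 1.4143"
    proof -
      have "1 / 1.4143 \<le> \<bar>g 1\<bar>"
      proof (rule power2_le_imp_le)
        have "(1 / 1.4143)\<^sup>2 \<le> (1 / 2 :: real)" by (simp add: power2_eq_square)
        thus "(1 / 1.4143)\<^sup>2 \<le> \<bar>g 1\<bar>\<^sup>2" using g_one_sq_ge by simp
      qed simp
      thus ?thesis using g1 by (simp add: field_simps)
    qed
    moreover have "c\<^sup>2 * p / q\<^sup>2 \<le> 1 / s\<^sup>2"
    proof -
      define R where "R = sqrt ch"
      have R: "R > 0" using ch_pos by (simp add: R_def)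
      have qs: "q = s * (s + 2 * R)" using outer_zero_params(2)[OF x] by (simp add: q_def s_def R_def)
      have "c\<^sup>2 * p \<le> c\<^sup>2 * (x * x)" using p by (intro mult_left_mono) auto
      also have "\<dots> = (s + R)\<^sup>2" by (simp add: s_def R_def power2_eq_square)
      also have "\<dots> \<le> (s + 2 * R)\<^sup>2" using s R by (intro power_mono) auto
      finally have "c\<^sup>2 * p / q\<^sup>2 \<le> (s + 2 * R)\<^sup>2 / q\<^sup>2" by (rule divide_right_mono) simp
      also have "\<dots> = 1 / s\<^sup>2" unfolding qs using s R by (simp add: power_mult_distrib)
      finally show ?thesis .
    qed
    ultimately show "(ch - ch') * (cmod \<mu> / cmod \<mu>') * (1 / \<bar>g 1\<bar>) * (c\<^sup>2 * p / q\<^sup>2) \<le> ch * 1 * 1.4143 * (1 / s\<^sup>2)"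
      using p q ch_pos by (intro mult_mono) auto
  qed (use B_nonneg M.B_nonneg in auto)
  also have "\<dots> = (1.285\<^sup>2 / 4 * 1.4143) * (cmod \<mu> * ch * B * M.B * (1 / s\<^sup>2))" by (simp only: mult_ac mult_1_left)
  also have "\<dots> \<le> 0.585 * (cmod \<mu> * ch * B * M.B * (1 / s\<^sup>2))"
    using B_nonneg M.B_nonneg ch_pos by (intro mult_right_mono mult_nonneg_nonneg) (auto simp: power2_eq_square)
  finally show ?thesis by (simp only: s_def mult.assoc)
qed

end

text \<open>The numerator equals q + R^2 for the denominator variable \<open>q\<close>; then q \<ge>
  s^2 serves for the first part and q \<ge> 2 R s for the second. The constant rounds up 1 / (2 sqrt
  2).\<close>

lemma even_profile_bound:
  fixes s R :: real
  assumes s: "s > 0" and R: "R > 0"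
  shows "(s + R) * (s + R) / (s * (s + 2 * R) * sqrt (s * (s + 2 * R))) \<le> 1 / s + 0.354 * sqrt R * (1 / (s * sqrt s))"
proof -
  define q where "q = s * (s + 2 * R)"
  have q: "q > 0" using s R by (simp add: q_def)
  have "s * s \<le> q" "2 * R * s \<le> q" using s R by (auto simp: q_def algebra_simps)
  note q = q this
  have a: "s \<le> sqrt q" using q s by (intro real_le_rsqrt) (simp add: power2_eq_square)
  have b: "sqrt (2 * R * s) \<le> sqrt q" using q by simp
  have "(s + R) * (s + R) = q + R * R" by (simp add: q_def algebra_simps)
  hence "(s + R) * (s + R) / (q * sqrt q) = 1 / sqrt q + R * R / (q * sqrt q)" using q by (simp add: add_divide_distrib)
  also have "\<dots> \<le> 1 / s + R * R / (2 * R * s * sqrt (2 * R * s))"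
    using s R q a b by (intro add_mono divide_left_mono mult_mono) auto
  also have "R * R / (2 * R * s * sqrt (2 * R * s)) = 1 / (2 * sqrt 2) * (R / sqrt R) * (1 / (s * sqrt s))"
    using s R by (simp add: real_sqrt_mult field_simps)
  also have "R / sqrt R = sqrt R" using R by (simp add: real_div_sqrt)
  also have "1 / (2 * sqrt 2) * sqrt R * (1 / (s * sqrt s)) \<le> 0.354 * sqrt R * (1 / (s * sqrt s))"
  proof (intro mult_right_mono)
    have "1.4142 \<le> sqrt (2::real)" by (rule real_le_rsqrt) (simp add: power2_eq_square)
    thus "1 / (2 * sqrt 2) \<le> (0.354::real)" by (simp add: divide_simps)
  qed (use s R in auto)
  finally show ?thesis by (simp add: q_def)
qed

lemma odd_profile_bound:
  fixes s R :: real
  assumes s: "s > 0" and R: "R > 0"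
  shows "(s + R) * R / (s * (s + 2 * R) * sqrt (s * (s + 2 * R))) \<le> 0.7072 * sqrt R * (1 / (s * sqrt s))"
proof -
  have "(s + R) * R / (s * (s + 2 * R) * sqrt (s * (s + 2 * R))) \<le> (s + 2 * R) * R / (s * (s + 2 * R) * sqrt (2 * R * s))"
    using s R by (intro frac_le mult_mono mult_pos_pos) (auto simp: algebra_simps)
  also have "\<dots> = R / (s * sqrt (2 * R * s))" using s R by simp
  also have "\<dots> = 1 / sqrt 2 * (R / sqrt R) * (1 / (s * sqrt s))"
    using s R by (simp add: real_sqrt_mult field_simps)
  also have "R / sqrt R = sqrt R" using R by (simp add: real_div_sqrt)
  also have "1 / sqrt 2 * sqrt R * (1 / (s * sqrt s)) \<le> 0.7072 * sqrt R * (1 / (s * sqrt s))"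
  proof (intro mult_right_mono)
    have "1.4142 \<le> sqrt (2::real)" by (rule real_le_rsqrt) (simp add: power2_eq_square)
    thus "1 / sqrt 2 \<le> (0.7072::real)" by (simp add: divide_simps)
  qed (use s R in auto)
  finally show ?thesis .
qed

section \<open>Summation over the outer zeros\<close>

context prolate_pair begin

lemma outer_sum_reindex:
  fixes h :: "real \<Rightarrow> real"
  assumes "finite P" "\<And>x. x \<in> P \<Longrightarrow> 1 < x \<and> g x = 0"
  shows "(\<Sum>x\<in>P. h (c * x - sqrt ch)) = sum h ((\<lambda>x. c * x - sqrt ch) ` P)"
    "z \<in> (\<lambda>x. c * x - sqrt ch) ` P \<Longrightarrow> 1.1 \<le> z"
    "z \<in> (\<lambda>x. c * x - sqrt ch) ` P \<Longrightarrow> z' \<in> (\<lambda>x. c * x - sqrt ch) ` P \<Longrightarrow> z < z' \<Longrightarrow> 2.2 \<le> z' - z"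
proof -
  have "inj_on (\<lambda>x. c * x - sqrt ch) P" using c_pos by (auto intro!: inj_onI)
  thus "(\<Sum>x\<in>P. h (c * x - sqrt ch)) = sum h ((\<lambda>x. c * x - sqrt ch) ` P)" by (simp add: sum.reindex)
  show "1.1 \<le> z" if "z \<in> (\<lambda>x. c * x - sqrt ch) ` P"
    using that assms(2) outer_zero_params(1) by blast
  show "2.2 \<le> z' - z" if zz: "z \<in> (\<lambda>x. c * x - sqrt ch) ` P" "z' \<in> (\<lambda>x. c * x - sqrt ch) ` P" "z < z'"
  proof -
    obtain x y where xy: "x \<in> P" "y \<in> P" "z = c * x - sqrt ch" "z' = c * y - sqrt ch" using zz by blast
    hence "c * x < c * y" using zz(3) by simp
    hence "x < y" using c_pos by simp
    thus ?thesis using outer_zero_spacing'[of x y] assms(2)[of x] assms(2)[of y] xy by simp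
  qed
qed

lemma term_profile:
  assumes le: "cmod \<mu> \<le> cmod \<mu>'" and x: "1 < x" "g x = 0"
  defines "s \<equiv> c * x - sqrt ch"
  shows "even k \<Longrightarrow> tm x \<le> 0.6425 * cmod \<mu> * M.B * (1 / s + 0.354 * sqrt (sqrt ch) * (1 / (s * sqrt s)))"
    and "odd k \<Longrightarrow> tm x \<le> 0.6425 * cmod \<mu> * M.B * (0.7072 * sqrt (sqrt ch) * (1 / (s * sqrt s)))"
proof -
  define R where "R = sqrt ch"
  have R: "R > 0" using ch_pos by (simp add: R_def)
  have s: "s > 0" using outer_zero_params(1)[OF x] by (simp add: s_def)
  have q: "c\<^sup>2 * x\<^sup>2 - ch = s * (s + 2 * R)" using outer_zero_params(2)[OF x] by (simp add: s_def R_def)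
  have cx: "c * x = s + R" by (simp add: s_def R_def)
  have K: "0 \<le> 0.6425 * cmod \<mu> * M.B" using M.B_nonneg by simp
  note t = term_bound[OF le x, unfolded q cx R_def[symmetric]]
  show "tm x \<le> 0.6425 * cmod \<mu> * M.B * (1 / s + 0.354 * sqrt (sqrt ch) * (1 / (s * sqrt s)))" if "even k"
    using t mult_left_mono[OF even_profile_bound[OF s R] K] that unfolding R_def[symmetric] if_P[OF that] by (meson order_trans)
  show "tm x \<le> 0.6425 * cmod \<mu> * M.B * (0.7072 * sqrt (sqrt ch) * (1 / (s * sqrt s)))" if "odd k"
    using t mult_left_mono[OF odd_profile_bound[OF s R] K] that unfolding R_def[symmetric] if_not_P[OF that] by (meson order_trans)
qed

lemma half_sum_odd:
  assumes le: "cmod \<mu> \<le> cmod \<mu>'" and k: "odd k" and P: "finite P" "\<And>x. x \<in> P \<Longrightarrow> 1 < x \<and> g x = 0"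
  shows "sum tm P \<le> 0.6425 * cmod \<mu> * M.B * (1.23 * sqrt (sqrt ch))"
proof -
  define K where "K = 0.6425 * cmod \<mu> * M.B"
  have K: "K \<ge> 0" using M.B_nonneg by (simp add: K_def)
  define w where "w = sqrt (sqrt ch)"
  have w: "w > 0" using ch_pos by (simp add: w_def)
  define H where "H = (\<lambda>s. K * (0.7072 * w * (1 / (s * sqrt s))))"
  have "sum tm P \<le> (\<Sum>x\<in>P. H (c * x - sqrt ch))"
    using term_profile(2)[OF le _ _ k] P(2) by (intro sum_mono) (auto simp: H_def K_def w_def)
  also have "\<dots> = K * (0.7072 * w * (\<Sum>s\<in>(\<lambda>x. c * x - sqrt ch) ` P. 1 / (s * sqrt s)))"
    by (simp only: outer_sum_reindex(1)[OF P, of H]) (simp only: H_def sum_distrib_left)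
  also have "\<dots> \<le> K * (0.7072 * w * 1.734)"
    using K w P outer_sum_reindex(2,3)[OF P] by (intro mult_left_mono sum_inverse_sqrt_spaced) auto
  also have "\<dots> \<le> K * (1.23 * w)" using K w by (intro mult_left_mono) auto
  finally show ?thesis by (simp add: K_def w_def)
qed

text \<open>The 1/s part of the direct bound is summable only up to a logarithm, so it is used for
  zeros with s \<le> L; beyond \<open>L\<close> the Wronskian bound takes over. The value of
  \<open>L\<close> is left free.\<close>

lemma half_sum_even:
  assumes le: "cmod \<mu> \<le> cmod \<mu>'" and k: "even k" "even k'" "0 \<le> ch'" and L: "1.1 \<le> L"
    and P: "finite P" "\<And>x. x \<in> P \<Longrightarrow> 1 < x \<and> g x = 0"
  shows "sum tm P \<le> 0.6425 * cmod \<mu> * M.B * (10 / 11 + ln L / 2.2 + 0.614 * sqrt (sqrt ch))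
     + 0.585 * cmod \<mu> * ch * B * M.B * (1 / L\<^sup>2 + 1 / (2.2 * L))"
proof -
  define K K2 where "K = 0.6425 * cmod \<mu> * M.B" and "K2 = 0.585 * cmod \<mu> * ch * B * M.B"
  have K: "K \<ge> 0" "K2 \<ge> 0" using M.B_nonneg B_nonneg ch_pos by (simp_all add: K_def K2_def)
  define w where "w = sqrt (sqrt ch)"
  have w: "w > 0" using ch_pos by (simp add: w_def)
  define P1 P2 where "P1 = {x \<in> P. c * x - sqrt ch \<le> L}" and "P2 = {x \<in> P. \<not> c * x - sqrt ch \<le> L}"
  have P1: "finite P1" "\<And>x. x \<in> P1 \<Longrightarrow> 1 < x \<and> g x = 0" and P2: "finite P2" "\<And>x. x \<in> P2 \<Longrightarrow> 1 < x \<and> g x = 0"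
    using P by (auto simp: P1_def P2_def)
  define H where "H = (\<lambda>s. K * (1 / s + 0.354 * w * (1 / (s * sqrt s))))"
  have "sum tm P1 \<le> (\<Sum>x\<in>P1. H (c * x - sqrt ch))"
    using term_profile(1)[OF le _ _ k(1)] P1(2) by (intro sum_mono) (auto simp: H_def K_def w_def)
  also have "\<dots> = K * ((\<Sum>s\<in>(\<lambda>x. c * x - sqrt ch) ` P1. 1 / s) + 0.354 * w * (\<Sum>s\<in>(\<lambda>x. c * x - sqrt ch) ` P1. 1 / (s * sqrt s)))"
    by (simp only: outer_sum_reindex(1)[OF P1, of H]) (simp only: H_def sum_distrib_left[symmetric] sum.distrib)
  also have "\<dots> \<le> K * ((10 / 11 + ln L / 2.2) + 0.354 * w * 1.734)"
  proof (intro mult_left_mono add_mono sum_inverse_sqrt_spaced sum_inverse_spaced)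
    show "1.1 \<le> z \<and> z \<le> L" if "z \<in> (\<lambda>x. c * x - sqrt ch) ` P1" for z
      using outer_sum_reindex(2)[OF P1 that] that by (auto simp: P1_def)
  qed (use K w P1 L outer_sum_reindex(2,3)[OF P1] in auto)
  also have "\<dots> \<le> K * (10 / 11 + ln L / 2.2 + 0.614 * w)" using K w by (intro mult_left_mono) auto
  finally have A: "sum tm P1 \<le> K * (10 / 11 + ln L / 2.2 + 0.614 * w)" .
  define H2 where "H2 = (\<lambda>s. K2 * (1 / s\<^sup>2))"
  have "sum tm P2 \<le> (\<Sum>x\<in>P2. H2 (c * x - sqrt ch))"
    using term_bound_tail[OF le k] P2(2) by (intro sum_mono) (auto simp: H2_def K2_def)
  also have "\<dots> = K2 * (\<Sum>s\<in>(\<lambda>x. c * x - sqrt ch) ` P2. 1 / s\<^sup>2)"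
    by (simp only: outer_sum_reindex(1)[OF P2, of H2]) (simp only: H2_def sum_distrib_left)
  also have "\<dots> \<le> K2 * (1 / L\<^sup>2 + 1 / (2.2 * L))"
  proof (intro mult_left_mono sum_inverse_square_spaced)
    show "L \<le> z" if "z \<in> (\<lambda>x. c * x - sqrt ch) ` P2" for z using that by (auto simp: P2_def)
  qed (use K P2 L outer_sum_reindex(3)[OF P2] in auto)
  finally have C: "sum tm P2 \<le> K2 * (1 / L\<^sup>2 + 1 / (2.2 * L))" .
  have "sum tm P = sum tm P1 + sum tm P2"
    unfolding P1_def P2_def using sum.Int_Diff[OF P(1), of tm "{x. c * x - sqrt ch \<le> L}"]
    by (simp add: Int_def set_diff_eq)
  thus ?thesis using A C by (simp only: K_def K2_def w_def)
qed

lemma tm_minus: "tm (- x) = tm x"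
proof -
  have "integral {-1..1} (\<lambda>s. g s / (- x - s)) = integral {-1..1} (\<lambda>s. g (- s) / (- x - (- s)))"
    using Henstock_Kurzweil_Integration.integral_reflect_real[of 1 "-1" "\<lambda>s. g s / (- x - s)"] by (simp only: minus_minus)
  also have "\<dots> = integral {-1..1} (\<lambda>s. - ((-1) ^ k) * (g s / (x - s)))"
  proof (rule integral_cong)
    fix s :: real
    have "- x - (- s) = - (x - s)" by simp
    thus "g (- s) / (- x - (- s)) = - ((-1) ^ k) * (g s / (x - s))" by (simp only: g_parity divide_minus_right) simp
  qed
  finally have "\<bar>integral {-1..1} (\<lambda>s. g s / (- x - s))\<bar> = \<bar>integral {-1..1} (\<lambda>s. g s / (x - s))\<bar>"
    by (simp only: integral_mult_right abs_mult abs_minus power_abs) simp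
  thus ?thesis by (simp add: tm_def M.g_parity g1_parity abs_mult abs_divide power_abs)
qed

lemma outer_sum_symmetric:
  shows "(\<Sum>x | 1 < \<bar>x\<bar> \<and> \<bar>x\<bar> < A \<and> g x = 0. tm x) = 2 * (\<Sum>x | 1 < x \<and> x < A \<and> g x = 0. tm x)"
    "finite {x. 1 < x \<and> x < A \<and> g x = 0}"
proof -
  define P where "P = {x. 1 < x \<and> x < A \<and> g x = 0}"
  have fin: "finite P" by (rule finite_subset[OF _ finite_zeros[of 1 A]]) (auto simp: P_def)
  thus "finite {x. 1 < x \<and> x < A \<and> g x = 0}" by (simp add: P_def)
  have gz: "g (- x) = 0 \<longleftrightarrow> g x = 0" for x by (simp add: g_parity)
  have "{x. 1 < \<bar>x\<bar> \<and> \<bar>x\<bar> < A \<and> g x = 0} = P \<union> uminus ` P"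
  proof (rule set_eqI)
    fix x
    have "x \<in> uminus ` P \<longleftrightarrow> - x \<in> P" by (metis (no_types, lifting) image_iff minus_minus)
    thus "x \<in> {x. 1 < \<bar>x\<bar> \<and> \<bar>x\<bar> < A \<and> g x = 0} \<longleftrightarrow> x \<in> P \<union> uminus ` P" by (auto simp: P_def gz abs_if)
  qed
  moreover have "P \<inter> uminus ` P = {}" by (auto simp: P_def)
  moreover have "sum tm (uminus ` P) = sum tm P" by (subst sum.reindex) (auto simp: tm_minus)
  ultimately show "(\<Sum>x | 1 < \<bar>x\<bar> \<and> \<bar>x\<bar> < A \<and> g x = 0. tm x) = 2 * (\<Sum>x | 1 < x \<and> x < A \<and> g x = 0. tm x)"
    using fin by (simp add: sum.union_disjoint P_def[symmetric])
qed

end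

text \<open>At the argument 1 the eigenvalue equation bounds |\<mu>| |g 1| by the integral of |g|,
  hence by 3/2, and |g 1| is at least 1 / sqrt 2.\<close>

lemma (in prolate_high) mu_le: "cmod \<mu> \<le> 2.13"
proof -
  have int: "(\<lambda>t. complex_of_real (g t) * exp (\<i> * of_real c * 1 * of_real t)) integrable_on {-1..1}"
    by (intro integrable_continuous_real continuous_intros cont_g)
  have "cmod (\<mu> * F 1) \<le> integral {-1..1} (\<lambda>t. (1 + (g t)\<^sup>2) / 2)"
    unfolding F_fourier_g
  proof (rule integral_norm_bound_integral[OF int])
    show "(\<lambda>t. (1 + (g t)\<^sup>2) / 2) integrable_on {-1..1}"
      by (intro integrable_continuous_real continuous_intros cont_g) auto
    fix t :: real
    have "cmod (exp (\<i> * of_real c * 1 * of_real t)) = 1" by simp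
    moreover have "0 \<le> (1 - \<bar>g t\<bar>)\<^sup>2" by simp
    hence "\<bar>g t\<bar> \<le> (1 + (g t)\<^sup>2) / 2" by (simp add: power2_eq_square algebra_simps)
    ultimately show "cmod (complex_of_real (g t) * exp (\<i> * of_real c * 1 * of_real t)) \<le> (1 + (g t)\<^sup>2) / 2"
      by (simp only: norm_mult norm_of_real mult_1_right)
  qed
  also have "\<dots> = (integral {-1..1} (\<lambda>t::real. 1) + integral {-1..1} (\<lambda>t. (g t)\<^sup>2)) / 2"
    by (simp only: integral_divide, subst integral_add) (auto intro!: integrable_continuous_real continuous_intros cont_g)
  also have "\<dots> = 1.5" by (simp add: g_norm)
  finally have a: "cmod \<mu> * \<bar>g 1\<bar> \<le> 1.5" using F_of_real[of 1] by (simp add: norm_mult)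
  have "1 / 1.415 \<le> \<bar>g 1\<bar>"
  proof (rule power2_le_imp_le)
    have "(1 / 1.415)\<^sup>2 \<le> (1 / 2 :: real)" by (simp add: power2_eq_square)
    thus "(1 / 1.415)\<^sup>2 \<le> \<bar>g 1\<bar>\<^sup>2" using g_one_sq_ge by simp
  qed simp
  hence "cmod \<mu> * (1 / 1.415) \<le> cmod \<mu> * \<bar>g 1\<bar>" by (intro mult_left_mono) auto
  thus ?thesis using a by simp
qed

text \<open>The logarithm is at least 1 - |\<mu>| \<ge> -1.13, and 24 * 1.13 < 30. This is the only
  loss when the logarithmic term is negative.\<close>

lemma (in prolate_high) log_mu_ge: "24 * ln (1 / cmod \<mu>) \<ge> - 30"
proof -
  have "ln (cmod \<mu>) \<le> cmod \<mu> - 1" using mu_nz by (intro ln_le_minus_one) auto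
  moreover have "ln (1 / cmod \<mu>) = - ln (cmod \<mu>)" using mu_nz by (simp add: ln_div)
  ultimately show ?thesis using mu_le by simp
qed

section \<open>The error bound\<close>

text \<open>The tangent of the logarithm at e gives ln u \<le> u / e, and 0.36792 rounds up 1 /
  e.\<close>

lemma ln_square_le:
  fixes v :: real
  assumes "v > 0"
  shows "ln (v\<^sup>2) \<le> 0.36792 * v\<^sup>2"
proof -
  have e: "exp 1 \<ge> (2.718 :: real)" using e_approx_32 by (simp add: abs_if split: if_splits)
  have "ln (v\<^sup>2 / exp 1) \<le> v\<^sup>2 / exp 1 - 1" using assms by (intro ln_le_minus_one) auto
  hence "ln (v\<^sup>2) \<le> v\<^sup>2 / exp 1" using assms by (simp add: ln_div)
  also have "\<dots> \<le> v\<^sup>2 / 2.718" using e by (intro divide_left_mono) auto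
  also have "\<dots> = 1 / 2.718 * v\<^sup>2" by simp
  also have "\<dots> \<le> 0.36792 * v\<^sup>2" by (intro mult_right_mono) auto
  finally show ?thesis .
qed

text \<open>All bounds are compared as polynomials in the eighth root of \<open>ch\<close>.\<close>
lemma eighth_root_bounds:
  fixes ch :: real
  assumes "ch > 900"
  defines "v \<equiv> sqrt (sqrt (sqrt ch))"
  shows "2.34 \<le> v" "sqrt (sqrt ch) = v\<^sup>2" "sqrt ch = v ^ 4" "ch = v ^ 8" "ln ch \<le> 1.4717 * v\<^sup>2"
proof -
  show v: "2.34 \<le> v" unfolding v_def
    using assms by (intro real_le_rsqrt) (simp_all add: power2_eq_square)
  have sq: "(sqrt x)\<^sup>2 = x" if "x \<ge> 0" for x :: real using that by simp
  have p: "sqrt ch \<ge> 0" "sqrt (sqrt ch) \<ge> 0" "ch \<ge> 0" using assms by auto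
  show a: "sqrt (sqrt ch) = v\<^sup>2" unfolding v_def by (rule sq[OF p(2), symmetric])
  have "sqrt ch = (sqrt (sqrt ch))\<^sup>2" by (rule sq[OF p(1), symmetric])
  thus b: "sqrt ch = v ^ 4" unfolding a by (simp flip: power_mult)
  have "ch = (sqrt ch)\<^sup>2" by (rule sq[OF p(3), symmetric])
  thus c: "ch = v ^ 8" unfolding b by (simp flip: power_mult)
  have "ln ch = 4 * ln (v\<^sup>2)" unfolding c using v by (simp add: ln_realpow)
  also have "\<dots> \<le> 4 * (0.36792 * v\<^sup>2)" using v by (intro mult_left_mono ln_square_le) auto
  also have "\<dots> = 4 * 0.36792 * v\<^sup>2" by (simp only: mult.assoc)
  also have "\<dots> \<le> 1.4717 * v\<^sup>2" by (intro mult_right_mono) auto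
  finally show "ln ch \<le> 1.4717 * v\<^sup>2" .
qed

text \<open>2.34 is 900^(1/8) rounded down; the other constants are its second, fifth and seventh
  powers rounded down.\<close>

lemma high_power_bounds:
  fixes v :: real
  assumes "2.34 \<le> v"
  shows "v \<ge> 0" "5.47 * v ^ 5 \<le> v ^ 7" "70 * v\<^sup>2 \<le> v ^ 7" "384 \<le> v ^ 7" "70 \<le> v ^ 5" "2.34 * v ^ 7 \<le> v ^ 8" "5.47 \<le> v\<^sup>2" "v ^ 8 \<ge> 0"
proof -
  have p: "2.34 ^ n \<le> v ^ n" for n using assms by (intro power_mono) auto
  show v0: "v \<ge> 0" using assms by simp
  show "5.47 \<le> v\<^sup>2" using p[of 2] by (simp add: power2_eq_square)
  show "70 \<le> v ^ 5" using p[of 5] by (simp add: eval_nat_numeral)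
  show "384 \<le> v ^ 7" using p[of 7] by (simp add: eval_nat_numeral)
  have "v ^ 7 = v\<^sup>2 * v ^ 5" by (simp flip: power_add)
  thus "5.47 * v ^ 5 \<le> v ^ 7" "70 * v\<^sup>2 \<le> v ^ 7"
    using mult_right_mono[OF \<open>5.47 \<le> v\<^sup>2\<close>, of "v ^ 5"] mult_left_mono[OF \<open>70 \<le> v ^ 5\<close>, of "v\<^sup>2"] zero_le_power[OF v0, of 5] by simp_all
  have "v ^ 8 = v * v ^ 7" by (simp flip: power_Suc)
  thus "2.34 * v ^ 7 \<le> v ^ 8" using assms v0 by (simp only:) (auto intro!: mult_right_mono)
  show "v ^ 8 \<ge> 0" by simp
qed

text \<open>The logarithm of \<open>ch\<close> is bounded by a multiple of v^2, so its square root
  costs one power of the eighth root v and the product with sqrt ch is of order v^5.\<close>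

lemma variation_bound_numeric:
  fixes ch :: real
  assumes "ch > 900"
  shows "sqrt 2 + sqrt ch * (2 * sqrt (ln (2 * ch)) + 2.84) \<le> 3.77 * sqrt (sqrt (sqrt ch)) ^ 5"
proof -
  define v where "v = sqrt (sqrt (sqrt ch))"
  note e = eighth_root_bounds[OF assms, folded v_def]
  note h = high_power_bounds[OF e(1)]
  have "ln (2 * ch) = ln 2 + ln ch" using assms by (simp add: ln_mult)
  moreover have "ln 2 \<le> (0.69445::real)" using ln2_le_25_over_36 by simp
  moreover have "l2 + l \<le> 1.599 * w" if "l2 \<le> 0.69445" "l \<le> 1.4717 * w" "5.47 \<le> w" for l2 l w :: real
    using that by simp
  ultimately have "ln (2 * ch) \<le> 1.599 * v\<^sup>2" using e(5) h(7) by (simp only:)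
  also have "\<dots> \<le> (1.265 * v)\<^sup>2" by (simp add: power_mult_distrib power2_eq_square[of "_ :: real"] mult_right_mono)
  finally have "sqrt (ln (2 * ch)) \<le> 1.265 * v" using h(1) by (intro real_le_lsqrt) auto
  hence "2 * sqrt (ln (2 * ch)) + 2.84 \<le> 3.744 * v" using e(1) by simp
  hence "v ^ 4 * (2 * sqrt (ln (2 * ch)) + 2.84) \<le> v ^ 4 * (3.744 * v)" by (intro mult_left_mono) auto
  also have "\<dots> = 3.744 * v ^ 5" by (simp add: eval_nat_numeral)
  moreover have "sqrt 2 \<le> (1.42::real)" by (rule real_le_lsqrt) (simp_all add: power2_eq_square)
  moreover have "r + X \<le> 3.77 * v5" if "X \<le> Y" "Y = 3.744 * v5" "r \<le> 1.42" "70 \<le> v5" for r X Y v5 :: real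
    using that by simp
  ultimately show ?thesis unfolding v_def[symmetric] unfolding e(3) using h(5) by blast
qed

lemma (in prolate_high) B_le:
  assumes "ch > 900" shows "B \<le> 3.77 * sqrt (sqrt (sqrt ch)) ^ 5"
  using B_bound[of ch] variation_bound_numeric[OF assms] assms ch_gt by linarith

lemma (in prolate_pair) M_B_le:
  assumes "ch > 900" "0 \<le> ch'" shows "M.B \<le> 3.77 * sqrt (sqrt (sqrt ch)) ^ 5"
  using M.B_bound[of ch] variation_bound_numeric[OF assms(1)] assms ch_gt ch'_le by linarith

text \<open>|M.g 1| is at most half of \<open>M.B\<close>, and both |\<mu>| / |\<mu>'| and |g 0| /
  |g 1| are at most 1; the constant rounds up 4 / pi.\<close>

lemma (in prolate_pair) boundary_term_le:
  assumes le: "cmod \<mu> \<le> cmod \<mu>'"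
  shows "8 / pi * rho * (cmod \<mu> * \<bar>g 0\<bar>) \<le> cmod \<mu> * (1.274 * M.B)"
proof -
  have mu: "cmod \<mu> > 0" "cmod \<mu>' > 0" using mu_nz M.mu_nz by auto
  have G: "\<bar>g 1\<bar> > 0" using g_one_nz by simp
  have "integral {-1..1} (\<lambda>t. \<bar>M.g1 t\<bar>) \<ge> 0"
    by (intro integral_nonneg integrable_continuous_real continuous_intros M.cont_g1) auto
  hence b: "\<bar>M.g 1\<bar> \<le> M.B / 2" by (simp add: M.B_def)
  have "rho * (cmod \<mu> * \<bar>g 0\<bar>) = cmod \<mu> * ((cmod \<mu> / cmod \<mu>') * (\<bar>g 0\<bar> / \<bar>g 1\<bar>) * \<bar>M.g 1\<bar>)"
    by (simp add: rho_def)
  also have "\<dots> \<le> cmod \<mu> * (1 * 1 * (M.B / 2))"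
    using le mu G g0_bounds(1) b by (intro mult_left_mono mult_mono) auto
  finally have "8 / pi * (rho * (cmod \<mu> * \<bar>g 0\<bar>)) \<le> 8 / pi * (cmod \<mu> * (1 * 1 * (M.B / 2)))"
    by (intro mult_left_mono) auto
  also have "\<dots> = cmod \<mu> * (4 / pi * M.B)" by simp
  also have "\<dots> \<le> cmod \<mu> * (1.274 * M.B)"
  proof (intro mult_left_mono mult_right_mono)
    show "4 / pi \<le> 1.274" using pi_approx(1) by (simp add: field_simps)
  qed (use M.B_nonneg in auto)
  finally show ?thesis by (simp only: mult.assoc)
qed

text \<open>The cut-off is L = ch^2: the tail, of order ch b b' / L, shrinks to v^2, while ln L is
  merely twice ln ch. The direct part is of order v^7 and fits under 6 v^8.\<close>

lemma final_polynomial_even: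
  fixes v b b' ch :: real
  assumes v: "2.34 \<le> v" and ch: "ch = v ^ 8" "ch > 900" "ln ch \<le> 1.4717 * v\<^sup>2"
    and b: "0 \<le> b" "b \<le> 3.77 * v ^ 5" "0 \<le> b'" "b' \<le> 3.77 * v ^ 5"
  shows "2 * (0.6425 * b' * (10 / 11 + ln (ch\<^sup>2) / 2.2 + 0.614 * v\<^sup>2) + 0.585 * ch * b * b' * (1 / (ch\<^sup>2)\<^sup>2 + 1 / (2.2 * ch\<^sup>2))) + 1.274 * b'
    \<le> 6 * ch - 30"
proof -
  note h = high_power_bounds[OF v]
  have ch2: "ch\<^sup>2 \<ge> 810000"
  proof -
    have "900\<^sup>2 \<le> ch\<^sup>2" using ch(2) by (intro power_mono) auto
    thus ?thesis by simp
  qed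
  have "ln (ch\<^sup>2) = 2 * ln ch" using ch(2) by (simp add: ln_realpow)
  hence l: "10 / 11 + ln (ch\<^sup>2) / 2.2 + 0.614 * v\<^sup>2 \<le> 0.9091 + 1.952 * v\<^sup>2" using ch(3) h(7) by (simp add: field_simps)
  have "0 \<le> ln (ch\<^sup>2)" using ch2 by simp
  hence l0: "0 \<le> 10 / 11 + ln (ch\<^sup>2) / 2.2 + 0.614 * v\<^sup>2" by simp
  have "0.6425 * b' * (10 / 11 + ln (ch\<^sup>2) / 2.2 + 0.614 * v\<^sup>2) \<le> 0.6425 * (3.77 * v ^ 5) * (0.9091 + 1.952 * v\<^sup>2)"
    using b l l0 h(1) by (intro mult_mono) auto
  also have "\<dots> = 0.6425 * 3.77 * 0.9091 * v ^ 5 + 0.6425 * 3.77 * 1.952 * (v ^ 5 * v\<^sup>2)" by (simp add: distrib_left)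
  also have "v ^ 5 * v\<^sup>2 = v ^ 7" by (simp flip: power_add)
  also have "0.6425 * 3.77 * 0.9091 * v ^ 5 + 0.6425 * 3.77 * 1.952 * v ^ 7 \<le> 2.2021 * v ^ 5 + 4.7283 * v ^ 7"
    using h(1) by (intro add_mono mult_right_mono) auto
  finally have A: "0.6425 * b' * (10 / 11 + ln (ch\<^sup>2) / 2.2 + 0.614 * v\<^sup>2) \<le> 2.2021 * v ^ 5 + 4.7283 * v ^ 7" .
  have "1 / (ch\<^sup>2)\<^sup>2 + 1 / (2.2 * ch\<^sup>2) = (1 / ch\<^sup>2 + 1 / 2.2) * (1 / ch\<^sup>2)" using ch(2) by (simp add: field_simps power2_eq_square)
  also have "\<dots> \<le> 0.455 * (1 / ch\<^sup>2)"
  proof (intro mult_right_mono)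
    have "1 / ch\<^sup>2 \<le> 1 / 810000" using ch2 by (intro divide_left_mono) auto
    thus "1 / ch\<^sup>2 + 1 / 2.2 \<le> 0.455" by simp
  qed auto
  finally have "0.585 * ch * b * b' * (1 / (ch\<^sup>2)\<^sup>2 + 1 / (2.2 * ch\<^sup>2)) \<le> 0.585 * ch * (3.77 * v ^ 5) * (3.77 * v ^ 5) * (0.455 * (1 / ch\<^sup>2))"
    using b h(1) ch(2) by (intro mult_mono) auto
  also have "\<dots> = 0.585 * 3.77 * 3.77 * 0.455 * (v ^ 10 / ch)" using ch(2) by (simp add: field_simps power2_eq_square flip: power_add)
  also have "v ^ 10 / ch = v\<^sup>2" unfolding ch(1) using v by (simp add: field_simps flip: power_add)
  finally have "0.585 * ch * b * b' * (1 / (ch\<^sup>2)\<^sup>2 + 1 / (2.2 * ch\<^sup>2)) \<le> 0.585 * 3.77 * 3.77 * 0.455 * v\<^sup>2" .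
  also have "\<dots> \<le> 3.8 * v\<^sup>2" by (intro mult_right_mono) auto
  finally have C: "0.585 * ch * b * b' * (1 / (ch\<^sup>2)\<^sup>2 + 1 / (2.2 * ch\<^sup>2)) \<le> 3.8 * v\<^sup>2" .
  have "2 * (X + Y) + 1.274 * b' \<le> 6 * v8 - 30"
    if "X \<le> 2.2021 * v5 + 4.7283 * v7" "Y \<le> 3.8 * v2" "b' \<le> 3.77 * v5" "5.47 * v5 \<le> v7" "70 * v2 \<le> v7" "384 \<le> v7" "2.34 * v7 \<le> v8"
    for X Y v2 v5 v7 v8 :: real using that by simp
  from this[OF A C b(4) h(2,3,4,6)] show ?thesis unfolding ch(1) .
qed

context prolate_pair begin

text \<open>Evenness is required of \<open>k'\<close> alone. For odd \<open>k\<close> the direct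
  bound is already summable; for even \<open>k\<close> the parities agree, as the Wronskian bound
  demands.\<close>

lemma error_bound_even:
  assumes le: "cmod \<mu> \<le> cmod \<mu>'" and ch: "ch > 900" and k': "even k'" and ch'0: "0 \<le> ch'"
    and simple: "\<And>t. -1 < t \<Longrightarrow> t < 1 \<Longrightarrow> g t = 0 \<Longrightarrow> g1 t \<noteq> 0"
  shows "\<bar>integral {-1..1} M.g - (\<Sum>t | -1 < t \<and> t < 1 \<and> g t = 0. M.g t * (integral {-1..1} (\<lambda>s. g s / (s - t)) / g1 t))\<bar>
     \<le> cmod \<mu> * (6 * ch - 30)"
proof -
  define v where "v = sqrt (sqrt (sqrt ch))"
  note e = eighth_root_bounds[OF ch, folded v_def]
  note h = high_power_bounds[OF e(1)]
  note B' = B_le[OF ch, folded v_def]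
  note MB = M_B_le[OF ch ch'0, folded v_def]
  define T where "T = (if even k then
     0.6425 * M.B * (10 / 11 + ln (ch\<^sup>2) / 2.2 + 0.614 * v\<^sup>2) + 0.585 * ch * B * M.B * (1 / (ch\<^sup>2)\<^sup>2 + 1 / (2.2 * ch\<^sup>2))
     else 0.6425 * M.B * (1.23 * v\<^sup>2))"
  have half: "(\<Sum>x | 1 < x \<and> x < A \<and> g x = 0. tm x) \<le> cmod \<mu> * T" for A
  proof (cases "even k")
    case True
    have "1.1 \<le> ch\<^sup>2" using ch power_mono[of 900 ch 2] by simp
    from half_sum_even[OF le True k' ch'0 this outer_sum_symmetric(2)[of A], unfolded e(2)]
    show ?thesis using True by (simp add: T_def algebra_simps)
  next
    case False
    from half_sum_odd[OF le False outer_sum_symmetric(2)[of A], unfolded e(2)]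
    show ?thesis using False by (simp add: T_def algebra_simps)
  qed
  have "\<bar>integral {-1..1} M.g - (\<Sum>t | -1 < t \<and> t < 1 \<and> g t = 0. M.g t * (integral {-1..1} (\<lambda>s. g s / (s - t)) / g1 t))\<bar>
     \<le> 2 * (cmod \<mu> * T) + 8 / pi * rho * (cmod \<mu> * \<bar>g 0\<bar>)"
  proof (rule error_bound_limit[OF simple])
    fix A
    show "(\<Sum>x | 1 < \<bar>x\<bar> \<and> \<bar>x\<bar> < A \<and> g x = 0. \<bar>M.g x / g1 x\<bar> * \<bar>integral {-1..1} (\<lambda>s. g s / (x - s))\<bar>) \<le> 2 * (cmod \<mu> * T)"
      using outer_sum_symmetric(1)[of A] half[of A] unfolding tm_def by linarith
  qed
  also have "\<dots> \<le> 2 * (cmod \<mu> * T) + cmod \<mu> * (1.274 * M.B)" using boundary_term_le[OF le] by linarith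
  also have "\<dots> = cmod \<mu> * (2 * T + 1.274 * M.B)" by (simp add: algebra_simps)
  also have "\<dots> \<le> cmod \<mu> * (6 * ch - 30)"
  proof (rule mult_left_mono)
    show "2 * T + 1.274 * M.B \<le> 6 * ch - 30"
    proof (cases "even k")
      case True
      thus ?thesis unfolding T_def if_P[OF True]
        by (intro final_polynomial_even[of v] e ch B' MB B_nonneg M.B_nonneg)
    next
      case False
      have "0.6425 * M.B * (1.23 * v\<^sup>2) \<le> 0.6425 * (3.77 * v ^ 5) * (1.23 * v\<^sup>2)"
        using MB by (intro mult_right_mono mult_left_mono) auto
      also have "\<dots> = 0.6425 * 3.77 * 1.23 * v ^ 7" by (simp flip: power_add)
      also have "\<dots> \<le> 2.98 * v ^ 7" using h(1) by (intro mult_right_mono) auto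
      finally have "T \<le> 2.98 * v ^ 7" unfolding T_def if_not_P[OF False] .
      thus ?thesis unfolding e(4) using MB h(2,4,6) by simp
    qed
  qed simp
  finally show ?thesis .
qed

text \<open>The integral of an odd function vanishes, and the nodes t and -t carry equal weights, so
  their contributions cancel whatever the parity of \<open>k\<close>.\<close>

lemma error_zero_odd:
  assumes k': "odd k'"
  shows "integral {-1..1} M.g - (\<Sum>t | -1 < t \<and> t < 1 \<and> g t = 0. M.g t * (integral {-1..1} (\<lambda>s. g s / (s - t)) / g1 t)) = 0"
proof -
  have "integral {-1..1} M.g = integral {-1..1} (\<lambda>s. M.g (- s))"
    using Henstock_Kurzweil_Integration.integral_reflect_real[of 1 "-1" M.g] by (simp only: minus_minus)
  also have "\<dots> = - integral {-1..1} M.g" using k' by (simp add: M.g_parity)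
  finally have I: "integral {-1..1} M.g = 0" by simp
  define Z where "Z = {t. -1 < t \<and> t < 1 \<and> g t = 0}"
  define h where "h t = M.g t * (integral {-1..1} (\<lambda>s. g s / (s - t)) / g1 t)" for t
  have odd: "h (- t) = - h t" for t
  proof -
    have "integral {-1..1} (\<lambda>s. g s / (s - (- t))) = integral {-1..1} (\<lambda>s. g (- s) / (- s - (- t)))"
      using Henstock_Kurzweil_Integration.integral_reflect_real[of 1 "-1" "\<lambda>s. g s / (s - (- t))"] by (simp only: minus_minus)
    also have "\<dots> = integral {-1..1} (\<lambda>s. - ((-1) ^ k) * (g s / (s - t)))"
    proof (rule integral_cong)
      fix s :: real
      have "- s - (- t) = - (s - t)" by simp
      thus "g (- s) / (- s - (- t)) = - ((-1) ^ k) * (g s / (s - t))" by (simp only: g_parity divide_minus_right) simp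
    qed
    finally have "integral {-1..1} (\<lambda>s. g s / (s - (- t))) = - ((-1) ^ k) * integral {-1..1} (\<lambda>s. g s / (s - t))" by (simp only: integral_mult_right)
    thus ?thesis unfolding h_def using k' by (cases "even k") (simp_all add: M.g_parity g1_parity)
  qed
  have "sum h Z = sum h (uminus ` Z)"
  proof -
    have "uminus ` Z = Z"
    proof (rule set_eqI)
      fix x
      have "x \<in> uminus ` Z \<longleftrightarrow> - x \<in> Z" by (metis (no_types, lifting) image_iff minus_minus)
      thus "x \<in> uminus ` Z \<longleftrightarrow> x \<in> Z" by (auto simp: Z_def g_parity)
    qed
    thus ?thesis by simp
  qed
  also have "\<dots> = - sum h Z" by (subst sum.reindex) (auto simp: odd sum_negf)
  finally have "sum h Z = 0" by simp
  thus ?thesis using I by (simp add: Z_def h_def)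
qed

end

lemma pswf_prolate:
  assumes "c > 0" "pswf_system c psi lam chi"
  shows "prolate c (chi n) (lam n) (psi n) n"
  using assms unfolding pswf_system_def by unfold_locales blast+

lemma pswf_mono:
  assumes "pswf_system c psi lam chi" "m \<le> n"
  shows "chi m \<le> chi n" "cmod (lam n) \<le> cmod (lam m)"
proof -
  have "chi i \<le> chi (Suc i)" "cmod (lam (Suc i)) \<le> cmod (lam i)" for i
    using assms(1) unfolding pswf_system_def by (auto intro: less_imp_le)
  thus "chi m \<le> chi n" "cmod (lam n) \<le> cmod (lam m)"
    using lift_Suc_mono_le[of chi m n] lift_Suc_antimono_le[of "\<lambda>i. cmod (lam i)" m n] assms(2) by auto
qed

theorem theorem62:
  fixes c :: real and psi :: "nat \<Rightarrow> real \<Rightarrow> real" and lam :: "nat \<Rightarrow> complex"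
    and chi :: "nat \<Rightarrow> real" and n m :: nat
  assumes "c > 30"
    and "pswf_system c psi lam chi"
    and "n > 0" and "m \<le> n - 1"
    and "real n > 2 * c / pi + 5"
  shows "\<bar>integral {-1..1} (psi m)
          - (\<Sum>t\<in>roots_in (psi n).
               psi m t * (integral {-1..1} (\<lambda>s. psi n s / (s - t)) / deriv (psi n) t))\<bar>
         \<le> cmod (lam n) * (24 * ln (1 / cmod (lam n)) + 6 * chi n)"
proof -
  have c: "c > 0" using assms(1) by simp
  have mn: "m \<le> n" using assms(4) by simp
  interpret N: prolate c "chi n" "lam n" "psi n" n by (rule pswf_prolate[OF c assms(2)])
  interpret M: prolate c "chi m" "lam m" "psi m" m by (rule pswf_prolate[OF c assms(2)])
  have sys: "finite (roots_in (psi n))" "card (roots_in (psi n)) = n" "\<And>t. t \<in> roots_in (psi n) \<Longrightarrow> deriv (psi n) t \<noteq> 0" "0 < chi i" for i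
    using assms(2) unfolding pswf_system_def by blast+
  have Z: "roots_in (psi n) = {t. -1 < t \<and> t < 1 \<and> N.g t = 0}"
    unfolding roots_in_def using N.g_eq by auto
  have simple: "N.g1 t \<noteq> 0" if "-1 < t" "t < 1" "N.g t = 0" for t
    using sys(3)[of t] N.g1_eq[of t] that unfolding Z by simp
  \<comment> \<open>If chi n were at most c^2, the n roots would exceed the admissible count 2 c /
    pi + 2.\<close>
  have high: "chi n > c\<^sup>2"
  proof (rule ccontr)
    assume "\<not> chi n > c\<^sup>2"
    hence "real (card (roots_in (psi n))) \<le> 2 * c / pi + 2"
      using sys(1) sys(4)[of n] simple assms(1) by (intro N.card_zeros_le[OF _ _ _ Z]) auto
    thus False using sys(2) assms(5) by simp
  qed
  interpret P: prolate_pair c "chi n" "lam n" "psi n" n "chi m" "lam m" "psi m" m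
    using high pswf_mono[OF assms(2) mn] by unfold_locales auto
  have "30\<^sup>2 < c\<^sup>2" using assms(1) by (intro power_strict_mono) auto
  hence ch: "chi n > 900" using high by simp
  have eq: "integral {-1..1} (psi m) - (\<Sum>t\<in>roots_in (psi n). psi m t * (integral {-1..1} (\<lambda>s. psi n s / (s - t)) / deriv (psi n) t))
    = integral {-1..1} M.g - (\<Sum>t | -1 < t \<and> t < 1 \<and> N.g t = 0. M.g t * (integral {-1..1} (\<lambda>s. N.g s / (s - t)) / N.g1 t))"
  proof (intro arg_cong2[where f = minus] sum.cong Z)
    show "integral {-1..1} (psi m) = integral {-1..1} M.g" by (rule integral_cong) (simp add: M.g_eq)
    fix t assume t: "t \<in> {t. -1 < t \<and> t < 1 \<and> N.g t = 0}"
    have "integral {-1..1} (\<lambda>s. psi n s / (s - t)) = integral {-1..1} (\<lambda>s. N.g s / (s - t))"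
      by (rule integral_cong) (simp add: N.g_eq)
    thus "psi m t * (integral {-1..1} (\<lambda>s. psi n s / (s - t)) / deriv (psi n) t) = M.g t * (integral {-1..1} (\<lambda>s. N.g s / (s - t)) / N.g1 t)"
      using t M.g_eq[of t] N.g1_eq[of t] by simp
  qed
  have "\<bar>integral {-1..1} M.g - (\<Sum>t | -1 < t \<and> t < 1 \<and> N.g t = 0. M.g t * (integral {-1..1} (\<lambda>s. N.g s / (s - t)) / N.g1 t))\<bar>
    \<le> cmod (lam n) * (6 * chi n - 30)"
  proof (cases "even m")
    case True
    show ?thesis by (rule P.error_bound_even[OF pswf_mono(2)[OF assms(2) mn] ch True less_imp_le[OF sys(4)] simple])
  next
    case False
    show ?thesis unfolding P.error_zero_odd[OF False] using ch by simp
  qed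
  \<comment> \<open>The reserve of 30 kept in the error bound pays for a possibly negative
    logarithm.\<close>
  also have "\<dots> \<le> cmod (lam n) * (24 * ln (1 / cmod (lam n)) + 6 * chi n)"
    using P.log_mu_ge by (intro mult_left_mono norm_ge_zero) linarith
  finally show ?thesis unfolding eq .
qed

end
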